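(* Let $\mathcal X$ be a non-empty finite set, $\mathcal A_x$ non-empty finite sets, $\mathcal Z=\{(x,a):x\in\mathcal X,a\in\mathcal A_x\}$, $P(x,a,\cdot)$ probability measures on $\mathcal X$, $S(x,a,y,\cdot)$ probability measures on $\mathbb R$ with finite second moments, and $\gamma\in[0,1/2)$. Consider Algorithm 2 (described in the context) with parameter $\theta\in(0,1]$ and initial law $\mu_0$ satisfying $\mu_0(x)>0$ for all $x\in\mathcal X$. Then almost surely, $\lim_{k\to\infty}V_{\bar\pi^k}(x)=V^*(x)$ for all $x\in\mathcal X$.
   Context: A (general) policy $\Pi=(\Pi_t)_{t\ge0}$ assigns to each history $h=(x_0,a_0,\dots,x_t)$ a probability $\Pi_t(h,\cdot)$ on $\mathcal A_{x_t}$; an SM policy is a family $\pi(x,\cdot)$ of probabilities on $\mathcal A_x$ used at every time. Given a start $x$ and a policy, $X_0=x$, $A_t$ drawn from the policy given the history, $X_{t+1}\sim P(X_t,A_t,\cdot)$ given the past, and conditionally on the state-action process the rewards $R_{t+1}\sim S(X_t,A_t,X_{t+1},\cdot)$ are independent. $G=\sum_{t\ge0}\gamma^tR_{t+1}$, $V_\Pi(x)=\mathbb E_{x,\Pi}[G]$, $V^*(x)=\sup_\Pi V_\Pi(x)$ over all policies. Algorithm 2 (first-visit Monte-Carlo). Fix $\theta>0$ and a law $\mu_0$ on $\mathcal X$; set $\bar Q^0\equiv0$. For $k\ge0$, given episodes $i=1,\dots,k$, $(X^i_0,A^i_0,X^i_1,R^i_1,A^i_1,\dots)$, and $\bar Q^k$,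 let $\tau^i_{x,a}=\inf\{t\ge0:(X^i_t,A^i_t)=(x,a)\}$ ($\inf\emptyset=\infty$), $N_k(x,a)=\sum_{i=1}^k\mathbf 1_{\{\tau^i_{x,a}<\infty\}}$, $N_k(x)=\sum_{a\in\mathcal A_x}N_k(x,a)$ (empty sums are $0$), $\varepsilon_k(x)=(1+N_k(x))^{-\theta}$ and $$\bar\pi^k(x,a)=\frac{\varepsilon_k(x)}{|\mathcal A_x|}+\mathbf 1_{\{a\in\arg\max\bar Q^k(x,\cdot)\}}\frac{1-\varepsilon_k(x)}{|\arg\max\bar Q^k(x,\cdot)|}.$$ Build episode $k+1$ with $X^{k+1}_0\sim\mu_0$ (independently of the past) and the SM policy $\bar\pi^k$. Then set $\bar Q^{k+1}(x,a)=\frac{\sum_{i=1}^{k+1}\mathbf 1_{\{\tau^i_{x,a}<\infty\}}G^i_{x,a}}{N_{k+1}(x,a)}$ (with $0/0=0$), where $G^i_{x,a}=\sum_{t\ge0}\gamma^tR^i_{\tau^i_{x,a}+t+1}$ ($G^i_{x,a}=0$ if $\tau^i_{x,a}=\infty$). *)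

theory Defs
  imports "HOL-Probability.Probability"
begin

definition mean_reward :: "('s \<Rightarrow> 'a \<Rightarrow> 's \<Rightarrow> real measure) \<Rightarrow> 's \<Rightarrow> 'a \<Rightarrow> 's \<Rightarrow> real" where
  "mean_reward S x a y = integral\<^sup>L (S x a y) (\<lambda>z. z)"

text \<open>A general (history dependent, randomised) policy: given the past state-action
 pairs h = [(x0,a0),...,(x_{t-1},a_{t-1})] and the current state x_t, it gives the probability
 weights of the actions in A x_t.\<close>

definition is_policy :: "('s \<Rightarrow> 'a set) \<Rightarrow> (('s \<times> 'a) list \<Rightarrow> 's \<Rightarrow> 'a \<Rightarrow> real) \<Rightarrow> bool" where
  "is_policy A Pol \<longleftrightarrow> (\<forall>h y. (\<forall>a\<in>A y. 0 \<le> Pol h y a) \<and> (\<Sum>a\<in>A y. Pol h y a) = 1)"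

definition sm_policy :: "('s \<Rightarrow> 'a \<Rightarrow> real) \<Rightarrow> ('s \<times> 'a) list \<Rightarrow> 's \<Rightarrow> 'a \<Rightarrow> real" where
  "sm_policy sp = (\<lambda>h y a. sp y a)"

text \<open>vfin n h y = expected value of the discounted return of the next n steps
 (sum_{t<n} gamma^t R_{t+1} of the continuation) from history h, current state y.\<close>
fun vfin :: "('s::finite \<Rightarrow> 'a set) \<Rightarrow> ('s \<Rightarrow> 'a \<Rightarrow> 's pmf) \<Rightarrow> ('s \<Rightarrow> 'a \<Rightarrow> 's \<Rightarrow> real measure)
    \<Rightarrow> real \<Rightarrow> (('s \<times> 'a) list \<Rightarrow> 's \<Rightarrow> 'a \<Rightarrow> real) \<Rightarrow> nat \<Rightarrow> ('s \<times> 'a) list \<Rightarrow> 's \<Rightarrow> real" where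
  "vfin A P S \<gamma> Pol 0 h y = 0"
| "vfin A P S \<gamma> Pol (Suc n) h y =
     (\<Sum>a\<in>A y. Pol h y a * (\<Sum>y'\<in>UNIV. pmf (P y a) y' *
         (mean_reward S y a y' + \<gamma> * vfin A P S \<gamma> Pol n (h @ [(y, a)]) y')))"

text \<open>V_Pi(x) = E_{x,Pol}[G] = lim_n E_{x,Pol}[sum_{t<n} gamma^t R_{t+1}].\<close>
definition Vpol :: "('s::finite \<Rightarrow> 'a set) \<Rightarrow> ('s \<Rightarrow> 'a \<Rightarrow> 's pmf) \<Rightarrow> ('s \<Rightarrow> 'a \<Rightarrow> 's \<Rightarrow> real measure)
    \<Rightarrow> real \<Rightarrow> (('s \<times> 'a) list \<Rightarrow> 's \<Rightarrow> 'a \<Rightarrow> real) \<Rightarrow> 's \<Rightarrow> real" where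
  "Vpol A P S \<gamma> Pol x = lim (\<lambda>n. vfin A P S \<gamma> Pol n [] x)"

definition Vstar :: "('s::finite \<Rightarrow> 'a set) \<Rightarrow> ('s \<Rightarrow> 'a \<Rightarrow> 's pmf) \<Rightarrow> ('s \<Rightarrow> 'a \<Rightarrow> 's \<Rightarrow> real measure)
    \<Rightarrow> real \<Rightarrow> 's \<Rightarrow> real" where
  "Vstar A P S \<gamma> x = (SUP Pol\<in>{Pol. is_policy A Pol}. Vpol A P S \<gamma> Pol x)"

text \<open>Episode data: X i t = X^i_t, Ac i t = A^i_t, R i t = R^i_t (t \<ge> 1), episodes i = 1,2,...\<close>

definition visits :: "(nat \<Rightarrow> nat \<Rightarrow> 's) \<Rightarrow> (nat \<Rightarrow> nat \<Rightarrow> 'a) \<Rightarrow> nat \<Rightarrow> 's \<Rightarrow> 'a \<Rightarrow> bool" where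
  "visits X Ac i x a \<longleftrightarrow> (\<exists>t. X i t = x \<and> Ac i t = a)"

definition first_visit :: "(nat \<Rightarrow> nat \<Rightarrow> 's) \<Rightarrow> (nat \<Rightarrow> nat \<Rightarrow> 'a) \<Rightarrow> nat \<Rightarrow> 's \<Rightarrow> 'a \<Rightarrow> nat" where
  "first_visit X Ac i x a = (LEAST t. X i t = x \<and> Ac i t = a)"

definition ret :: "real \<Rightarrow> (nat \<Rightarrow> nat \<Rightarrow> 's) \<Rightarrow> (nat \<Rightarrow> nat \<Rightarrow> 'a) \<Rightarrow> (nat \<Rightarrow> nat \<Rightarrow> real)
    \<Rightarrow> nat \<Rightarrow> 's \<Rightarrow> 'a \<Rightarrow> real" where
  "ret \<gamma> X Ac R i x a = (if visits X Ac i x a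
      then (\<Sum>t. \<gamma> ^ t * R i (first_visit X Ac i x a + t + 1)) else 0)"

definition Nvis :: "(nat \<Rightarrow> nat \<Rightarrow> 's) \<Rightarrow> (nat \<Rightarrow> nat \<Rightarrow> 'a) \<Rightarrow> nat \<Rightarrow> 's \<Rightarrow> 'a \<Rightarrow> nat" where
  "Nvis X Ac k x a = card {i\<in>{1..k}. visits X Ac i x a}"

definition Nst :: "('s \<Rightarrow> 'a set) \<Rightarrow> (nat \<Rightarrow> nat \<Rightarrow> 's) \<Rightarrow> (nat \<Rightarrow> nat \<Rightarrow> 'a) \<Rightarrow> nat \<Rightarrow> 's \<Rightarrow> nat" where
  "Nst A X Ac k x = (\<Sum>a\<in>A x. Nvis X Ac k x a)"

text \<open>Qbar^k (note x / 0 = 0 in Isabelle, so Qbar^0 = 0 and 0/0 = 0 as in the paper).\<close>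
definition Qbar :: "real \<Rightarrow> (nat \<Rightarrow> nat \<Rightarrow> 's) \<Rightarrow> (nat \<Rightarrow> nat \<Rightarrow> 'a) \<Rightarrow> (nat \<Rightarrow> nat \<Rightarrow> real)
    \<Rightarrow> nat \<Rightarrow> 's \<Rightarrow> 'a \<Rightarrow> real" where
  "Qbar \<gamma> X Ac R k x a = (\<Sum>i\<in>{1..k}. ret \<gamma> X Ac R i x a) / real (Nvis X Ac k x a)"

definition argmaxQ :: "('s \<Rightarrow> 'a set) \<Rightarrow> real \<Rightarrow> (nat \<Rightarrow> nat \<Rightarrow> 's) \<Rightarrow> (nat \<Rightarrow> nat \<Rightarrow> 'a)
    \<Rightarrow> (nat \<Rightarrow> nat \<Rightarrow> real) \<Rightarrow> nat \<Rightarrow> 's \<Rightarrow> 'a set" where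
  "argmaxQ A \<gamma> X Ac R k x = {a\<in>A x. \<forall>b\<in>A x. Qbar \<gamma> X Ac R k x b \<le> Qbar \<gamma> X Ac R k x a}"

definition eps :: "('s \<Rightarrow> 'a set) \<Rightarrow> real \<Rightarrow> (nat \<Rightarrow> nat \<Rightarrow> 's) \<Rightarrow> (nat \<Rightarrow> nat \<Rightarrow> 'a) \<Rightarrow> nat \<Rightarrow> 's \<Rightarrow> real" where
  "eps A \<theta> X Ac k x = (1 + real (Nst A X Ac k x)) powr (- \<theta>)"

definition pibar :: "('s \<Rightarrow> 'a set) \<Rightarrow> real \<Rightarrow> real \<Rightarrow> (nat \<Rightarrow> nat \<Rightarrow> 's) \<Rightarrow> (nat \<Rightarrow> nat \<Rightarrow> 'a)
    \<Rightarrow> (nat \<Rightarrow> nat \<Rightarrow> real) \<Rightarrow> nat \<Rightarrow> 's \<Rightarrow> 'a \<Rightarrow> real" where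
  "pibar A \<gamma> \<theta> X Ac R k x a = (if a \<in> A x then
      eps A \<theta> X Ac k x / real (card (A x))
      + (if a \<in> argmaxQ A \<gamma> X Ac R k x
         then (1 - eps A \<theta> X Ac k x) / real (card (argmaxQ A \<gamma> X Ac R k x)) else 0)
    else 0)"

definition past_sigma :: "'m measure \<Rightarrow> (nat \<Rightarrow> nat \<Rightarrow> 'm \<Rightarrow> 's) \<Rightarrow> (nat \<Rightarrow> nat \<Rightarrow> 'm \<Rightarrow> 'a)
    \<Rightarrow> (nat \<Rightarrow> nat \<Rightarrow> 'm \<Rightarrow> real) \<Rightarrow> nat \<Rightarrow> 'm measure" where
  "past_sigma M Xs As Rs k = sigma (space M)
     (\<Union>i\<in>{1..k}. \<Union>t. range (\<lambda>s. Xs i t -` {s} \<inter> space M)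
                     \<union> range (\<lambda>a. As i t -` {a} \<inter> space M)
                     \<union> (\<lambda>B. Rs i (Suc t) -` B \<inter> space M) ` sets borel)"

end

theory Submission
  imports Defs "HOL-Library.Discrete_Functions"
begin

text \<open>Given the past, a first-visit return in episode $k+1$ has mean $Q_{\bar\pi^k}(x,a)$, so
 $\bar Q^k$ is, up to a noise average, the average of the $Q_{\bar\pi^{i-1}}$ over the visiting
 episodes. The noise consists of orthogonal increments with bounded variance per visit, and
 every pair is visited infinitely often because the exploration rates are not summable
 (this uses $\theta\le 1$); hence the noise average vanishes.
 As $Q_\pi\le Q^*$, only the deficit $d=\limsup\max(Q^*-\bar Q^k)$ matters, and the error of
 $\bar Q^k$ is asymptotically one-sided. Acting greedily with respect to $\bar Q^k$ therefore
 loses at most $d/(1-\gamma)$ rather than $2d/(1-\gamma)$, and averaging gives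
 $d\le \frac{\gamma}{1-\gamma}\,d$, which forces $d=0$ when $\gamma<1/2$.\<close>

text \<open>The probabilistic input is \<open>algo\<close>, the joint law of finite beginnings of an
  episode on events of the past. The return after a first visit, however, is an infinite sum started
  at a random time, under a policy that is itself random. Each difficulty is removed separately:
  returns are cut to finitely many rewards, whose means come from backward induction over cylinders;
  a first visit is split into the disjoint events that it occurs at time s, each a finite union of
  cylinders; and every identity is integrated over an arbitrary past event, on which the policy
  weights stay under the integral. The denominator N_k(x,a) is random and may grow much more slowly
  than k. The noise therefore runs on the clock of its own visits, with variance charged per visit
  and not per episode. The condition \<open>\<theta> \<le> 1\<close> acts through N_k(x) <= |A_x| k:
  exploration is at least 1/(1 + |A_x| k), a divergent series. The factor gamma in the final
  contraction is gained in passing from values of states to values of pairs.\<close>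

lemma weighted_sum_le:
  fixes w f :: "'b \<Rightarrow> real"
  assumes "\<And>a. a \<in> B \<Longrightarrow> 0 \<le> w a" "(\<Sum>a\<in>B. w a) = 1" "\<And>a. a \<in> B \<Longrightarrow> f a \<le> c"
  shows "(\<Sum>a\<in>B. w a * f a) \<le> c"
proof -
  have "(\<Sum>a\<in>B. w a * f a) \<le> (\<Sum>a\<in>B. w a * c)"
    by (intro sum_mono mult_left_mono assms)
  also have "\<dots> = c" using assms(2) by (simp flip: sum_distrib_right)
  finally show ?thesis .
qed

lemma weighted_sum_abs_le:
  fixes w f :: "'b \<Rightarrow> real"
  assumes "\<And>a. a \<in> B \<Longrightarrow> 0 \<le> w a" "(\<Sum>a\<in>B. w a) = 1" "\<And>a. a \<in> B \<Longrightarrow> \<bar>f a\<bar> \<le> c"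
  shows "\<bar>\<Sum>a\<in>B. w a * f a\<bar> \<le> c"
proof -
  have "\<bar>\<Sum>a\<in>B. w a * f a\<bar> \<le> (\<Sum>a\<in>B. w a * \<bar>f a\<bar>)"
    by (rule order_trans[OF sum_abs]) (intro sum_mono, simp add: abs_mult assms(1))
  also have "\<dots> \<le> c" by (rule weighted_sum_le) (use assms in auto)
  finally show ?thesis .
qed

lemma sum_pmf_UNIV: "(\<Sum>y\<in>UNIV. pmf p (y::'b::finite)) = 1"
  by (rule sum_pmf_eq_1) auto

lemma convergent_of_geometric_increments:
  fixes f :: "nat \<Rightarrow> real"
  assumes "0 \<le> g" "g < 1" and inc: "\<And>n. \<bar>f (Suc n) - f n\<bar> \<le> C * g ^ n"
  shows "convergent f"
proof -
  have "summable (\<lambda>n. C * g ^ n)" using assms(1,2) by (intro summable_mult summable_geometric) auto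
  then have "summable (\<lambda>n. f (Suc n) - f n)"
    by (rule summable_comparison_test'[where N = 0]) (use inc in auto)
  then have "convergent (\<lambda>n. f n - f 0)"
    unfolding summable_iff_convergent sum_lessThan_telescope .
  then show ?thesis by (simp add: convergent_diff_const_right_iff)
qed

text \<open>Maxima are nonexpansive in the sup norm; this carries the contraction property of
  \<open>qval\<close> over to the Bellman optimality operator.\<close>

lemma abs_Max_image_diff_le:
  fixes f g :: "'b \<Rightarrow> real"
  assumes "finite B" "B \<noteq> {}" "\<And>a. a \<in> B \<Longrightarrow> \<bar>f a - g a\<bar> \<le> c"
  shows "\<bar>Max (f ` B) - Max (g ` B)\<bar> \<le> c"
proof -
  have 1: "Max (u ` B) \<le> Max (v ` B) + c" if "\<And>a. a \<in> B \<Longrightarrow> \<bar>u a - v a\<bar> \<le> c" for u v :: "'b \<Rightarrow> real"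
  proof (rule Max.boundedI)
    fix z assume "z \<in> u ` B"
    then obtain a where a: "a \<in> B" "z = u a" by auto
    have "v a \<le> Max (v ` B)" using assms a by simp
    then show "z \<le> Max (v ` B) + c" using that[OF a(1)] a(2) by auto
  qed (use assms in auto)
  have "Max (f ` B) \<le> Max (g ` B) + c" "Max (g ` B) \<le> Max (f ` B) + c"
    by (rule 1, use assms in force)+
  then show ?thesis by auto
qed

section \<open>Discounted Markov decision processes\<close>

locale mdp =
  fixes A :: "'s::finite \<Rightarrow> 'a set"
    and P :: "'s \<Rightarrow> 'a \<Rightarrow> 's pmf"
    and S :: "'s \<Rightarrow> 'a \<Rightarrow> 's \<Rightarrow> real measure"
    and \<gamma> :: real
  assumes A_fin: "\<And>x. finite (A x)" and A_ne: "\<And>x. A x \<noteq> {}"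
    and \<gamma>_nonneg: "0 \<le> \<gamma>" and \<gamma>_less_1: "\<gamma> < 1"
begin

text \<open>One-step lookahead with continuation value \<open>v\<close>: the action value of a
  policy for \<open>v = Vsm sp\<close>, the optimal action value for
  \<open>v = Vopt\<close>.\<close>

definition qval :: "('s \<Rightarrow> real) \<Rightarrow> 's \<Rightarrow> 'a \<Rightarrow> real" where
  "qval v x a = (\<Sum>y\<in>UNIV. pmf (P x a) y * (mean_reward S x a y + \<gamma> * v y))"

text \<open>A crude total over the finitely many admissible triples: it dominates each mean reward
  by positivity alone, and only boundedness matters later.\<close>

definition rbound :: real where
  "rbound = (\<Sum>x\<in>UNIV. \<Sum>a\<in>A x. \<Sum>y\<in>UNIV. \<bar>mean_reward S x a y\<bar>)"

abbreviation "vbound \<equiv> rbound / (1 - \<gamma>)"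

definition sm :: "('s \<Rightarrow> 'a \<Rightarrow> real) \<Rightarrow> bool" where
  "sm sp \<longleftrightarrow> (\<forall>y. (\<forall>a\<in>A y. 0 \<le> sp y a) \<and> (\<Sum>a\<in>A y. sp y a) = 1)"

abbreviation "Vsm sp \<equiv> Vpol A P S \<gamma> (sm_policy sp)"

lemma rbound: "a \<in> A x \<Longrightarrow> \<bar>mean_reward S x a y\<bar> \<le> rbound"
proof -
  assume a: "a \<in> A x"
  have "\<bar>mean_reward S x a y\<bar> \<le> (\<Sum>y\<in>UNIV. \<bar>mean_reward S x a y\<bar>)"
    by (rule member_le_sum[where f = "\<lambda>y. \<bar>mean_reward S x a y\<bar>"]) auto
  also have "\<dots> \<le> (\<Sum>a\<in>A x. \<Sum>y\<in>UNIV. \<bar>mean_reward S x a y\<bar>)"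
    by (rule member_le_sum[where f = "\<lambda>a. \<Sum>y\<in>UNIV. \<bar>mean_reward S x a y\<bar>"])
      (auto intro: sum_nonneg a A_fin)
  also have "\<dots> \<le> rbound"
    unfolding rbound_def
    by (rule member_le_sum[where f = "\<lambda>x. \<Sum>a\<in>A x. \<Sum>y\<in>UNIV. \<bar>mean_reward S x a y\<bar>"])
      (auto intro: sum_nonneg)
  finally show ?thesis .
qed

lemma rbound_nonneg: "0 \<le> rbound"
  unfolding rbound_def by (intro sum_nonneg) auto

lemma vbound_nonneg: "0 \<le> vbound"
  using rbound_nonneg \<gamma>_less_1 by simp

lemma qval_diff: "qval v x a - qval w x a = (\<Sum>y\<in>UNIV. pmf (P x a) y * (\<gamma> * (v y - w y)))"
  unfolding qval_def sum_subtractf[symmetric] by (intro sum.cong refl) (simp add: algebra_simps)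

text \<open>The one-sided form of the contraction estimate. The deficit argument bounds differences
  from above only, and an absolute value would lose the sign.\<close>

lemma qval_diff_le:
  assumes "\<And>y. v y - w y \<le> c"
  shows "qval v x a - qval w x a \<le> \<gamma> * c"
  unfolding qval_diff using assms \<gamma>_nonneg
  by (intro weighted_sum_le) (auto simp: sum_pmf_UNIV intro: mult_left_mono)

lemma qval_mono: "(\<And>y. v y \<le> w y) \<Longrightarrow> qval v x a \<le> qval w x a"
  using qval_diff_le[of v w 0 x a] by auto

lemma abs_qval_diff_le:
  assumes "\<And>y. \<bar>v y - w y\<bar> \<le> c"
  shows "\<bar>qval v x a - qval w x a\<bar> \<le> \<gamma> * c"
  unfolding qval_diff using assms \<gamma>_nonneg
  by (intro weighted_sum_abs_le) (auto simp: sum_pmf_UNIV abs_mult intro: mult_left_mono)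

lemma abs_qval_le:
  assumes "a \<in> A x" "\<And>y. \<bar>v y\<bar> \<le> vbound"
  shows "\<bar>qval v x a\<bar> \<le> vbound"
  unfolding qval_def
proof (rule weighted_sum_abs_le)
  fix y
  have "\<bar>mean_reward S x a y + \<gamma> * v y\<bar> \<le> rbound + \<gamma> * vbound"
    using rbound[OF assms(1), of y] mult_left_mono[OF assms(2)[of y] \<gamma>_nonneg] \<gamma>_nonneg
      abs_triangle_ineq[of "mean_reward S x a y" "\<gamma> * v y"]
    by (simp add: abs_mult)
  also have "\<dots> = vbound" using \<gamma>_less_1 by (simp add: field_simps)
  finally show "\<bar>mean_reward S x a y + \<gamma> * v y\<bar> \<le> vbound" .
qed (auto simp: sum_pmf_UNIV)

lemma tendsto_qval:
  assumes "\<And>y. ((\<lambda>n. v n y) \<longlongrightarrow> w y) F"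
  shows "((\<lambda>n. qval (v n) x a) \<longlongrightarrow> qval w x a) F"
  unfolding qval_def by (intro tendsto_intros assms)

lemma vfin_Suc: "vfin A P S \<gamma> Pol (Suc n) h y =
    (\<Sum>a\<in>A y. Pol h y a * qval (vfin A P S \<gamma> Pol n (h @ [(y, a)])) y a)"
  by (simp add: qval_def)

text \<open>The two horizons differ by a single reward, discounted by \<open>\<gamma> ^ n\<close>.
  The induction peels off the first action, which prolongs the history; hence the statement for all
  \<open>h\<close>.\<close>

lemma vfin_increment:
  assumes "is_policy A Pol"
  shows "\<bar>vfin A P S \<gamma> Pol (Suc n) h y - vfin A P S \<gamma> Pol n h y\<bar> \<le> rbound * \<gamma> ^ n"
proof (induction n arbitrary: h y)
  case 0
  show ?case using assms rbound
    by (auto simp: is_policy_def sum_pmf_UNIV intro!: weighted_sum_abs_le)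
next
  case (Suc n)
  have "\<bar>\<Sum>a\<in>A y. Pol h y a * (qval (vfin A P S \<gamma> Pol (Suc n) (h @ [(y, a)])) y a
      - qval (vfin A P S \<gamma> Pol n (h @ [(y, a)])) y a)\<bar> \<le> \<gamma> * (rbound * \<gamma> ^ n)"
    using assms by (intro weighted_sum_abs_le abs_qval_diff_le Suc) (auto simp: is_policy_def)
  then show ?case
    by (subst (1 2) vfin_Suc) (simp only: sum_subtractf[symmetric] right_diff_distrib[symmetric], simp add: ac_simps)
qed

lemma vfin_bounded:
  assumes "is_policy A Pol"
  shows "\<bar>vfin A P S \<gamma> Pol n h y\<bar> \<le> vbound"
proof (induction n arbitrary: h y)
  case 0
  then show ?case using vbound_nonneg by simp
next
  case (Suc n)
  show ?case unfolding vfin_Suc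
    using assms by (intro weighted_sum_abs_le abs_qval_le Suc) (auto simp: is_policy_def)
qed

lemma vfin_tendsto:
  assumes "is_policy A Pol"
  shows "(\<lambda>n. vfin A P S \<gamma> Pol n [] y) \<longlonglongrightarrow> Vpol A P S \<gamma> Pol y"
  unfolding Vpol_def convergent_LIMSEQ_iff[symmetric]
  using vfin_increment[OF assms] \<gamma>_nonneg \<gamma>_less_1 by (intro convergent_of_geometric_increments)

lemma Vpol_bounded:
  assumes "is_policy A Pol"
  shows "\<bar>Vpol A P S \<gamma> Pol y\<bar> \<le> vbound"
  by (rule LIMSEQ_le_const2[OF tendsto_rabs[OF vfin_tendsto[OF assms]]])
    (use vfin_bounded[OF assms] in auto)

lemma is_policy_sm: "sm sp \<Longrightarrow> is_policy A (sm_policy sp)"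
  by (auto simp: sm_def is_policy_def sm_policy_def)

text \<open>A stationary policy never looks at the history, so the recursion, which appends to it,
  closes up at the empty one.\<close>

lemma vfin_sm_history: "vfin A P S \<gamma> (sm_policy sp) n h = vfin A P S \<gamma> (sm_policy sp) n []"
proof (induction n arbitrary: h)
  case (Suc n)
  show ?case
  proof
    fix y
    show "vfin A P S \<gamma> (sm_policy sp) (Suc n) h y = vfin A P S \<gamma> (sm_policy sp) (Suc n) [] y"
      unfolding vfin_Suc Suc[of "_ @ _"] by (simp add: sm_policy_def)
  qed
qed auto

lemma vfin_sm_Suc: "vfin A P S \<gamma> (sm_policy sp) (Suc n) [] y =
    (\<Sum>a\<in>A y. sp y a * qval (vfin A P S \<gamma> (sm_policy sp) n []) y a)"
  unfolding vfin_Suc vfin_sm_history[of _ _ "_ @ _"] by (simp add: sm_policy_def)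

lemma Vsm_Bellman:
  assumes "sm sp"
  shows "Vsm sp y = (\<Sum>a\<in>A y. sp y a * qval (Vsm sp) y a)"
proof (rule LIMSEQ_unique)
  note lim = vfin_tendsto[OF is_policy_sm[OF assms]]
  show "(\<lambda>n. vfin A P S \<gamma> (sm_policy sp) (Suc n) [] y) \<longlonglongrightarrow> Vsm sp y"
    using lim by (rule LIMSEQ_Suc)
  show "(\<lambda>n. vfin A P S \<gamma> (sm_policy sp) (Suc n) [] y) \<longlonglongrightarrow> (\<Sum>a\<in>A y. sp y a * qval (Vsm sp) y a)"
    unfolding vfin_sm_Suc by (intro tendsto_sum tendsto_mult tendsto_const tendsto_qval lim)
qed

text \<open>At a state where \<open>W - Vsm sp\<close> attains its maximum m, one Bellman step gives
  m <= c + gamma m. The function \<open>W\<close> is arbitrary; it is later a fixed point of the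
  optimality operator, with c = 0 for an exactly greedy policy and c small for an approximately
  greedy one.\<close>

lemma Vsm_deficit_le:
  assumes sm: "sm sp" and c: "\<And>y. W y - (\<Sum>a\<in>A y. sp y a * qval W y a) \<le> c"
  shows "W y - Vsm sp y \<le> c / (1 - \<gamma>)"
proof -
  define m where "m = Max (range (\<lambda>y. W y - Vsm sp y))"
  have le_m: "W y - Vsm sp y \<le> m" for y unfolding m_def by (rule Max_ge) auto
  have "m \<in> range (\<lambda>y. W y - Vsm sp y)" unfolding m_def by (rule Max_in) auto
  then obtain y0 where y0: "m = W y0 - Vsm sp y0" by auto
  have "(\<Sum>a\<in>A y0. sp y0 a * (qval W y0 a - qval (Vsm sp) y0 a)) \<le> \<gamma> * m"
    using sm by (intro weighted_sum_le qval_diff_le le_m) (auto simp: sm_def)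
  then have "(\<Sum>a\<in>A y0. sp y0 a * qval W y0 a) - Vsm sp y0 \<le> \<gamma> * m"
    by (subst Vsm_Bellman[OF sm]) (simp add: right_diff_distrib sum_subtractf)
  then have "m - \<gamma> * m \<le> c" using c[of y0] y0 by linarith
  then have "m * (1 - \<gamma>) \<le> c" by (simp add: algebra_simps)
  then have "m \<le> c / (1 - \<gamma>)" using \<gamma>_less_1 by (simp add: field_simps)
  then show ?thesis using le_m[of y] by linarith
qed

section \<open>The optimality equation, obtained from value iteration\<close>

fun value_iteration :: "nat \<Rightarrow> 's \<Rightarrow> real" where
  "value_iteration 0 y = 0"
| "value_iteration (Suc n) y = Max (qval (value_iteration n) y ` A y)"

text \<open>A weighted mean of action values is at most their maximum, whatever the history. In this
  way history-dependent policies are dominated by a function of the state alone.\<close>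

lemma vfin_le_value_iteration:
  assumes "is_policy A Pol"
  shows "vfin A P S \<gamma> Pol n h y \<le> value_iteration n y"
proof (induction n arbitrary: h y)
  case (Suc n)
  show ?case unfolding vfin_Suc value_iteration.simps
  proof (rule weighted_sum_le)
    fix a assume a: "a \<in> A y"
    have "qval (vfin A P S \<gamma> Pol n (h @ [(y, a)])) y a \<le> qval (value_iteration n) y a"
      by (intro qval_mono Suc)
    also have "\<dots> \<le> Max (qval (value_iteration n) y ` A y)" using a A_fin by simp
    finally show "qval (vfin A P S \<gamma> Pol n (h @ [(y, a)])) y a \<le> \<dots>" .
  qed (use assms in \<open>auto simp: is_policy_def\<close>)
qed simp

lemma value_iteration_increment:
  "\<bar>value_iteration (Suc n) y - value_iteration n y\<bar> \<le> rbound * \<gamma> ^ n"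
proof (induction n arbitrary: y)
  case 0
  have "\<bar>qval (\<lambda>_. 0) y a - 0\<bar> \<le> rbound" if "a \<in> A y" for a
    unfolding qval_def using rbound[OF that] 
    by (auto simp: sum_pmf_UNIV intro!: weighted_sum_abs_le)
  then have "\<bar>Max (qval (\<lambda>_. 0) y ` A y) - Max ((\<lambda>_. 0) ` A y)\<bar> \<le> rbound"
    by (intro abs_Max_image_diff_le A_fin A_ne) auto
  moreover have "value_iteration 0 = (\<lambda>_. 0)" by auto
  moreover have "(\<lambda>_. 0 :: real) ` A y = {0}" using A_ne[of y] by auto
  ultimately show ?case by simp
next
  case (Suc n)
  have "\<bar>Max (qval (value_iteration (Suc n)) y ` A y) - Max (qval (value_iteration n) y ` A y)\<bar>
      \<le> \<gamma> * (rbound * \<gamma> ^ n)"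
    by (intro abs_Max_image_diff_le A_fin A_ne abs_qval_diff_le Suc)
  then show ?case by (simp add: ac_simps)
qed

lemma Bellman_optimality_solution:
  obtains W where "\<And>y. (\<lambda>n. value_iteration n y) \<longlonglongrightarrow> W y" "\<And>y. W y = Max (qval W y ` A y)"
proof -
  have "\<forall>y. \<exists>l. (\<lambda>n. value_iteration n y) \<longlonglongrightarrow> l"
  proof
    fix y
    have "convergent (\<lambda>n. value_iteration n y)"
      by (rule convergent_of_geometric_increments[OF \<gamma>_nonneg \<gamma>_less_1 value_iteration_increment])
    then show "\<exists>l. (\<lambda>n. value_iteration n y) \<longlonglongrightarrow> l" by (simp add: convergent_def)
  qed
  then obtain W where W: "\<And>y. (\<lambda>n. value_iteration n y) \<longlonglongrightarrow> W y" by metis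
  have "W y = Max (qval W y ` A y)" for y
  proof (rule LIMSEQ_unique)
    show "(\<lambda>n. value_iteration (Suc n) y) \<longlonglongrightarrow> W y" by (rule LIMSEQ_Suc[OF W])
    \<comment> \<open>On a finite state space the sum of the absolute errors can stand in for the
      sup norm: it dominates each of them and tends to 0 termwise.\<close>
    have "(\<lambda>n. \<Sum>y'\<in>UNIV. \<bar>value_iteration n y' - W y'\<bar>) \<longlonglongrightarrow> (\<Sum>y'\<in>UNIV. \<bar>W y' - W y'\<bar>)"
      by (intro tendsto_intros W)
    then have lim: "(\<lambda>n. \<gamma> * (\<Sum>y'\<in>UNIV. \<bar>value_iteration n y' - W y'\<bar>)) \<longlonglongrightarrow> 0"
      using tendsto_mult_right_zero by simp
    have le: "norm (value_iteration (Suc n) y - Max (qval W y ` A y))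
        \<le> \<gamma> * (\<Sum>y'\<in>UNIV. \<bar>value_iteration n y' - W y'\<bar>)" for n
      unfolding value_iteration.simps real_norm_def
      by (rule abs_Max_image_diff_le[OF A_fin A_ne abs_qval_diff_le],
          rule member_le_sum[where f = "\<lambda>y'. \<bar>value_iteration n y' - W y'\<bar>"]) auto
    have "(\<lambda>n. value_iteration (Suc n) y - Max (qval W y ` A y)) \<longlonglongrightarrow> 0"
      by (rule Lim_null_comparison[OF always_eventually lim]) (rule allI, rule le)
    then show "(\<lambda>n. value_iteration (Suc n) y) \<longlonglongrightarrow> Max (qval W y ` A y)"
      by (rule LIM_zero_cancel)
  qed
  with W show thesis by (rule that)
qed

abbreviation "Vopt \<equiv> Vstar A P S \<gamma>"

lemma sm_nonempty: "sm (\<lambda>y a. 1 / real (card (A y)))"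
  using A_fin A_ne by (auto simp: sm_def)

text \<open>Value iteration bounds every policy by its limit W. The deterministic policy that is
  greedy for W attains this bound, because its one-step deficit is 0 and
  \<open>Vsm_deficit_le\<close> applies. Hence the supremum is attained, equals W and inherits the
  fixed-point equation.\<close>

lemma Vopt_characterization:
  "Vopt y = Max (qval Vopt y ` A y)" "is_policy A Pol \<Longrightarrow> Vpol A P S \<gamma> Pol y \<le> Vopt y"
proof -
  obtain W where W: "\<And>y. (\<lambda>n. value_iteration n y) \<longlonglongrightarrow> W y" "\<And>y. W y = Max (qval W y ` A y)"
    using Bellman_optimality_solution by blast
  have le: "Vpol A P S \<gamma> Pol y \<le> W y" if "is_policy A Pol" for Pol y
    by (rule LIMSEQ_le[OF vfin_tendsto[OF that] W(1)]) (use vfin_le_value_iteration[OF that] in auto)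
  have "\<forall>y. \<exists>a. a \<in> A y \<and> qval W y a = W y"
  proof
    fix y
    have "Max (qval W y ` A y) \<in> qval W y ` A y" using A_fin A_ne by (intro Max_in) auto
    then show "\<exists>a. a \<in> A y \<and> qval W y a = W y" using W(2)[of y] by auto
  qed
  then obtain f where f: "\<And>y. f y \<in> A y" "\<And>y. qval W y (f y) = W y" by metis
  define sp where "sp = (\<lambda>y a. if a = f y then 1 else 0 :: real)"
  have sm: "sm sp" using f A_fin by (auto simp: sm_def sp_def)
  have "W y - Vsm sp y \<le> 0 / (1 - \<gamma>)" for y
    using f A_fin by (intro Vsm_deficit_le sm)
      (simp add: sp_def of_bool_def[symmetric] if_distrib[where f = "\<lambda>z. z * _"] sum.delta)
  then have eq: "Vsm sp y = W y" for y using le[OF is_policy_sm[OF sm], of y] by (simp add: order_antisym)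
  have "Vopt y = W y" for y
    unfolding Vstar_def
    by (rule cSup_eq_maximum) (use eq[of y] is_policy_sm[OF sm] le in \<open>force simp: image_iff\<close>)+
  then have "Vopt = W" by auto
  then show "Vopt y = Max (qval Vopt y ` A y)" "is_policy A Pol \<Longrightarrow> Vpol A P S \<gamma> Pol y \<le> Vopt y"
    using W le by auto
qed

lemma optimal_action: obtains a where "a \<in> A y" "qval Vopt y a = Vopt y"
proof -
  have "Max (qval Vopt y ` A y) \<in> qval Vopt y ` A y" using A_fin A_ne by (intro Max_in) auto
  then show thesis using that Vopt_characterization(1)[of y] by auto
qed

end

section \<open>Averages along visits and the contraction argument\<close>

text \<open>The count takes an arbitrary predicate on episode numbers, so that the averaging lemmas
  and the law of large numbers stay free of the decision process.\<close>

definition vcount :: "(nat \<Rightarrow> bool) \<Rightarrow> nat \<Rightarrow> nat" where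
  "vcount V k = card {i\<in>{1..k}. V i}"

text \<open>One-sided Cesaro argument along visits: finitely many terms exceed \<open>c\<close>,
  their total excess is at most the constant \<open>K\<close>, and \<open>e\<close> times the count
  eventually exceeds \<open>K\<close>.\<close>

lemma eventually_visit_average_le:
  fixes q :: "nat \<Rightarrow> real"
  assumes N: "filterlim (vcount V) at_top sequentially"
    and q: "\<forall>\<^sub>F i in sequentially. q i \<le> c" and e: "0 < e"
  shows "\<forall>\<^sub>F k in sequentially. (\<Sum>i\<in>{i\<in>{1..k}. V i}. q i) / real (vcount V k) \<le> c + e"
proof -
  from q obtain k0 where k0: "\<And>i. k0 \<le> i \<Longrightarrow> q i \<le> c" by (auto simp: eventually_sequentially)
  define K where "K = (\<Sum>i\<in>{..k0}. \<bar>q i - c\<bar>)"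
  have "\<forall>\<^sub>F k in sequentially. nat \<lceil>K / e\<rceil> + 1 \<le> vcount V k"
    using N unfolding filterlim_at_top by blast
  then show ?thesis
  proof eventually_elim
    case (elim k)
    let ?I = "{i\<in>{1..k}. V i}"
    have pos: "0 < real (vcount V k)" using elim by simp
    have "(\<Sum>i\<in>?I. q i) - c * real (vcount V k) = (\<Sum>i\<in>?I. q i - c)"
      by (simp add: sum_subtractf vcount_def)
    also have "\<dots> \<le> (\<Sum>i\<in>?I. if i \<le> k0 then \<bar>q i - c\<bar> else 0)"
      by (intro sum_mono) (use k0 in force)
    also have "\<dots> = (\<Sum>i\<in>?I \<inter> {..k0}. \<bar>q i - c\<bar>)"
      by (simp add: sum.inter_restrict)
    also have "\<dots> \<le> K" unfolding K_def by (intro sum_mono2) auto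
    also have "K \<le> e * real (vcount V k)"
    proof -
      have "K / e \<le> real (vcount V k)" using elim by linarith
      then show ?thesis using e by (simp add: field_simps)
    qed
    finally show ?case using pos by (simp add: field_simps)
  qed
qed

section \<open>Deterministic convergence of the policy values\<close>

context mdp begin

lemma Vopt_bounded: "\<bar>Vopt y\<bar> \<le> vbound"
proof -
  have "Vopt y \<le> vbound"
    unfolding Vstar_def
    by (rule cSUP_least) (use is_policy_sm[OF sm_nonempty] Vpol_bounded[of _ y] in \<open>auto simp: abs_le_iff\<close>)
  moreover have "- vbound \<le> Vopt y"
    using Vpol_bounded[OF is_policy_sm[OF sm_nonempty], of y]
      Vopt_characterization(2)[OF is_policy_sm[OF sm_nonempty], of y] by linarith
  ultimately show ?thesis by linarith
qed

text \<open>Free of probability: it is applied to one fixed outcome outside a null set. The index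
  \<open>i - 1\<close> occurs because episode \<open>i\<close> is run with the policy computed from
  the episodes before it. By \<open>nongreedy\<close>, \<open>sp k\<close> may split ties between
  maximizers of \<open>Q k\<close> in any way.\<close>

lemma Vsm_tends_to_Vopt:
  assumes \<gamma>: "\<gamma> < 1 / 2"
    and sm: "\<And>k. sm (sp k)"
    and N: "\<And>x a. a \<in> A x \<Longrightarrow> filterlim (vcount (\<lambda>i. V i x a)) at_top sequentially"
    and noise: "\<And>x a. a \<in> A x \<Longrightarrow> (\<lambda>k. Q k x a -
        (\<Sum>i\<in>{i\<in>{1..k}. V i x a}. qval (Vsm (sp (i - 1))) x a) / real (vcount (\<lambda>i. V i x a) k)) \<longlonglongrightarrow> 0"
    and nongreedy: "\<And>k y. (\<Sum>a\<in>{a\<in>A y. \<exists>b\<in>A y. Q k y a < Q k y b}. sp k y a) \<le> \<epsilon> k y"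
    and \<epsilon>: "\<And>y. (\<lambda>k. \<epsilon> k y) \<longlonglongrightarrow> 0"
  shows "(\<lambda>k. Vsm (sp k) y) \<longlonglongrightarrow> Vopt y"
proof -
  let ?q = "\<lambda>x a i. qval (Vsm (sp (i - 1))) x a"
  let ?avg = "\<lambda>x a k. (\<Sum>i\<in>{i\<in>{1..k}. V i x a}. ?q x a i) / real (vcount (\<lambda>i. V i x a) k)"
  have all: "(\<forall>\<^sub>F k in sequentially. \<forall>x. \<forall>a\<in>A x. R k x a)"
    if "\<And>x a. a \<in> A x \<Longrightarrow> \<forall>\<^sub>F k in sequentially. R k x a" for R
    using that A_fin by (intro eventually_all_finite) (auto intro!: eventually_ball_finite)
  have Vsm_le: "Vsm (sp k) y \<le> Vopt y" for k y
    by (intro Vopt_characterization is_policy_sm sm)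
  have noise': "\<forall>\<^sub>F k in sequentially. \<bar>Q k x a - ?avg x a k\<bar> < e" if "a \<in> A x" "0 < e" for x a e
    using tendstoD[OF noise[OF that(1)] that(2)] by (simp add: dist_real_def)
  have upper: "\<forall>\<^sub>F k in sequentially. \<forall>x. \<forall>a\<in>A x. Q k x a \<le> qval Vopt x a + e" if e: "0 < e" for e
  proof (rule all)
    fix x a assume a: "a \<in> A x"
    have "\<forall>\<^sub>F k in sequentially. ?avg x a k \<le> qval Vopt x a + e / 2"
      using e by (intro eventually_visit_average_le N a always_eventually) (auto intro!: qval_mono Vsm_le)
    moreover have "\<forall>\<^sub>F k in sequentially. \<bar>Q k x a - ?avg x a k\<bar> < e / 2"
      using a e by (intro noise') auto
    ultimately show "\<forall>\<^sub>F k in sequentially. Q k x a \<le> qval Vopt x a + e"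
      by eventually_elim linarith
  qed
  have lower: "\<forall>\<^sub>F k in sequentially. \<forall>x. \<forall>a\<in>A x. qval Vopt x a - Q k x a \<le> c + e"
    if e: "0 < e" and c: "\<forall>\<^sub>F k in sequentially. \<forall>x. \<forall>a\<in>A x. qval Vopt x a - qval (Vsm (sp k)) x a \<le> c" for e c
  proof (rule all)
    fix x a assume a: "a \<in> A x"
    \<comment> \<open>The upper averaging bound, applied to the negated action values, yields the
      lower one.\<close>
    have "\<forall>\<^sub>F k in sequentially. (\<Sum>i\<in>{i\<in>{1..k}. V i x a}. - ?q x a i) / real (vcount (\<lambda>i. V i x a) k)
        \<le> (c - qval Vopt x a) + e / 2"
    proof (rule eventually_visit_average_le[OF N[OF a]])
      have "\<forall>\<^sub>F i in sequentially. qval Vopt x a - qval (Vsm (sp i)) x a \<le> c"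
        using c by eventually_elim (use a in auto)
      then obtain i0 where i0: "\<And>i. i0 \<le> i \<Longrightarrow> qval Vopt x a - qval (Vsm (sp i)) x a \<le> c"
        by (auto simp: eventually_sequentially)
      \<comment> \<open>Term \<open>i\<close> uses policy \<open>i - 1\<close>, so a bound for
        policies from \<open>i0\<close> on covers the terms from \<open>Suc i0\<close> on.\<close>
      have "- ?q x a i \<le> c - qval Vopt x a" if "Suc i0 \<le> i" for i
      proof -
        have "i0 \<le> i - 1" using that by linarith
        from i0[OF this] show ?thesis by linarith
      qed
      then show "\<forall>\<^sub>F i in sequentially. - ?q x a i \<le> c - qval Vopt x a"
        unfolding eventually_sequentially by blast
    qed (use e in auto)
    moreover have "\<forall>\<^sub>F k in sequentially. \<bar>Q k x a - ?avg x a k\<bar> < e / 2"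
      using a e by (intro noise') auto
    ultimately show "\<forall>\<^sub>F k in sequentially. qval Vopt x a - Q k x a \<le> c + e"
      by eventually_elim (unfold sum_negf minus_divide_left[symmetric], linarith)
  qed
  have improve: "\<forall>\<^sub>F k in sequentially. \<forall>y. Vopt y - Vsm (sp k) y \<le> (d + e) / (1 - \<gamma>)"
    if d: "0 \<le> d" "\<forall>\<^sub>F k in sequentially. \<forall>x. \<forall>a\<in>A x. qval Vopt x a - Q k x a \<le> d" and e: "0 < e" for d e
  proof -
    \<comment> \<open>Every action loses at most \<open>2 * vbound\<close>, as both values are
      bounded by \<open>vbound\<close>; the added 1 makes \<open>K\<close> positive for the division
      below.\<close>
    define K where "K = 2 * vbound + 1"
    have K: "Vopt x - qval Vopt x a \<le> K" if "a \<in> A x" for x a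
      using abs_qval_le[OF that, of Vopt, OF Vopt_bounded] Vopt_bounded[of x]
      unfolding K_def abs_le_iff by linarith
    have K0: "0 < K" using vbound_nonneg by (simp add: K_def)
    have "\<forall>\<^sub>F k in sequentially. \<forall>y. \<epsilon> k y < e / 2 / K"
      using e K0 \<epsilon> by (intro eventually_all_finite) (auto intro!: order_tendstoD(2))
    moreover have "\<forall>\<^sub>F k in sequentially. \<forall>x. \<forall>a\<in>A x. Q k x a \<le> qval Vopt x a + e / 2"
      using e by (intro upper) auto
    ultimately show ?thesis using d(2)
    proof eventually_elim
      case (elim k)
      show ?case
      proof (intro allI Vsm_deficit_le sm)
        fix y
        define B where "B = {a\<in>A y. \<exists>b\<in>A y. Q k y a < Q k y b}"
        have B_sum: "(\<Sum>a\<in>A y. if a \<in> B then sp k y a * K else 0) = (\<Sum>a\<in>B. sp k y a) * K"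
          unfolding sum_distrib_right by (rule sum.mono_neutral_cong_right) (auto simp: B_def A_fin)
        obtain b where b: "b \<in> A y" "qval Vopt y b = Vopt y" by (rule optimal_action)
        have nn: "\<And>a. a \<in> A y \<Longrightarrow> 0 \<le> sp k y a" and one: "(\<Sum>a\<in>A y. sp k y a) = 1"
          using sm[of k] by (auto simp: sm_def)
        have "Vopt y - (\<Sum>a\<in>A y. sp k y a * qval Vopt y a) = (\<Sum>a\<in>A y. sp k y a * (Vopt y - qval Vopt y a))"
          using one by (simp add: right_diff_distrib sum_subtractf flip: sum_distrib_right)
        also have "\<dots> \<le> (\<Sum>a\<in>A y. sp k y a * (d + e / 2) + (if a \<in> B then sp k y a * K else 0))"
        proof (rule sum_mono)
          fix a assume a: "a \<in> A y"
          show "sp k y a * (Vopt y - qval Vopt y a) \<le> sp k y a * (d + e / 2) + (if a \<in> B then sp k y a * K else 0)"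
          proof (cases "a \<in> B")
            case True
            have "sp k y a * (Vopt y - qval Vopt y a) \<le> sp k y a * K"
              by (intro mult_left_mono K nn a)
            moreover have "0 \<le> sp k y a * (d + e / 2)" using nn[OF a] d(1) e by simp
            ultimately show ?thesis using True by simp
          next
            case False
            \<comment> \<open>An action outside \<open>B\<close> maximizes \<open>Q k y\<close>.
              Hence Vopt(y) = q(b) <= Q(b) + d <= Q(a) + d <= q(a) + d + e/2, with q the optimal
              action value: underestimating the optimal b costs d once, overestimating a costs only
              e/2.\<close>
            then have "Q k y b \<le> Q k y a" using a b by (auto simp: B_def not_less)
            moreover have "Vopt y - Q k y b \<le> d" using elim(3) b by metis
            moreover have "Q k y a \<le> qval Vopt y a + e / 2" using elim(2) a by auto
            ultimately have "Vopt y - qval Vopt y a \<le> d + e / 2" by linarith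
            from mult_left_mono[OF this nn[OF a]] False show ?thesis by simp
          qed
        qed
        also have "\<dots> = (d + e / 2) + (\<Sum>a\<in>B. sp k y a) * K"
          using one by (simp add: sum.distrib B_sum flip: sum_distrib_right)
        also have "\<dots> \<le> (d + e / 2) + (e / 2 / K) * K"
          using order_trans[OF nongreedy[of k y] less_imp_le[OF spec[OF elim(1), of y]]] K0
          by (intro add_left_mono mult_right_mono) (auto simp: B_def)
        also have "\<dots> = d + e" using K0 by simp
        finally show "Vopt y - (\<Sum>a\<in>A y. sp k y a * qval Vopt y a) \<le> d + e" .
      qed
    qed
  qed
  \<comment> \<open>The eventual upper bounds of the deficit; their infimum plays the role of the
    limit superior.\<close>
  define D where "D = {d. \<forall>\<^sub>F k in sequentially. \<forall>x. \<forall>a\<in>A x. qval Vopt x a - Q k x a \<le> d}"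
  define \<beta> where "\<beta> = \<gamma> / (1 - \<gamma>)"
  have \<beta>: "0 \<le> \<beta>" "\<beta> < 1" using \<gamma> \<gamma>_nonneg by (auto simp: \<beta>_def field_simps)
  \<comment> \<open>At any single pair \<open>upper\<close> keeps the deficit eventually above -e,
    so no eventual upper bound is negative.\<close>
  have D_nonneg: "0 \<le> d" if "d \<in> D" for d
  proof (rule field_le_epsilon)
    fix e :: real assume e: "0 < e"
    obtain x :: 's and a where a: "a \<in> A x" using A_ne by blast
    have "\<forall>\<^sub>F k in sequentially. 0 \<le> d + e"
      using upper[OF e] that[unfolded D_def mem_Collect_eq] by eventually_elim (use a in force)
    then show "0 \<le> d + e" by simp
  qed
  \<comment> \<open>\<open>improve\<close> costs the factor 1/(1 - gamma) and the lookahead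
    \<open>qval\<close> regains gamma, which together make \<open>\<beta>\<close>.\<close>
  have step: "\<beta> * (d + e) + e \<in> D" if "d \<in> D" "0 < e" for d e
  proof -
    have "\<forall>\<^sub>F k in sequentially. \<forall>y. Vopt y - Vsm (sp k) y \<le> (d + e) / (1 - \<gamma>)"
      using that D_nonneg by (intro improve) (auto simp: D_def)
    then have "\<forall>\<^sub>F k in sequentially. \<forall>x. \<forall>a\<in>A x. qval Vopt x a - qval (Vsm (sp k)) x a \<le> \<beta> * (d + e)"
    proof eventually_elim
      case (elim k)
      then show ?case using qval_diff_le[of Vopt "Vsm (sp k)" "(d + e) / (1 - \<gamma>)"] by (simp add: \<beta>_def)
    qed
    then show ?thesis using lower[OF that(2)] by (simp add: D_def)
  qed
  \<comment> \<open>The a priori bound on values gives one eventual bound, so that the infimum of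
    \<open>D\<close> is meaningful.\<close>
  have "2 * vbound + 1 \<in> D"
  proof -
    have "\<bar>qval Vopt x a\<bar> \<le> vbound" "\<bar>qval (Vsm (sp k)) x a\<bar> \<le> vbound" if "a \<in> A x" for x a k
      using that by (auto intro!: abs_qval_le Vopt_bounded Vpol_bounded is_policy_sm sm)
    then have "qval Vopt x a - qval (Vsm (sp k)) x a \<le> 2 * vbound" if "a \<in> A x" for x a k
      using that by (smt (verit) abs_le_iff)
    then show ?thesis using lower[of 1 "2 * vbound"] by (simp add: D_def)
  qed
  then have D_ne: "D \<noteq> {}" by auto
  have bdd: "bdd_below D" using D_nonneg by (intro bdd_belowI[of _ 0])
  have "Inf D \<le> 0"
  proof (rule ccontr)
    assume "\<not> Inf D \<le> 0"
    \<comment> \<open>Chosen so that the total slack \<open>e * (2 * \<beta> + 1)\<close> is half of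
      \<open>Inf D * (1 - \<beta>)\<close>, the amount that the contraction gains.\<close>
    define e where "e = Inf D * (1 - \<beta>) / (2 * (2 * \<beta> + 1))"
    have e: "0 < e" using \<open>\<not> Inf D \<le> 0\<close> \<beta> by (auto simp: e_def intro!: divide_pos_pos mult_pos_pos)
    have "Inf D < Inf D + e" using e by simp
    then obtain d where d: "d \<in> D" "d < Inf D + e" using cInf_lessD[OF D_ne] by blast
    have "Inf D \<le> \<beta> * (d + e) + e" by (rule cInf_lower[OF step[OF d(1) e] bdd])
    also have "\<dots> \<le> \<beta> * (Inf D + 2 * e) + e" using d(2) \<beta> by (intro add_right_mono mult_left_mono) auto
    finally have "Inf D * (1 - \<beta>) \<le> e * (2 * \<beta> + 1)" by (simp add: algebra_simps)
    also have "\<dots> = Inf D * (1 - \<beta>) / 2" using \<beta> by (simp add: e_def field_simps)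
    finally have "Inf D * (1 - \<beta>) \<le> 0" by simp
    moreover have "0 < Inf D * (1 - \<beta>)" using \<open>\<not> Inf D \<le> 0\<close> \<beta> by (intro mult_pos_pos) auto
    ultimately show False by linarith
  qed
  show ?thesis
  proof (rule tendstoI)
    fix e :: real assume e: "0 < e"
    define e' where "e' = e * (1 - \<gamma>) / 3"
    have e': "0 < e'" using e \<gamma>_less_1 by (simp add: e'_def)
    then have "Inf D < e'" using \<open>Inf D \<le> 0\<close> by simp
    then obtain d where d: "d \<in> D" "d < e'" using cInf_lessD[OF D_ne] by blast
    have ev: "\<forall>\<^sub>F k in sequentially. \<forall>y. Vopt y - Vsm (sp k) y \<le> (d + e') / (1 - \<gamma>)"
      using d e' D_nonneg by (intro improve) (auto simp: D_def)
    have lt: "(d + e') / (1 - \<gamma>) < e"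
    proof -
      have "d + e' < 3 * e'" using d e' by simp
      also have "\<dots> = e * (1 - \<gamma>)" by (simp add: e'_def)
      finally show ?thesis using \<gamma>_less_1 by (simp add: pos_divide_less_eq)
    qed
    from ev show "\<forall>\<^sub>F k in sequentially. dist (Vsm (sp k) y) (Vopt y) < e"
    proof eventually_elim
      case (elim k)
      then show ?case using Vsm_le[of k y] order.strict_trans1[OF spec[OF elim, of y] lt] by (simp add: dist_real_def)
    qed
  qed
qed

end

section \<open>A law of large numbers along visits\<close>

lemma vcount_0 [simp]: "vcount V 0 = 0"
  by (simp add: vcount_def)

lemma vcount_Suc: "vcount V (Suc k) = vcount V k + (if V (Suc k) then 1 else 0)"
proof -
  have "{i\<in>{1..Suc k}. V i} = (if V (Suc k) then insert (Suc k) {i\<in>{1..k}. V i} else {i\<in>{1..k}. V i})"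
    by (auto simp: le_Suc_eq)
  then show ?thesis by (simp add: vcount_def)
qed

lemma vcount_mono: "i \<le> j \<Longrightarrow> vcount V i \<le> vcount V j"
  by (induction j rule: nat_induct) (auto simp: vcount_Suc le_Suc_eq)

lemma measurable_vcount:
  assumes "\<And>i. 1 \<le> i \<Longrightarrow> i \<le> k \<Longrightarrow> Measurable.pred M (V i)"
  shows "(\<lambda>\<omega>. vcount (\<lambda>j. V j \<omega>) k) \<in> measurable M (count_space UNIV)"
  using assms
proof (induction k)
  case (Suc k)
  have [measurable]: "Measurable.pred M (V (Suc k))" "(\<lambda>\<omega>. vcount (\<lambda>j. V j \<omega>) k) \<in> measurable M (count_space UNIV)"
    using Suc by auto
  show ?case unfolding vcount_Suc by measurable
qed simp

text \<open>If episode i + 1 is a visit, it is visit number \<open>vcount V i + 1\<close>. So the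
  condition \<open>vcount V i < n\<close> picks exactly the first \<open>n\<close> visits.\<close>

lemma card_visits_below: "card {i. i < K \<and> vcount V i < n \<and> V (Suc i)} = min n (vcount V K)"
proof (induction K)
  case (Suc K)
  have "{i. i < Suc K \<and> vcount V i < n \<and> V (Suc i)} =
    (if vcount V K < n \<and> V (Suc K) then insert K {i. i < K \<and> vcount V i < n \<and> V (Suc i)}
     else {i. i < K \<and> vcount V i < n \<and> V (Suc i)})"
    by (auto simp: less_Suc_eq)
  then show ?case using Suc by (auto simp: vcount_Suc)
qed simp

lemma card_visits_window_le:
  assumes "m \<le> n"
  shows "card {i. i < K \<and> m \<le> vcount V i \<and> vcount V i < n \<and> V (Suc i)} \<le> n - m"
proof -
  let ?B = "\<lambda>n. {i. i < K \<and> vcount V i < n \<and> V (Suc i)}"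
  have eq: "{i. i < K \<and> m \<le> vcount V i \<and> vcount V i < n \<and> V (Suc i)} = ?B n - ?B m"
    using assms by auto
  have "card (?B n - ?B m) = card (?B n) - card (?B m)"
    using assms by (intro card_Diff_subset) auto
  then show ?thesis unfolding eq card_visits_below using assms by auto
qed

text \<open>Equality on all events of the subalgebra means equal conditional expectations, which
  extends to measurable factors. Only the products must be integrable, so unbounded factors are
  allowed; \<open>orthogonality\<close> needs these.\<close>

lemma (in finite_measure_subalgebra) integral_mult_eqI:
  fixes \<phi> f h :: "'a \<Rightarrow> real"
  assumes f: "integrable M f" and h: "integrable M h"
    and eq: "\<And>E. E \<in> sets F \<Longrightarrow> (\<integral>x. indicator E x * f x \<partial>M) = (\<integral>x. indicator E x * h x \<partial>M)"
    and \<phi> [measurable]: "\<phi> \<in> borel_measurable F"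
    and int: "integrable M (\<lambda>x. \<phi> x * f x)" "integrable M (\<lambda>x. \<phi> x * h x)"
  shows "(\<integral>x. \<phi> x * f x \<partial>M) = (\<integral>x. \<phi> x * h x \<partial>M)"
proof -
  have [measurable]: "f \<in> borel_measurable M" "h \<in> borel_measurable M"
    "\<phi> \<in> borel_measurable M"
    using f h measurable_from_subalg[OF subalg \<phi>] by auto
  have "AE x in M. real_cond_exp M F f x = real_cond_exp M F h x"
  proof (rule real_cond_exp_charact)
    fix E assume E: "E \<in> sets F"
    have "(LINT x:E|M. f x) = (LINT x:E|M. h x)"
      using eq[OF E] by (simp add: set_lebesgue_integral_def)
    also have "\<dots> = (LINT x:E|M. real_cond_exp M F h x)"
      by (rule real_cond_exp_intA[OF h E])
    finally show "(LINT x:E|M. f x) = (LINT x:E|M. real_cond_exp M F h x)" .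
  qed (use f h in auto)
  then have "(\<integral>x. \<phi> x * real_cond_exp M F f x \<partial>M) = (\<integral>x. \<phi> x * real_cond_exp M F h x \<partial>M)"
    by (intro integral_cong_AE) auto
  then show ?thesis using real_cond_exp_intg(2) int by simp
qed

text \<open>\<open>F k\<close> is the information after \<open>k\<close> episodes, and conditional
  statements are phrased as integrals over its events. Essential is that \<open>D_var\<close>
  charges variance in proportion to the probability of a visit: this permits counting in visits
  instead of episodes.\<close>

locale visit_noise = prob_space M for M :: "'m measure" +
  fixes F :: "nat \<Rightarrow> 'm measure" and D :: "nat \<Rightarrow> 'm \<Rightarrow> real" and V :: "nat \<Rightarrow> 'm \<Rightarrow> bool" and C :: real
  assumes F_sub: "\<And>k. subalgebra M (F k)"
    and D_meas_F: "\<And>i k. 1 \<le> i \<Longrightarrow> i \<le> k \<Longrightarrow> D i \<in> borel_measurable (F k)"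
    and V_meas_F: "\<And>i k. 1 \<le> i \<Longrightarrow> i \<le> k \<Longrightarrow> Measurable.pred (F k) (V i)"
    and D_sq: "\<And>k. integrable M (\<lambda>\<omega>. (D (Suc k) \<omega>)\<^sup>2)"
    and D_mean: "\<And>k E. E \<in> sets (F k) \<Longrightarrow> (\<integral>\<omega>. indicator E \<omega> * D (Suc k) \<omega> \<partial>M) = 0"
    and D_var: "\<And>k E. E \<in> sets (F k) \<Longrightarrow>
        (\<integral>\<omega>. indicator E \<omega> * (D (Suc k) \<omega>)\<^sup>2 \<partial>M) \<le> C * (\<integral>\<omega>. indicator E \<omega> * of_bool (V (Suc k) \<omega>) \<partial>M)"
    and D_off: "\<And>k \<omega>. \<not> V (Suc k) \<omega> \<Longrightarrow> D (Suc k) \<omega> = 0"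
    and C_nonneg: "0 \<le> C"
begin

abbreviation "N i \<omega> \<equiv> vcount (\<lambda>j. V j \<omega>) i"

lemma D_measurable [measurable]: "D (Suc k) \<in> borel_measurable M"
  by (rule measurable_from_subalg[OF F_sub D_meas_F[of "Suc k" "Suc k"]]) auto

lemma V_measurable [measurable]: "Measurable.pred M (V (Suc k))"
  by (rule measurable_from_subalg[OF F_sub V_meas_F[of "Suc k" "Suc k"]]) auto

lemma N_measurable_F: "i \<le> k \<Longrightarrow> (\<lambda>\<omega>. N i \<omega>) \<in> measurable (F k) (count_space UNIV)"
  by (rule measurable_vcount) (auto intro: V_meas_F)

lemma N_measurable [measurable]: "(\<lambda>\<omega>. N i \<omega>) \<in> measurable M (count_space UNIV)"
  by (rule measurable_from_subalg[OF F_sub N_measurable_F[of i i]]) auto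

section \<open>Orthogonal increments and second moments on blocks of visits\<close>

lemma integrable_mult_of_squares:
  fixes f g :: "'m \<Rightarrow> real"
  assumes [measurable]: "f \<in> borel_measurable M" "g \<in> borel_measurable M"
    and "integrable M (\<lambda>\<omega>. (f \<omega>)\<^sup>2)" "integrable M (\<lambda>\<omega>. (g \<omega>)\<^sup>2)"
  shows "integrable M (\<lambda>\<omega>. f \<omega> * g \<omega>)"
proof (rule Bochner_Integration.integrable_bound[OF Bochner_Integration.integrable_add[OF assms(3,4)]])
  show "AE x in M. norm (f x * g x) \<le> norm ((f x)\<^sup>2 + (g x)\<^sup>2)"
  proof (rule AE_I2)
    fix x
    have "2 * (\<bar>f x\<bar> * \<bar>g x\<bar>) \<le> (f x)\<^sup>2 + (g x)\<^sup>2"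
      using sum_squares_bound[of "\<bar>f x\<bar>" "\<bar>g x\<bar>"] by simp
    then show "norm (f x * g x) \<le> norm ((f x)\<^sup>2 + (g x)\<^sup>2)"
      by (simp add: abs_mult) (smt (verit) mult_nonneg_nonneg abs_ge_zero)
  qed
qed measurable

lemma orthogonality:
  assumes meas: "S \<in> borel_measurable (F k)" and sq: "integrable M (\<lambda>\<omega>. (S \<omega>)\<^sup>2)"
  shows "(\<integral>\<omega>. S \<omega> * D (Suc k) \<omega> \<partial>M) = 0"
proof -
  interpret finite_measure_subalgebra M "F k" by standard (rule F_sub)
  have [measurable]: "S \<in> borel_measurable M" using measurable_from_subalg[OF F_sub meas] .
  have "integrable M (D (Suc k))"
    using integrable_mult_of_squares[of "\<lambda>_. 1" "D (Suc k)"] D_sq by simp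
  then have "(\<integral>\<omega>. S \<omega> * D (Suc k) \<omega> \<partial>M) = (\<integral>\<omega>. S \<omega> * 0 \<partial>M)"
  proof (rule integral_mult_eqI)
    show "integrable M (\<lambda>\<omega>. S \<omega> * D (Suc k) \<omega>)"
      by (intro integrable_mult_of_squares sq D_sq) auto
  qed (use meas D_mean in auto)
  then show ?thesis by simp
qed

text \<open>The visits are cut into blocks from number $j^2$ to $(j+1)^2$: \<open>U\<close> is the noise accumulated
 before a block and \<open>G\<close> bounds, by Cauchy-Schwarz, all that the block can add. Blocks of this
 length make second moments summable without any maximal inequality.\<close>

definition U :: "nat \<Rightarrow> nat \<Rightarrow> 'm \<Rightarrow> real" where
  "U n K \<omega> = (\<Sum>i<K. if N i \<omega> < n then D (Suc i) \<omega> else 0)"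

definition G :: "nat \<Rightarrow> nat \<Rightarrow> nat \<Rightarrow> 'm \<Rightarrow> real" where
  "G m n K \<omega> = (\<Sum>i<K. if m \<le> N i \<omega> \<and> N i \<omega> < n then \<bar>D (Suc i) \<omega>\<bar> else 0)"

lemma U_measurable_F: "U n K \<in> borel_measurable (F K)"
  unfolding U_def
proof (intro borel_measurable_sum)
  fix i assume "i \<in> {..<K}"
  then have [measurable]: "D (Suc i) \<in> borel_measurable (F K)" "(\<lambda>\<omega>. N i \<omega>) \<in> measurable (F K) (count_space UNIV)"
    using D_meas_F N_measurable_F by auto
  show "(\<lambda>x. if N i x < n then D (Suc i) x else 0) \<in> borel_measurable (F K)" by measurable
qed

lemma U_measurable [measurable]: "U n K \<in> borel_measurable M"
  unfolding U_def by measurable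

lemma G_measurable [measurable]: "G m n K \<in> borel_measurable M"
  unfolding G_def by measurable

text \<open>Whether episode i + 1 falls into the window is decided by the count \<open>N i\<close>,
  hence by \<open>F i\<close>; so the window is an admissible event for
  \<open>D_var\<close>.\<close>

lemma D_window_var:
  "integrable M (\<lambda>\<omega>. (if m \<le> N i \<omega> \<and> N i \<omega> < n then D (Suc i) \<omega> else 0)\<^sup>2)" (is ?int)
  "(\<integral>\<omega>. (if m \<le> N i \<omega> \<and> N i \<omega> < n then D (Suc i) \<omega> else 0)\<^sup>2 \<partial>M)
    \<le> C * (\<integral>\<omega>. of_bool (m \<le> N i \<omega> \<and> N i \<omega> < n \<and> V (Suc i) \<omega>) \<partial>M)" (is ?le)
proof -
  show ?int
    by (rule Bochner_Integration.integrable_bound[OF D_sq[of i]]) auto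
  define E where "E = {\<omega>\<in>space M. m \<le> N i \<omega> \<and> N i \<omega> < n}"
  have sp: "space (F i) = space M" using F_sub by (simp add: subalgebra_def)
  have [measurable]: "(\<lambda>\<omega>. N i \<omega>) \<in> measurable (F i) (count_space UNIV)" by (rule N_measurable_F) simp
  have E: "E \<in> sets (F i)" unfolding E_def sp[symmetric] by measurable
  have "(\<integral>\<omega>. (if m \<le> N i \<omega> \<and> N i \<omega> < n then D (Suc i) \<omega> else 0)\<^sup>2 \<partial>M) = (\<integral>\<omega>. indicator E \<omega> * (D (Suc i) \<omega>)\<^sup>2 \<partial>M)"
    by (intro Bochner_Integration.integral_cong refl) (auto simp: E_def indicator_def)
  also have "\<dots> \<le> C * (\<integral>\<omega>. indicator E \<omega> * of_bool (V (Suc i) \<omega>) \<partial>M)" by (rule D_var[OF E])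
  also have "(\<integral>\<omega>. indicator E \<omega> * of_bool (V (Suc i) \<omega>) \<partial>M) = (\<integral>\<omega>. (of_bool (m \<le> N i \<omega> \<and> N i \<omega> < n \<and> V (Suc i) \<omega>) :: real) \<partial>M)"
    by (intro Bochner_Integration.integral_cong refl) (auto simp: E_def indicator_def)
  finally show ?le .
qed

text \<open>The visit indicators are summed under the integral, where at most \<open>n - m\<close>
  visits fall into the window for every outcome. The bound is thus free of \<open>K\<close>.\<close>

lemma window_count:
  assumes "m \<le> n"
  shows "(\<Sum>i<K. (\<integral>\<omega>. (if m \<le> N i \<omega> \<and> N i \<omega> < n then D (Suc i) \<omega> else 0)\<^sup>2 \<partial>M)) \<le> C * real (n - m)"
proof -
  have int: "integrable M (\<lambda>\<omega>. of_bool (m \<le> N i \<omega> \<and> N i \<omega> < n \<and> V (Suc i) \<omega>) :: real)" for i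
    by (rule integrable_const_bound[of _ 1]) auto
  have "(\<Sum>i<K. (\<integral>\<omega>. (if m \<le> N i \<omega> \<and> N i \<omega> < n then D (Suc i) \<omega> else 0)\<^sup>2 \<partial>M))
      \<le> (\<Sum>i<K. C * (\<integral>\<omega>. of_bool (m \<le> N i \<omega> \<and> N i \<omega> < n \<and> V (Suc i) \<omega>) \<partial>M))"
    by (intro sum_mono D_window_var)
  also have "\<dots> = C * (\<integral>\<omega>. (\<Sum>i<K. of_bool (m \<le> N i \<omega> \<and> N i \<omega> < n \<and> V (Suc i) \<omega>)) \<partial>M)"
    unfolding sum_distrib_left[symmetric] by (subst Bochner_Integration.integral_sum[OF int]) (rule refl)
  also have "(\<lambda>\<omega>. \<Sum>i<K. of_bool (m \<le> N i \<omega> \<and> N i \<omega> < n \<and> V (Suc i) \<omega>) :: real)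
      = (\<lambda>\<omega>. real (card {i. i < K \<and> m \<le> N i \<omega> \<and> N i \<omega> < n \<and> V (Suc i) \<omega>}))"
    by (auto simp: of_bool_def sum.If_cases Int_def)
  also have "(\<integral>\<omega>. real (card {i. i < K \<and> m \<le> N i \<omega> \<and> N i \<omega> < n \<and> V (Suc i) \<omega>}) \<partial>M) \<le> (\<integral>\<omega>. real (n - m) \<partial>M)"
  proof (rule Bochner_Integration.integral_mono_AE')
    show "AE \<omega> in M. real (card {i. i < K \<and> m \<le> N i \<omega> \<and> N i \<omega> < n \<and> V (Suc i) \<omega>}) \<le> real (n - m)"
      using assms by (intro AE_I2 of_nat_mono card_visits_window_le)
  qed auto
  also have "\<dots> = real (n - m)" by (simp add: prob_space)
  finally show ?thesis using C_nonneg by (simp add: mult_left_mono)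
qed

text \<open>The sum is cut off after visit number \<open>n\<close>. Its past part is
  \<open>F K\<close>-measurable, so the cross term with the next increment vanishes by
  \<open>orthogonality\<close> and only the window variances remain.\<close>

lemma U_second_moment:
  "integrable M (\<lambda>\<omega>. (U n K \<omega>)\<^sup>2)" "(\<integral>\<omega>. (U n K \<omega>)\<^sup>2 \<partial>M) \<le> C * real n"
proof -
  let ?d = "\<lambda>i \<omega>. if 0 \<le> N i \<omega> \<and> N i \<omega> < n then D (Suc i) \<omega> else 0"
  have "integrable M (\<lambda>\<omega>. (U n K \<omega>)\<^sup>2) \<and> (\<integral>\<omega>. (U n K \<omega>)\<^sup>2 \<partial>M) = (\<Sum>i<K. \<integral>\<omega>. (?d i \<omega>)\<^sup>2 \<partial>M)"
  proof (induction K)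
    case 0
    show ?case by (simp add: U_def)
  next
    case (Suc K)
    \<comment> \<open>The cut-off indicator is moved to the past factor, which leaves
      \<open>D (Suc K)\<close> itself for \<open>orthogonality\<close>.\<close>
    let ?S = "\<lambda>\<omega>. (if N K \<omega> < n then U n K \<omega> else 0)"
    have [measurable]: "(\<lambda>\<omega>. N K \<omega>) \<in> measurable (F K) (count_space UNIV)" "U n K \<in> borel_measurable (F K)"
      by (auto intro: N_measurable_F U_measurable_F)
    have S_sq: "integrable M (\<lambda>\<omega>. (?S \<omega>)\<^sup>2)"
      by (rule Bochner_Integration.integrable_bound[OF conjunct1[OF Suc]]) auto
    have SD: "integrable M (\<lambda>\<omega>. ?S \<omega> * D (Suc K) \<omega>)"
      by (intro integrable_mult_of_squares D_sq S_sq) auto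
    have zero: "(\<integral>\<omega>. ?S \<omega> * D (Suc K) \<omega> \<partial>M) = 0"
      by (rule orthogonality[OF _ S_sq]) measurable
    have eq: "(\<lambda>\<omega>. (U n (Suc K) \<omega>)\<^sup>2) = (\<lambda>\<omega>. (U n K \<omega>)\<^sup>2 + 2 * (?S \<omega> * D (Suc K) \<omega>) + (?d K \<omega>)\<^sup>2)"
      by (auto simp: U_def power2_eq_square algebra_simps)
    show ?case unfolding eq using Suc SD zero D_window_var(1)[of 0 K n] by simp
  qed
  then show "integrable M (\<lambda>\<omega>. (U n K \<omega>)\<^sup>2)" "(\<integral>\<omega>. (U n K \<omega>)\<^sup>2 \<partial>M) \<le> C * real n"
    using window_count[of 0 n K] by auto
qed

text \<open>At most \<open>n - m\<close> terms are nonzero, so Cauchy-Schwarz puts a factor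
  \<open>n - m\<close> on top of the summed variances. Since \<open>G\<close> adds absolute values,
  one bound serves all partial sums within the block.\<close>

lemma G_second_moment:
  assumes "m \<le> n"
  shows "integrable M (\<lambda>\<omega>. (G m n K \<omega>)\<^sup>2)" "(\<integral>\<omega>. (G m n K \<omega>)\<^sup>2 \<partial>M) \<le> C * (real (n - m))\<^sup>2"
proof -
  let ?d = "\<lambda>i \<omega>. if m \<le> N i \<omega> \<and> N i \<omega> < n then D (Suc i) \<omega> else 0"
  have int: "integrable M (\<lambda>\<omega>. real (n - m) * (\<Sum>i<K. (?d i \<omega>)\<^sup>2))"
    using D_window_var(1) by (intro integrable_mult_right Bochner_Integration.integrable_sum)
  have le: "(G m n K \<omega>)\<^sup>2 \<le> real (n - m) * (\<Sum>i<K. (?d i \<omega>)\<^sup>2)" for \<omega>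
  proof -
    let ?I = "{i. i < K \<and> m \<le> N i \<omega> \<and> N i \<omega> < n \<and> V (Suc i) \<omega>}"
    have "G m n K \<omega> = (\<Sum>i\<in>?I. \<bar>D (Suc i) \<omega>\<bar>)"
      unfolding G_def using D_off by (intro sum.mono_neutral_cong_right) auto
    then have "(G m n K \<omega>)\<^sup>2 \<le> (\<Sum>i\<in>?I. \<bar>D (Suc i) \<omega>\<bar>\<^sup>2) * real (card ?I)"
      using sum_squared_le_sum_of_squares[of "\<lambda>i. \<bar>D (Suc i) \<omega>\<bar>" ?I] by simp
    also have "\<dots> \<le> (\<Sum>i\<in>?I. \<bar>D (Suc i) \<omega>\<bar>\<^sup>2) * real (n - m)"
      using assms by (intro mult_left_mono of_nat_mono card_visits_window_le sum_nonneg) auto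
    also have "(\<Sum>i\<in>?I. \<bar>D (Suc i) \<omega>\<bar>\<^sup>2) = (\<Sum>i<K. (?d i \<omega>)\<^sup>2)"
      using D_off by (intro sum.mono_neutral_cong_left) auto
    finally show ?thesis by (simp add: mult.commute)
  qed
  show "integrable M (\<lambda>\<omega>. (G m n K \<omega>)\<^sup>2)"
    by (rule Bochner_Integration.integrable_bound[OF int]) (use le in \<open>auto intro!: order_trans[OF le]\<close>)
  have "(\<integral>\<omega>. (G m n K \<omega>)\<^sup>2 \<partial>M) \<le> (\<integral>\<omega>. real (n - m) * (\<Sum>i<K. (?d i \<omega>)\<^sup>2) \<partial>M)"
    by (rule Bochner_Integration.integral_mono) (use int le \<open>integrable M (\<lambda>\<omega>. (G m n K \<omega>)\<^sup>2)\<close> in auto)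
  also have "\<dots> = real (n - m) * (\<Sum>i<K. \<integral>\<omega>. (?d i \<omega>)\<^sup>2 \<partial>M)"
    using D_window_var(1) by (simp add: Bochner_Integration.integral_sum)
  also have "\<dots> \<le> real (n - m) * (C * real (n - m))"
    by (intro mult_left_mono window_count assms) auto
  finally show "(\<integral>\<omega>. (G m n K \<omega>)\<^sup>2 \<partial>M) \<le> C * (real (n - m))\<^sup>2" by (simp add: power2_eq_square ac_simps)
qed

text \<open>The squares of both contributions to the noise, divided by j^4 because the count is at
  least j^2 throughout block j. The expectations of the numerators are of order j^2 and (2j + 1)^2,
  so that of the quotient is of order 1/j^2.\<close>

definition Z :: "nat \<Rightarrow> nat \<Rightarrow> 'm \<Rightarrow> real" where
  "Z j K \<omega> = ((U (j\<^sup>2) K \<omega>)\<^sup>2 + (G (j\<^sup>2) ((Suc j)\<^sup>2) K \<omega>)\<^sup>2) / real (j\<^sup>2) ^ 2"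

lemma Z_integral:
  assumes j: "1 \<le> j"
  shows "(\<integral>\<^sup>+\<omega>. ennreal (Z j K \<omega>) \<partial>M) \<le> ennreal (10 * C / (real j)\<^sup>2)"
proof -
  have "(\<integral>\<^sup>+\<omega>. ennreal (Z j K \<omega>) \<partial>M) = ennreal (\<integral>\<omega>. Z j K \<omega> \<partial>M)"
    unfolding Z_def using U_second_moment(1) G_second_moment(1)[of "j\<^sup>2" "(Suc j)\<^sup>2"]
    by (intro nn_integral_eq_integral) auto
  also have "(\<integral>\<omega>. Z j K \<omega> \<partial>M)
      = ((\<integral>\<omega>. (U (j\<^sup>2) K \<omega>)\<^sup>2 \<partial>M) + (\<integral>\<omega>. (G (j\<^sup>2) ((Suc j)\<^sup>2) K \<omega>)\<^sup>2 \<partial>M)) / real (j\<^sup>2) ^ 2"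
    unfolding Z_def using U_second_moment(1) G_second_moment(1)[of "j\<^sup>2" "(Suc j)\<^sup>2"]
    by (subst integral_divide_zero, subst Bochner_Integration.integral_add) auto
  also have "\<dots> \<le> (C * real (j\<^sup>2) + C * (real ((Suc j)\<^sup>2 - j\<^sup>2))\<^sup>2) / real (j\<^sup>2) ^ 2"
    by (intro divide_right_mono add_mono U_second_moment G_second_moment) auto
  also have "real ((Suc j)\<^sup>2 - j\<^sup>2) = 2 * real j + 1"
    by (simp add: power2_eq_square)
  \<comment> \<open>For j >= 1 the block length 2j + 1 is at most 3j, hence the constant 10 = 1 +
    9.\<close>
  also have "(C * real (j\<^sup>2) + C * (2 * real j + 1)\<^sup>2) / real (j\<^sup>2) ^ 2
      \<le> (C * real (j\<^sup>2) + C * (3 * real j)\<^sup>2) / real (j\<^sup>2) ^ 2"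
    using j C_nonneg by (intro divide_right_mono add_left_mono mult_left_mono power_mono) auto
  also have "\<dots> = 10 * C / (real j)\<^sup>2"
    using j by (simp add: power2_eq_square field_simps)
  finally show ?thesis by (simp add: ennreal_leI)
qed

text \<open>A limit inferior, so that Fatou's lemma passes the bound to an unbounded horizon \<open>K\<close>.\<close>

definition Zinf :: "nat \<Rightarrow> 'm \<Rightarrow> ennreal" where
  "Zinf j \<omega> = liminf (\<lambda>K. ennreal (Z j K \<omega>))"

lemma Z_measurable [measurable]: "Z j K \<in> borel_measurable M"
  unfolding Z_def by measurable

lemma Zinf_measurable [measurable]: "Zinf j \<in> borel_measurable M"
  unfolding Zinf_def by measurable

text \<open>The integrals have summable bounds, so the series of the \<open>Zinf\<close> has finite
  integral, is finite almost surely, and its terms tend to 0. The index starts at 1, because the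
  denominator of block 0 is 0.\<close>

lemma AE_Zinf_null: "AE \<omega> in M. (\<lambda>j. enn2real (Zinf (Suc j) \<omega>)) \<longlonglongrightarrow> 0 \<and> (\<forall>j. Zinf (Suc j) \<omega> < \<top>)"
proof -
  have le: "(\<integral>\<^sup>+\<omega>. Zinf (Suc j) \<omega> \<partial>M) \<le> ennreal (10 * C / (real (Suc j))\<^sup>2)" for j
  proof -
    have "(\<integral>\<^sup>+\<omega>. Zinf (Suc j) \<omega> \<partial>M) \<le> liminf (\<lambda>K. \<integral>\<^sup>+\<omega>. ennreal (Z (Suc j) K \<omega>) \<partial>M)"
      unfolding Zinf_def by (rule nn_integral_liminf) measurable
    also have "\<dots> \<le> ennreal (10 * C / (real (Suc j))\<^sup>2)"
      by (rule Liminf_le) (use Z_integral[of "Suc j"] in \<open>auto simp del: of_nat_Suc\<close>)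
    finally show ?thesis .
  qed
  have sum: "summable (\<lambda>j. 10 * C / (real (Suc j))\<^sup>2)"
    using summable_mult[OF iffD2[OF summable_Suc_iff inverse_power_summable[of 2, where 'a = real]], of "10 * C"]
    by (simp add: divide_inverse)
  have "(\<integral>\<^sup>+\<omega>. (\<Sum>j. Zinf (Suc j) \<omega>) \<partial>M) = (\<Sum>j. \<integral>\<^sup>+\<omega>. Zinf (Suc j) \<omega> \<partial>M)"
    by (rule nn_integral_suminf) measurable
  also have "\<dots> \<le> (\<Sum>j. ennreal (10 * C / (real (Suc j))\<^sup>2))"
    by (intro suminf_le le) auto
  also have "\<dots> = ennreal (\<Sum>j. 10 * C / (real (Suc j))\<^sup>2)"
    using C_nonneg by (intro suminf_ennreal2 sum) auto
  also have "\<dots> < \<infinity>" by simp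
  finally have "(\<integral>\<^sup>+\<omega>. (\<Sum>j. Zinf (Suc j) \<omega>) \<partial>M) \<noteq> \<infinity>" by simp
  then have "AE \<omega> in M. (\<Sum>j. Zinf (Suc j) \<omega>) \<noteq> \<infinity>"
    by (intro nn_integral_PInf_AE) measurable
  then show ?thesis
  proof eventually_elim
    case (elim \<omega>)
    have fin: "Zinf (Suc j) \<omega> < \<top>" for j
    proof (rule ccontr)
      assume "\<not> Zinf (Suc j) \<omega> < \<top>"
      then have "Zinf (Suc j) \<omega> = \<top>" by (simp add: less_top[symmetric])
      moreover have "Zinf (Suc j) \<omega> \<le> (\<Sum>j. Zinf (Suc j) \<omega>)"
        using sum_le_suminf[of "\<lambda>j. Zinf (Suc j) \<omega>" "{j}"] by simp
      ultimately show False using elim by (simp add: top_unique)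
    qed
    have "summable (\<lambda>j. enn2real (Zinf (Suc j) \<omega>))"
      by (rule summable_suminf_not_top) (use fin elim in auto)
    then show ?case using fin summable_LIMSEQ_zero by blast
  qed
qed

text \<open>With \<open>j\<close> the integer root, the count lies in block \<open>j\<close>. The
  noise splits into the part up to visit j^2 and a part inside the block that \<open>G\<close>
  dominates. The estimate (a + b)^2 <= 2 (a^2 + b^2) explains the factor 1/2. The bound holds for
  all \<open>K\<close> from \<open>k\<close> on, hence for the limit inferior.\<close>

lemma average_le_Zinf:
  assumes pos: "0 < N k \<omega>" and j: "j = floor_sqrt (N k \<omega>)"
  shows "ennreal (((\<Sum>i<k. D (Suc i) \<omega>) / real (N k \<omega>))\<^sup>2 / 2) \<le> Zinf j \<omega>"
  unfolding Zinf_def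
proof (rule Liminf_bounded)
  have j2: "j\<^sup>2 \<le> N k \<omega>" "N k \<omega> < (Suc j)\<^sup>2" "0 < j"
    using pos j Suc_floor_sqrt_power2_gt by auto
  have "((\<Sum>i<k. D (Suc i) \<omega>) / real (N k \<omega>))\<^sup>2 / 2 \<le> Z j K \<omega>" if K: "k \<le> K" for K
  proof -
    have "(\<Sum>i<k. D (Suc i) \<omega>) = U (j\<^sup>2) k \<omega>
        + (\<Sum>i<k. if j\<^sup>2 \<le> N i \<omega> \<and> N i \<omega> < (Suc j)\<^sup>2 then D (Suc i) \<omega> else 0)" (is "_ = _ + ?R")
      unfolding U_def sum.distrib[symmetric]
    proof (rule sum.cong)
      fix i assume "i \<in> {..<k}"
      then have "N i \<omega> < (Suc j)\<^sup>2" using vcount_mono[of i k "\<lambda>j. V j \<omega>"] j2 by auto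
      then show "D (Suc i) \<omega> = (if N i \<omega> < j\<^sup>2 then D (Suc i) \<omega> else 0)
          + (if j\<^sup>2 \<le> N i \<omega> \<and> N i \<omega> < (Suc j)\<^sup>2 then D (Suc i) \<omega> else 0)" by auto
    qed simp
    \<comment> \<open>From episode \<open>k\<close> on the count is at least j^2, so a longer
      horizon adds nothing to \<open>U\<close>.\<close>
    moreover have "U (j\<^sup>2) k \<omega> = U (j\<^sup>2) K \<omega>"
      unfolding U_def
    proof (rule sum.mono_neutral_left)
      show "\<forall>i\<in>{..<K} - {..<k}. (if N i \<omega> < j\<^sup>2 then D (Suc i) \<omega> else 0) = 0"
      proof
        fix i assume "i \<in> {..<K} - {..<k}"
        then have "N k \<omega> \<le> N i \<omega>" by (intro vcount_mono) auto
        then show "(if N i \<omega> < j\<^sup>2 then D (Suc i) \<omega> else 0) = 0" using j2 by auto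
      qed
    qed (use K in auto)
    moreover have "\<bar>?R\<bar> \<le> G (j\<^sup>2) ((Suc j)\<^sup>2) K \<omega>"
    proof -
      have "\<bar>?R\<bar> \<le> G (j\<^sup>2) ((Suc j)\<^sup>2) k \<omega>"
        unfolding G_def by (rule order_trans[OF sum_abs]) (auto intro!: sum_mono)
      also have "\<dots> \<le> G (j\<^sup>2) ((Suc j)\<^sup>2) K \<omega>"
        unfolding G_def using K by (intro sum_mono2) auto
      finally show ?thesis .
    qed
    ultimately have "\<bar>\<Sum>i<k. D (Suc i) \<omega>\<bar> \<le> \<bar>U (j\<^sup>2) K \<omega>\<bar> + G (j\<^sup>2) ((Suc j)\<^sup>2) K \<omega>" (is "_ \<le> ?a + ?b")
      by linarith
    then have "\<bar>\<Sum>i<k. D (Suc i) \<omega>\<bar>\<^sup>2 \<le> (?a + ?b)\<^sup>2" by (intro power_mono) auto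
    also have "\<dots> \<le> 2 * (?a\<^sup>2 + ?b\<^sup>2)" using sum_squares_bound[of ?a ?b] by (simp add: power2_sum)
    finally have "(\<Sum>i<k. D (Suc i) \<omega>)\<^sup>2 / 2 \<le> ?a\<^sup>2 + ?b\<^sup>2" by simp
    then have "(\<Sum>i<k. D (Suc i) \<omega>)\<^sup>2 / 2 / (real (N k \<omega>))\<^sup>2 \<le> (?a\<^sup>2 + ?b\<^sup>2) / (real (j\<^sup>2))\<^sup>2"
      using j2 by (intro frac_le power_mono) auto
    then show ?thesis by (simp add: Z_def power_divide)
  qed
  then show "\<forall>\<^sub>F K in sequentially. ennreal (((\<Sum>i<k. D (Suc i) \<omega>) / real (N k \<omega>))\<^sup>2 / 2) \<le> ennreal (Z j K \<omega>)"
    unfolding eventually_sequentially by (auto intro!: exI[of _ k] ennreal_leI)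
qed

theorem AE_visit_average_null:
  "AE \<omega> in M. filterlim (\<lambda>k. N k \<omega>) at_top sequentially \<longrightarrow>
     (\<lambda>k. (\<Sum>i<k. D (Suc i) \<omega>) / real (N k \<omega>)) \<longlonglongrightarrow> 0"
  using AE_Zinf_null
proof eventually_elim
  case (elim \<omega>)
  then have Znull: "(\<lambda>j. enn2real (Zinf (Suc j) \<omega>)) \<longlonglongrightarrow> 0" and Zfin: "\<And>j. Zinf (Suc j) \<omega> < \<top>"
    by auto
  show ?case
  proof
    assume lim: "filterlim (\<lambda>k. N k \<omega>) at_top sequentially"
    \<comment> \<open>\<open>AE_Zinf_null\<close> speaks of \<open>Suc j\<close>; the subtraction
      undoes this shift once the root is at least 1.\<close>
    let ?j = "\<lambda>k. floor_sqrt (N k \<omega>) - 1"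
    have jlim: "filterlim ?j at_top sequentially"
      unfolding filterlim_at_top
    proof
      fix m :: nat
      have "\<forall>\<^sub>F k in sequentially. (Suc m)\<^sup>2 \<le> N k \<omega>" using lim unfolding filterlim_at_top by blast
      then show "\<forall>\<^sub>F k in sequentially. m \<le> ?j k"
      proof eventually_elim
        case (elim k)
        then have "Suc m \<le> floor_sqrt (N k \<omega>)" by (subst le_floor_sqrt_iff)
        then show ?case by linarith
      qed
    qed
    have lim0: "(\<lambda>k. 2 * enn2real (Zinf (Suc (?j k)) \<omega>)) \<longlonglongrightarrow> 2 * 0"
      by (intro tendsto_mult tendsto_const filterlim_compose[OF Znull jlim])
    have "\<forall>\<^sub>F k in sequentially. 1 \<le> N k \<omega>" using lim unfolding filterlim_at_top by blast
    then have "\<forall>\<^sub>F k in sequentially. norm (((\<Sum>i<k. D (Suc i) \<omega>) / real (N k \<omega>))\<^sup>2) \<le> 2 * enn2real (Zinf (Suc (?j k)) \<omega>)"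
    proof eventually_elim
      case (elim k)
      have j: "Suc (?j k) = floor_sqrt (N k \<omega>)" using elim by simp
      have "ennreal (((\<Sum>i<k. D (Suc i) \<omega>) / real (N k \<omega>))\<^sup>2 / 2) \<le> Zinf (Suc (?j k)) \<omega>"
        by (rule average_le_Zinf[OF _ j]) (use elim in simp)
      from enn2real_mono[OF this Zfin]
      have "((\<Sum>i<k. D (Suc i) \<omega>) / real (N k \<omega>))\<^sup>2 / 2 \<le> enn2real (Zinf (Suc (?j k)) \<omega>)"
        by (subst (asm) enn2real_ennreal) simp_all
      then show ?case by simp
    qed
    then have "(\<lambda>k. ((\<Sum>i<k. D (Suc i) \<omega>) / real (N k \<omega>))\<^sup>2) \<longlonglongrightarrow> 0"
      by (rule Lim_null_comparison) (use lim0 in simp)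
    from tendsto_real_sqrt[OF this] show "(\<lambda>k. (\<Sum>i<k. D (Suc i) \<omega>) / real (N k \<omega>)) \<longlonglongrightarrow> 0"
      by (simp only: real_sqrt_abs real_sqrt_zero tendsto_rabs_zero_iff)
  qed
qed

end

section \<open>Infinitely many visits from non-summable visit rates\<close>

lemma vcount_at_top:
  assumes "\<And>m. \<exists>i\<ge>m. V (Suc i)"
  shows "filterlim (vcount V) at_top sequentially"
  unfolding filterlim_at_top
proof
  fix n
  have "\<exists>k. n \<le> vcount V k"
  proof (induction n)
    case (Suc n)
    then obtain k where k: "n \<le> vcount V k" by blast
    obtain i where i: "k \<le> i" "V (Suc i)" using assms by blast
    have "n \<le> vcount V i" using k vcount_mono[OF i(1), of V] by linarith
    then show ?case using i by (intro exI[of _ "Suc i"]) (simp add: vcount_Suc)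
  qed simp
  then obtain k where k: "n \<le> vcount V k" by blast
  show "\<forall>\<^sub>F j in sequentially. n \<le> vcount V j"
    using eventually_ge_at_top[of k]
    by eventually_elim (use k vcount_mono order_trans in blast)
qed

text \<open>The number \<open>c k\<close> bounds the conditional visit probability from below
  whatever the past. So no visit in episodes m + 1 to n has probability at most the product of the 1
  - c i, hence at most exp of minus the sum of the c i, which tends to 0. No independence of the
  episodes enters.\<close>

lemma (in prob_space) AE_infinitely_many_visits:
  fixes F :: "nat \<Rightarrow> 'a measure" and c :: "nat \<Rightarrow> real"
  assumes F_sub: "\<And>k. subalgebra M (F k)"
    and V_meas: "\<And>i k. 1 \<le> i \<Longrightarrow> i \<le> k \<Longrightarrow> Measurable.pred (F k) (V i)"
    and le: "\<And>k E. E \<in> sets (F k) \<Longrightarrow> prob {\<omega>\<in>E. \<not> V (Suc k) \<omega>} \<le> (1 - c k) * prob E"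
    and c: "\<And>k. 0 \<le> c k" "\<And>k. c k \<le> 1" "\<not> summable c"
  shows "AE \<omega> in M. filterlim (vcount (\<lambda>i. V i \<omega>)) at_top sequentially"
proof -
  define E where "E m n = {\<omega>\<in>space M. \<forall>i\<in>{m..<n}. \<not> V (Suc i) \<omega>}" for m n
  have sp: "space (F k) = space M" for k using F_sub by (simp add: subalgebra_def)
  have E_F: "E m n \<in> sets (F n)" for m n
  proof -
    have "Measurable.pred (F n) (\<lambda>\<omega>. \<forall>i\<in>{m..<n}. \<not> V (Suc i) \<omega>)"
      by (intro pred_intros_finite pred_intros_logic V_meas) auto
    then show ?thesis unfolding E_def sp[of n, symmetric] by measurable
  qed
  have E_M: "E m n \<in> events" for m n using E_F[of m n] F_sub[of n] unfolding subalgebra_def by blast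
  have bound: "prob (E m n) \<le> exp (- (\<Sum>i\<in>{m..<n}. c i))" if "m \<le> n" for m n
    using that
  proof (induction n rule: dec_induct)
    case (step n)
    have "E m (Suc n) = {\<omega>\<in>E m n. \<not> V (Suc n) \<omega>}"
      using step(1) by (auto simp: E_def less_Suc_eq)
    then have "prob (E m (Suc n)) \<le> (1 - c n) * prob (E m n)" using le[OF E_F] by simp
    also have "\<dots> \<le> exp (- c n) * exp (- (\<Sum>i\<in>{m..<n}. c i))"
      using exp_ge_add_one_self[of "- c n"] c(2)[of n] by (intro mult_mono step) auto
    also have "\<dots> = exp (- (\<Sum>i\<in>{m..<Suc n}. c i))" using step(1) by (simp flip: exp_add)
    finally show ?case .
  qed (simp add: E_def)
  have "AE \<omega> in M. \<exists>i\<ge>m. V (Suc i) \<omega>" for m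
  proof -
    let ?N = "{\<omega>\<in>space M. \<forall>i\<ge>m. \<not> V (Suc i) \<omega>}"
    have N: "?N = (\<Inter>n. E m n)" by (fastforce simp: E_def)
    have N_M: "?N \<in> events" unfolding N using E_M by auto
    have small: "prob ?N \<le> e" if e: "0 < e" for e
    proof -
      have "\<exists>n. - ln e \<le> (\<Sum>i<n. c i) - (\<Sum>i<m. c i)"
      proof (rule ccontr)
        assume *: "\<nexists>n. - ln e \<le> (\<Sum>i<n. c i) - (\<Sum>i<m. c i)"
        have "summable c"
        proof (rule summableI_nonneg_bounded)
          show "(\<Sum>i<n. c i) \<le> - ln e + (\<Sum>i<m. c i)" for n
            using *[simplified, rule_format, of n] by linarith
        qed (rule c)
        then show False using c by blast
      qed
      then obtain n where n: "- ln e \<le> (\<Sum>i<n. c i) - (\<Sum>i<m. c i)" by blast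
      define n' where "n' = max m n"
      have "(\<Sum>i<n. c i) \<le> (\<Sum>i<n'. c i)" using c by (intro sum_mono2) (auto simp: n'_def)
      moreover have "(\<Sum>i<n'. c i) = (\<Sum>i<m. c i) + (\<Sum>i\<in>{m..<n'}. c i)"
        using sum.atLeastLessThan_concat[of 0 m n' c] by (simp add: n'_def atLeast0LessThan)
      ultimately have "- (\<Sum>i\<in>{m..<n'}. c i) \<le> ln e" using n by linarith
      then have "exp (- (\<Sum>i\<in>{m..<n'}. c i)) \<le> e" using e by (simp add: ln_ge_iff)
      moreover have "prob ?N \<le> prob (E m n')" unfolding N by (rule finite_measure_mono) (auto simp: E_M)
      moreover have "m \<le> n'" by (simp add: n'_def)
      ultimately show ?thesis using bound[of m n'] by linarith
    qed
    have "prob ?N \<le> 0" by (rule field_le_epsilon) (use small in simp)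
    then have "prob ?N = 0" by (simp add: measure_le_0_iff)
    then have "?N \<in> null_sets M" using N_M by (intro null_setsI) (simp_all only: emeasure_eq_measure ennreal_0)
    then show ?thesis by (rule AE_I') auto
  qed
  then have "AE \<omega> in M. \<forall>m. \<exists>i\<ge>m. V (Suc i) \<omega>" by (simp add: AE_all_countable)
  then show ?thesis
  proof eventually_elim
    case (elim \<omega>)
    show ?case by (rule vcount_at_top) (rule elim[rule_format])
  qed
qed

text \<open>Cauchy-Schwarz with the discount as weight: \<open>g ^ t\<close> is split into two
  square roots, and the geometric series bounds the sum free of rewards. Absolute summability
  follows from \<open>\<bar>r\<bar> \<le> 1 + r\<^sup>2\<close>.\<close>

lemma discounted_sum_squared_le:
  fixes r :: "nat \<Rightarrow> real"
  assumes g: "0 \<le> g" "g < 1" and sq: "summable (\<lambda>t. g ^ t * (r t)\<^sup>2)"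
  shows "summable (\<lambda>t. g ^ t * \<bar>r t\<bar>)" "(\<Sum>t. g ^ t * r t)\<^sup>2 \<le> (\<Sum>t. g ^ t * (r t)\<^sup>2) / (1 - g)"
proof -
  have geo: "summable (\<lambda>t. g ^ t)" using g by simp
  have "norm (g ^ t * \<bar>r t\<bar>) \<le> g ^ t + g ^ t * (r t)\<^sup>2" for t
  proof -
    have "\<bar>r t\<bar> \<le> 1 + (r t)\<^sup>2" using sum_squares_bound[of 1 "\<bar>r t\<bar>"] by simp
    then have "g ^ t * \<bar>r t\<bar> \<le> g ^ t * (1 + (r t)\<^sup>2)" using g by (intro mult_left_mono) auto
    then show ?thesis using g by (simp add: algebra_simps abs_mult)
  qed
  then show abs: "summable (\<lambda>t. g ^ t * \<bar>r t\<bar>)"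
    by (rule summable_comparison_test'[OF summable_add[OF geo sq], where N = 0])
  have sum: "summable (\<lambda>t. g ^ t * r t)"
  proof -
    have "(\<lambda>t. \<bar>g ^ t * r t\<bar>) = (\<lambda>t. g ^ t * \<bar>r t\<bar>)" using g by (simp add: abs_mult)
    with abs show ?thesis by (simp add: summable_rabs_cancel[of "\<lambda>t. g ^ t * r t"])
  qed
  show "(\<Sum>t. g ^ t * r t)\<^sup>2 \<le> (\<Sum>t. g ^ t * (r t)\<^sup>2) / (1 - g)"
  proof (rule LIMSEQ_le)
    show "(\<lambda>n. (\<Sum>t<n. g ^ t * r t)\<^sup>2) \<longlonglongrightarrow> (\<Sum>t. g ^ t * r t)\<^sup>2"
      by (intro tendsto_power summable_LIMSEQ sum)
    show "(\<lambda>n. (\<Sum>t<n. g ^ t * (r t)\<^sup>2) / (1 - g)) \<longlonglongrightarrow> (\<Sum>t. g ^ t * (r t)\<^sup>2) / (1 - g)"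
      using g by (intro tendsto_divide summable_LIMSEQ sq tendsto_const) auto
    show "\<exists>N. \<forall>n\<ge>N. (\<Sum>t<n. g ^ t * r t)\<^sup>2 \<le> (\<Sum>t<n. g ^ t * (r t)\<^sup>2) / (1 - g)"
    proof (intro exI allI impI)
      fix n :: nat
      have "(\<Sum>t<n. g ^ t * r t)\<^sup>2 = (\<Sum>t<n. sqrt (g ^ t) * (sqrt (g ^ t) * r t))\<^sup>2"
        using g by (simp flip: mult.assoc)
      also have "\<dots> \<le> (\<Sum>t<n. (sqrt (g ^ t))\<^sup>2) * (\<Sum>t<n. (sqrt (g ^ t) * r t)\<^sup>2)"
        by (rule Cauchy_Schwarz_ineq_sum)
      also have "\<dots> = (\<Sum>t<n. g ^ t) * (\<Sum>t<n. g ^ t * (r t)\<^sup>2)"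
        using g by (simp add: power_mult_distrib)
      also have "(\<Sum>t<n. g ^ t) \<le> 1 / (1 - g)"
        using sum_le_suminf[OF geo, of "{..<n}"] g by (simp add: suminf_geometric)
      finally show "(\<Sum>t<n. g ^ t * r t)\<^sup>2 \<le> (\<Sum>t<n. g ^ t * (r t)\<^sup>2) / (1 - g)"
        using g by (simp add: mult_right_mono sum_nonneg)
    qed
  qed
qed

text \<open>Trades a minimum over an infinite time set for a condition on the times up to
  \<open>s\<close>, which a finite history decides.\<close>

lemma Least_eq_iff_first:
  fixes Q :: "nat \<Rightarrow> bool"
  shows "(\<exists>t. Q t) \<and> (LEAST t. Q t) = s \<longleftrightarrow> Q s \<and> (\<forall>t<s. \<not> Q t)"
  by (metis LeastI_ex Least_equality not_le not_less_Least)

section \<open>The law of an episode given the past\<close>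

context mdp begin

section \<open>The exploring policy\<close>

lemma finite_argmaxQ: "finite (argmaxQ A \<gamma> X Ac R k x)"
  by (rule finite_subset[OF _ A_fin[of x]]) (auto simp: argmaxQ_def)

lemma argmaxQ_nonempty: "argmaxQ A \<gamma> X Ac R k x \<noteq> {}"
proof -
  have "Max (Qbar \<gamma> X Ac R k x ` A x) \<in> Qbar \<gamma> X Ac R k x ` A x"
    using A_fin A_ne by (intro Max_in) auto
  then obtain a where a: "a \<in> A x" "Qbar \<gamma> X Ac R k x a = Max (Qbar \<gamma> X Ac R k x ` A x)" by auto
  have "a \<in> argmaxQ A \<gamma> X Ac R k x"
    unfolding argmaxQ_def using a A_fin by simp
  then show ?thesis by blast
qed

lemma eps_bounds:
  assumes "0 < \<theta>"
  shows "0 < eps A \<theta> X Ac k x" "eps A \<theta> X Ac k x \<le> 1"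
proof -
  show "0 < eps A \<theta> X Ac k x" by (simp add: eps_def add_pos_nonneg)
  have "eps A \<theta> X Ac k x \<le> (1 + real (Nst A X Ac k x)) powr 0"
    unfolding eps_def using assms by (intro powr_mono) auto
  then show "eps A \<theta> X Ac k x \<le> 1" by simp
qed

lemma sm_pibar:
  assumes "0 < \<theta>"
  shows "sm (pibar A \<gamma> \<theta> X Ac R k)"
  unfolding sm_def
proof (intro allI conjI ballI)
  fix x a
  note e = eps_bounds[OF assms, of X Ac k x]
  show "0 \<le> pibar A \<gamma> \<theta> X Ac R k x a" using e by (simp add: pibar_def)
  let ?m = "argmaxQ A \<gamma> X Ac R k x"
  have c: "0 < card ?m" "0 < card (A x)"
    using finite_argmaxQ argmaxQ_nonempty A_fin A_ne by (auto simp: card_gt_0_iff)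
  have "(\<Sum>a\<in>A x. if a \<in> ?m then (1 - eps A \<theta> X Ac k x) / real (card ?m) else 0)
      = (\<Sum>a\<in>?m. (1 - eps A \<theta> X Ac k x) / real (card ?m))"
    by (rule sum.mono_neutral_cong_right) (auto simp: argmaxQ_def A_fin)
  then show "(\<Sum>a\<in>A x. pibar A \<gamma> \<theta> X Ac R k x a) = 1"
    using c by (simp add: pibar_def sum.distrib)
qed

lemma pibar_le_1:
  assumes "0 < \<theta>"
  shows "pibar A \<gamma> \<theta> X Ac R k x a \<le> 1"
proof (cases "a \<in> A x")
  case True
  have "pibar A \<gamma> \<theta> X Ac R k x a \<le> (\<Sum>a\<in>A x. pibar A \<gamma> \<theta> X Ac R k x a)"
    using sm_pibar[OF assms, unfolded sm_def] True A_fin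
    by (intro member_le_sum[where f = "pibar A \<gamma> \<theta> X Ac R k x"]) auto
  then show ?thesis using sm_pibar[OF assms, unfolded sm_def] by simp
qed (simp add: pibar_def)

lemma pibar_nonneg: "0 < \<theta> \<Longrightarrow> 0 \<le> pibar A \<gamma> \<theta> X Ac R k x a"
  using sm_pibar[of \<theta>, unfolded sm_def] by (cases "a \<in> A x") (auto simp: pibar_def)

lemma pibar_ge:
  assumes "0 < \<theta>" "a \<in> A x"
  shows "eps A \<theta> X Ac k x / real (card (A x)) \<le> pibar A \<gamma> \<theta> X Ac R k x a"
  using eps_bounds[OF assms(1), of X Ac k x] assms(2) by (simp add: pibar_def)

text \<open>Off the maximizers only the exploration share remains, and at most
  \<open>card (A x)\<close> actions receive it.\<close>

lemma pibar_nongreedy_le: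
  assumes "0 < \<theta>"
  shows "(\<Sum>a\<in>{a\<in>A x. \<exists>b\<in>A x. Qbar \<gamma> X Ac R k x a < Qbar \<gamma> X Ac R k x b}. pibar A \<gamma> \<theta> X Ac R k x a)
    \<le> eps A \<theta> X Ac k x" (is "sum _ ?B \<le> _")
proof -
  have "(\<Sum>a\<in>?B. pibar A \<gamma> \<theta> X Ac R k x a) = (\<Sum>a\<in>?B. eps A \<theta> X Ac k x / real (card (A x)))"
    by (intro sum.cong refl) (auto simp: pibar_def argmaxQ_def)
  also have "\<dots> \<le> (\<Sum>a\<in>A x. eps A \<theta> X Ac k x / real (card (A x)))"
    using eps_bounds[OF assms, of X Ac k x] A_fin by (intro sum_mono2) auto
  also have "\<dots> = eps A \<theta> X Ac k x" using A_fin A_ne by simp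
  finally show ?thesis .
qed

end

text \<open>In \<open>algo\<close> the right side is integrated over \<open>E\<close> because the
  policy depends on the outcome through the past. Two instances are used below: all reward sets
  equal to \<open>UNIV\<close>, for the law of paths, and a single nontrivial last set, for the law
  of one reward along a path.\<close>

locale monte_carlo = mdp A P S \<gamma> + prob_space M
  for A :: "'s::finite \<Rightarrow> 'a set"
    and P :: "'s \<Rightarrow> 'a \<Rightarrow> 's pmf"
    and S :: "'s \<Rightarrow> 'a \<Rightarrow> 's \<Rightarrow> real measure"
    and \<gamma> :: real
    and M :: "'m measure" +
  fixes \<theta> :: real
    and \<mu>0 :: "'s pmf"
    and Xs :: "nat \<Rightarrow> nat \<Rightarrow> 'm \<Rightarrow> 's"
    and As :: "nat \<Rightarrow> nat \<Rightarrow> 'm \<Rightarrow> 'a"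
    and Rs :: "nat \<Rightarrow> nat \<Rightarrow> 'm \<Rightarrow> real"
  assumes S_prob: "\<And>x a y. a \<in> A x \<Longrightarrow> prob_space (S x a y)"
    and S_borel: "\<And>x a y. a \<in> A x \<Longrightarrow> sets (S x a y) = sets borel"
    and S_sq: "\<And>x a y. a \<in> A x \<Longrightarrow> integrable (S x a y) (\<lambda>z. z ^ 2)"
    and \<theta>: "0 < \<theta>" "\<theta> \<le> 1"
    and \<mu>0: "\<And>x. 0 < pmf \<mu>0 x"
    and Xs_meas [measurable]: "\<And>i t. Xs i t \<in> measurable M (count_space UNIV)"
    and As_meas [measurable]: "\<And>i t. As i t \<in> measurable M (count_space UNIV)"
    and Rs_meas [measurable]: "\<And>i t. Rs i t \<in> borel_measurable M"
    and algo: "\<And>k n xs as Bs E. (\<And>t. Bs t \<in> sets borel) \<Longrightarrow>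
        E \<in> sets (past_sigma M Xs As Rs k) \<Longrightarrow>
        emeasure M (E \<inter> {\<omega>\<in>space M. (\<forall>t\<le>n. Xs (Suc k) t \<omega> = xs t)
              \<and> (\<forall>t<n. As (Suc k) t \<omega> = as t \<and> Rs (Suc k) (Suc t) \<omega> \<in> Bs t)})
        = (\<integral>\<^sup>+\<omega>. indicator E \<omega> * ennreal (pmf \<mu>0 (xs 0) *
              (\<Prod>t<n. pibar A \<gamma> \<theta> (\<lambda>i t. Xs i t \<omega>) (\<lambda>i t. As i t \<omega>) (\<lambda>i t. Rs i t \<omega>) k (xs t) (as t)
                     * pmf (P (xs t) (as t)) (xs (Suc t))
                     * measure (S (xs t) (as t) (xs (Suc t))) (Bs t))) \<partial>M)"
begin

abbreviation "F \<equiv> past_sigma M Xs As Rs"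

abbreviation "plc k \<omega> \<equiv> pibar A \<gamma> \<theta> (\<lambda>i t. Xs i t \<omega>) (\<lambda>i t. As i t \<omega>) (\<lambda>i t. Rs i t \<omega>) k"

abbreviation "vis i x a \<omega> \<equiv> visits (\<lambda>i t. Xs i t \<omega>) (\<lambda>i t. As i t \<omega>) i x a"

abbreviation "rtn i x a \<omega> \<equiv> ret \<gamma> (\<lambda>i t. Xs i t \<omega>) (\<lambda>i t. As i t \<omega>) (\<lambda>i t. Rs i t \<omega>) i x a"

section \<open>Measurability of the data and of the policy with respect to the past\<close>

definition past_generator :: "nat \<Rightarrow> 'm set set" where
  "past_generator k = (\<Union>i\<in>{1..k}. \<Union>t. range (\<lambda>s. Xs i t -` {s} \<inter> space M)
                     \<union> range (\<lambda>a. As i t -` {a} \<inter> space M)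
                     \<union> (\<lambda>B. Rs i (Suc t) -` B \<inter> space M) ` sets borel)"

lemma past_generator_sets: "past_generator k \<subseteq> sets M"
  unfolding past_generator_def by (auto intro: measurable_sets)

lemma past_generator_Pow: "past_generator k \<subseteq> Pow (space M)"
  using past_generator_sets sets.sets_into_space by blast

lemma F_eq: "F k = sigma (space M) (past_generator k)"
  by (simp add: past_sigma_def past_generator_def)

lemma space_F [simp]: "space (F k) = space M"
  unfolding F_eq by (rule space_measure_of[OF past_generator_Pow])

lemma F_sub: "subalgebra M (F k)"
  unfolding subalgebra_def
proof
  show "sets (F k) \<subseteq> sets M"
    unfolding F_eq sets_measure_of[OF past_generator_Pow]
    by (rule sets.sigma_sets_subset[OF past_generator_sets])
qed simp

lemma in_F_sets: "E \<in> sets (F k) \<Longrightarrow> E \<in> sets M"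
  using F_sub[of k] by (auto simp: subalgebra_def)

lemma generator_in_F: "B \<in> past_generator k \<Longrightarrow> B \<in> sets (F k)"
  unfolding F_eq by (rule in_measure_of[OF past_generator_Pow])

context
  fixes i k :: nat
  assumes i: "1 \<le> i" "i \<le> k"
begin

lemma pred_Xs_F [measurable]: "Measurable.pred (F k) (\<lambda>\<omega>. Xs i t \<omega> = s)"
proof -
  have "{\<omega> \<in> space (F k). Xs i t \<omega> = s} = Xs i t -` {s} \<inter> space M" by auto
  also have "\<dots> \<in> sets (F k)"
    by (rule generator_in_F, unfold past_generator_def, rule UN_I[of i], use i in simp, rule UN_I[of t], simp, blast)
  finally show ?thesis by (simp add: pred_def)
qed

lemma pred_As_F [measurable]: "Measurable.pred (F k) (\<lambda>\<omega>. As i t \<omega> = s)"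
proof -
  have "{\<omega> \<in> space (F k). As i t \<omega> = s} = As i t -` {s} \<inter> space M" by auto
  also have "\<dots> \<in> sets (F k)"
    by (rule generator_in_F, unfold past_generator_def, rule UN_I[of i], use i in simp, rule UN_I[of t], simp, blast)
  finally show ?thesis by (simp add: pred_def)
qed

lemma Rs_F [measurable]: "Rs i (Suc t) \<in> borel_measurable (F k)"
proof (rule measurableI)
  fix B :: "real set" assume B: "B \<in> sets borel"
  show "Rs i (Suc t) -` B \<inter> space (F k) \<in> sets (F k)"
    unfolding space_F
    by (rule generator_in_F, unfold past_generator_def, rule UN_I[of i], use i in simp, rule UN_I[of t], simp, use B in blast)
qed simp

lemma vis_F [measurable]: "Measurable.pred (F k) (vis i x a)"
  unfolding visits_def by measurable

lemma rtn_F [measurable]: "rtn i x a \<in> borel_measurable (F k)"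
proof -
  have T [measurable]: "(\<lambda>\<omega>. first_visit (\<lambda>i t. Xs i t \<omega>) (\<lambda>i t. As i t \<omega>) i x a) \<in> measurable (F k) (count_space UNIV)"
    unfolding first_visit_def by (rule measurable_Least) measurable
  have [measurable]: "(\<lambda>\<omega>. Rs i (first_visit (\<lambda>i t. Xs i t \<omega>) (\<lambda>i t. As i t \<omega>) i x a + t + 1) \<omega>) \<in> borel_measurable (F k)" for t
    by (rule measurable_compose_countable[OF _ T]) simp
  show ?thesis unfolding ret_def by measurable
qed

end

lemma Nvis_eq_vcount: "Nvis X Ac k x a = vcount (\<lambda>i. visits X Ac i x a) k"
  by (simp add: Nvis_def vcount_def)

lemma Nvis_F [measurable]: "(\<lambda>\<omega>. Nvis (\<lambda>i t. Xs i t \<omega>) (\<lambda>i t. As i t \<omega>) k x a) \<in> measurable (F k) (count_space UNIV)"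
  unfolding Nvis_eq_vcount by (rule measurable_vcount) (rule vis_F)

lemma Qbar_F [measurable]:
  "(\<lambda>\<omega>. Qbar \<gamma> (\<lambda>i t. Xs i t \<omega>) (\<lambda>i t. As i t \<omega>) (\<lambda>i t. Rs i t \<omega>) k x a) \<in> borel_measurable (F k)"
proof -
  have "(\<lambda>\<omega>. \<Sum>i\<in>{1..k}. rtn i x a \<omega>) \<in> borel_measurable (F k)"
    by (intro borel_measurable_sum rtn_F) auto
  then show ?thesis unfolding Qbar_def by measurable
qed

lemma argmaxQ_F [measurable]:
  "Measurable.pred (F k) (\<lambda>\<omega>. a \<in> argmaxQ A \<gamma> (\<lambda>i t. Xs i t \<omega>) (\<lambda>i t. As i t \<omega>) (\<lambda>i t. Rs i t \<omega>) k x)"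
  unfolding argmaxQ_def mem_Collect_eq using A_fin[of x]
  by (intro pred_intros_logic pred_intros_finite) measurable

lemma plc_F [measurable]: "(\<lambda>\<omega>. plc k \<omega> x a) \<in> borel_measurable (F k)"
proof -
  have [measurable]: "(\<lambda>\<omega>. eps A \<theta> (\<lambda>i t. Xs i t \<omega>) (\<lambda>i t. As i t \<omega>) k x) \<in> borel_measurable (F k)"
    unfolding eps_def Nst_def of_nat_sum by measurable
  \<comment> \<open>The cardinality of a random set is measurable as a sum of indicators over the
    finite \<open>A x\<close>.\<close>
  have "(\<lambda>\<omega>. real (card (argmaxQ A \<gamma> (\<lambda>i t. Xs i t \<omega>) (\<lambda>i t. As i t \<omega>) (\<lambda>i t. Rs i t \<omega>) k x)))
     = (\<lambda>\<omega>. \<Sum>a\<in>A x. of_bool (a \<in> argmaxQ A \<gamma> (\<lambda>i t. Xs i t \<omega>) (\<lambda>i t. As i t \<omega>) (\<lambda>i t. Rs i t \<omega>) k x))"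
  proof
    fix \<omega>
    let ?m = "argmaxQ A \<gamma> (\<lambda>i t. Xs i t \<omega>) (\<lambda>i t. As i t \<omega>) (\<lambda>i t. Rs i t \<omega>) k x"
    have "A x \<inter> ?m = ?m" by (auto simp: argmaxQ_def)
    then show "real (card ?m) = (\<Sum>a\<in>A x. of_bool (a \<in> ?m))"
      using A_fin[of x] by (simp add: of_bool_def sum.If_cases Int_def)
  qed
  then have [measurable]: "(\<lambda>\<omega>. real (card (argmaxQ A \<gamma> (\<lambda>i t. Xs i t \<omega>) (\<lambda>i t. As i t \<omega>) (\<lambda>i t. Rs i t \<omega>) k x))) \<in> borel_measurable (F k)"
    by simp measurable
  show ?thesis unfolding pibar_def by measurable
qed

text \<open>The conditional probability, given the first \<open>k\<close> episodes, that episode \<open>k + 1\<close> starts with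
 the state-action pairs \<open>zs\<close> followed by the state \<open>y\<close>.\<close>

definition pathweight :: "nat \<Rightarrow> ('s \<times> 'a) list \<Rightarrow> 's \<Rightarrow> 'm \<Rightarrow> real" where
  "pathweight k zs y \<omega> = pmf \<mu>0 ((map fst zs @ [y]) ! 0) *
     (\<Prod>t<length zs. plc k \<omega> (fst (zs ! t)) (snd (zs ! t))
        * pmf (P (fst (zs ! t)) (snd (zs ! t))) ((map fst zs @ [y]) ! Suc t))"

definition hist :: "nat \<Rightarrow> nat \<Rightarrow> 'm \<Rightarrow> ('s \<times> 'a) list" where
  "hist k n \<omega> = map (\<lambda>t. (Xs (Suc k) t \<omega>, As (Suc k) t \<omega>)) [0..<n]"

text \<open>The cylinder ends in a state whose action is still open; in this shape the law in
  \<open>algo\<close> and the value at the end of a path fit together.\<close>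

definition pth :: "nat \<Rightarrow> ('s \<times> 'a) list \<Rightarrow> 's \<Rightarrow> 'm set" where
  "pth k zs y = {\<omega>\<in>space M. hist k (length zs) \<omega> = zs \<and> Xs (Suc k) (length zs) \<omega> = y}"

lemma pathweight_Nil: "pathweight k [] y \<omega> = pmf \<mu>0 y"
  by (simp add: pathweight_def)

lemma pathweight_snoc:
  "pathweight k (zs @ [(x, a)]) y \<omega> = pathweight k zs x \<omega> * (plc k \<omega> x a * pmf (P x a) y)"
proof -
  have 1: "((map fst (zs @ [(x, a)]) @ [y]) ! j) = ((map fst zs @ [x]) ! j)" if "j \<le> length zs" for j
    using that by (auto simp: nth_append)
  have 2: "(\<Prod>t<length zs. plc k \<omega> (fst ((zs @ [(x, a)]) ! t)) (snd ((zs @ [(x, a)]) ! t))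
        * pmf (P (fst ((zs @ [(x, a)]) ! t)) (snd ((zs @ [(x, a)]) ! t))) ((map fst (zs @ [(x, a)]) @ [y]) ! Suc t))
    = (\<Prod>t<length zs. plc k \<omega> (fst (zs ! t)) (snd (zs ! t))
        * pmf (P (fst (zs ! t)) (snd (zs ! t))) ((map fst zs @ [x]) ! Suc t))"
  proof (rule prod.cong[OF refl])
    fix t assume "t \<in> {..<length zs}"
    then have "(zs @ [(x, a)]) ! t = zs ! t" "Suc t \<le> length zs" by (auto simp: nth_append)
    then show "plc k \<omega> (fst ((zs @ [(x, a)]) ! t)) (snd ((zs @ [(x, a)]) ! t))
        * pmf (P (fst ((zs @ [(x, a)]) ! t)) (snd ((zs @ [(x, a)]) ! t))) ((map fst (zs @ [(x, a)]) @ [y]) ! Suc t)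
      = plc k \<omega> (fst (zs ! t)) (snd (zs ! t))
        * pmf (P (fst (zs ! t)) (snd (zs ! t))) ((map fst zs @ [x]) ! Suc t)"
      by (simp only: 1)
  qed
  have 3: "(map fst (zs @ [(x, a)]) @ [y]) ! Suc (length zs) = y"
    by (simp add: nth_append)
  have 4: "length (zs @ [(x, a)]) = Suc (length zs)" by simp
  show ?thesis
    unfolding pathweight_def 4 prod.lessThan_Suc 2 1[OF le0] 3 by simp
qed

lemma pathweight_bounds: "0 \<le> pathweight k zs y \<omega>" "pathweight k zs y \<omega> \<le> 1"
proof -
  note nn = pibar_nonneg[OF \<theta>(1)] and le = pibar_le_1[OF \<theta>(1)]
  show "0 \<le> pathweight k zs y \<omega>"
    unfolding pathweight_def by (intro mult_nonneg_nonneg prod_nonneg ballI nn) auto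
  show "pathweight k zs y \<omega> \<le> 1"
    unfolding pathweight_def
    by (intro mult_le_one prod_le_1 prod_nonneg mult_nonneg_nonneg conjI nn le) (auto simp: pmf_le_1 nn)
qed

lemma pathweight_F [measurable]: "pathweight k zs y \<in> borel_measurable (F k)"
  unfolding pathweight_def by measurable

lemma from_F: "f \<in> measurable (F k) N \<Longrightarrow> f \<in> measurable M N"
  by (rule measurable_from_subalg[OF F_sub])

lemma plc_M [measurable]: "(\<lambda>\<omega>. plc k \<omega> x a) \<in> borel_measurable M"
  by (rule from_F) (rule plc_F)

lemma pathweight_M [measurable]: "pathweight k zs y \<in> borel_measurable M"
  by (rule from_F) (rule pathweight_F)

lemma vis_M [measurable]: "Measurable.pred M (vis (Suc k) x a)"
  by (rule from_F[of _ "Suc k"]) (rule vis_F, auto)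

lemma rtn_M [measurable]: "rtn (Suc k) x a \<in> borel_measurable M"
  by (rule from_F[of _ "Suc k"]) (rule rtn_F, auto)

section \<open>Laws of paths and of the rewards along them\<close>

lemma pth_iff: "\<omega> \<in> pth k zs y \<longleftrightarrow> \<omega> \<in> space M \<and>
    (\<forall>t\<le>length zs. Xs (Suc k) t \<omega> = (map fst zs @ [y]) ! t) \<and> (\<forall>t<length zs. As (Suc k) t \<omega> = snd (zs ! t))"
proof -
  have "hist k (length zs) \<omega> = zs \<longleftrightarrow> (\<forall>t<length zs. Xs (Suc k) t \<omega> = fst (zs ! t) \<and> As (Suc k) t \<omega> = snd (zs ! t))"
    unfolding hist_def list_eq_iff_nth_eq[of _ zs] by (simp add: prod_eq_iff)
  then show ?thesis by (auto simp: pth_def nth_append le_less)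
qed

lemma pth_sets [measurable]: "pth k zs y \<in> events"
proof -
  have "pth k zs y = {\<omega>\<in>space M. (\<forall>t\<in>{..length zs}. Xs (Suc k) t \<omega> = (map fst zs @ [y]) ! t)
      \<and> (\<forall>t\<in>{..<length zs}. As (Suc k) t \<omega> = snd (zs ! t))}"
    by (auto simp: pth_iff)
  also have "\<dots> \<in> events" by measurable
  finally show ?thesis .
qed

text \<open>Outside \<open>A x\<close> no total mass is prescribed for \<open>S x a y\<close>, but
  there the policy weight is 0.\<close>

lemma reward_factor:
  assumes "B = UNIV"
  shows "plc k \<omega> x a * p * measure (S x a y) B = plc k \<omega> x a * p"
proof (cases "a \<in> A x")
  case True
  then have "space (S x a y) = UNIV" using sets_eq_imp_space_eq[OF S_borel] by simp
  then show ?thesis using prob_space.prob_space[OF S_prob[OF True, of y]] assms by simp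
qed (simp add: pibar_def)

lemma path_emeasure:
  assumes E: "E \<in> sets (F k)"
  shows "emeasure M (E \<inter> pth k zs y) = (\<integral>\<^sup>+\<omega>. indicator E \<omega> * ennreal (pathweight k zs y \<omega>) \<partial>M)"
proof -
  have eq: "pth k zs y = {\<omega>\<in>space M. (\<forall>t\<le>length zs. Xs (Suc k) t \<omega> = (map fst zs @ [y]) ! t)
      \<and> (\<forall>t<length zs. As (Suc k) t \<omega> = snd (zs ! t) \<and> Rs (Suc k) (Suc t) \<omega> \<in> UNIV)}"
    by (auto simp: pth_iff)
  have fst: "(map fst zs @ [y]) ! t = fst (zs ! t)" if "t < length zs" for t
    using that by (simp add: nth_append)
  have "pathweight k zs y \<omega> = pmf \<mu>0 ((map fst zs @ [y]) ! 0) *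
     (\<Prod>t<length zs. plc k \<omega> ((map fst zs @ [y]) ! t) (snd (zs ! t))
        * pmf (P ((map fst zs @ [y]) ! t) (snd (zs ! t))) ((map fst zs @ [y]) ! Suc t)
        * measure (S ((map fst zs @ [y]) ! t) (snd (zs ! t)) ((map fst zs @ [y]) ! Suc t)) UNIV)" for \<omega>
    unfolding pathweight_def
    by (rule arg_cong2[of _ _ _ _ "(*)", OF refl], rule prod.cong[OF refl])
      (simp only: lessThan_iff fst reward_factor[OF refl])
  then show ?thesis
    unfolding eq by (subst algo[OF _ E]) simp_all
qed

text \<open>\<open>algo\<close> with \<open>B\<close> at the last step and \<open>UNIV\<close>
  before. The last reward factor does not depend on the outcome and leaves the integral: on the
  cylinder, the reward is independent of the past.\<close>

lemma path_reward_emeasure: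
  assumes E: "E \<in> sets (F k)" and a: "a \<in> A x" and B: "B \<in> sets borel"
  shows "emeasure M (E \<inter> pth k (zs @ [(x, a)]) y \<inter> {\<omega>\<in>space M. Rs (Suc k) (Suc (length zs)) \<omega> \<in> B})
    = ennreal (measure (S x a y) B) * emeasure M (E \<inter> pth k (zs @ [(x, a)]) y)"
proof -
  have [measurable]: "E \<in> events" by (rule in_F_sets[OF E])
  let ?zs = "zs @ [(x, a)]" and ?n = "Suc (length zs)"
  let ?Bs = "\<lambda>t. if t = length zs then B else UNIV"
  let ?xs = "\<lambda>t. (map fst ?zs @ [y]) ! t"
  have eq: "pth k ?zs y \<inter> {\<omega>\<in>space M. Rs (Suc k) (Suc (length zs)) \<omega> \<in> B}
    = {\<omega>\<in>space M. (\<forall>t\<le>?n. Xs (Suc k) t \<omega> = ?xs t)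
      \<and> (\<forall>t<?n. As (Suc k) t \<omega> = snd (?zs ! t) \<and> Rs (Suc k) (Suc t) \<omega> \<in> ?Bs t)}"
    by (auto simp: pth_iff All_less_Suc)
  have fst: "?xs t = fst (?zs ! t)" if "t < ?n" for t
    using that by (auto simp: nth_append less_Suc_eq)
  have last_reward: "measure (S (?xs (length zs)) (snd (?zs ! length zs)) (?xs (Suc (length zs)))) (?Bs (length zs))
      = measure (S x a y) B"
    by (simp add: nth_append)
  let ?f = "\<lambda>\<omega> t. plc k \<omega> (?xs t) (snd (?zs ! t)) * pmf (P (?xs t) (snd (?zs ! t))) (?xs (Suc t))"
  have weight: "pmf \<mu>0 (?xs 0) *
     (\<Prod>t<?n. ?f \<omega> t * measure (S (?xs t) (snd (?zs ! t)) (?xs (Suc t))) (?Bs t))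
    = measure (S x a y) B * pathweight k ?zs y \<omega>" for \<omega>
  proof -
    have "(\<Prod>t<length zs. ?f \<omega> t * measure (S (?xs t) (snd (?zs ! t)) (?xs (Suc t))) (?Bs t)) = (\<Prod>t<length zs. ?f \<omega> t)"
      by (intro prod.cong refl reward_factor) auto
    then have "(\<Prod>t<?n. ?f \<omega> t * measure (S (?xs t) (snd (?zs ! t)) (?xs (Suc t))) (?Bs t))
        = (\<Prod>t<?n. ?f \<omega> t) * measure (S x a y) B"
      unfolding prod.lessThan_Suc
      by (simp only: last_reward ac_simps)
    moreover have "pathweight k ?zs y \<omega> = pmf \<mu>0 (?xs 0) * (\<Prod>t<?n. ?f \<omega> t)"
      unfolding pathweight_def length_append_singleton
      by (rule arg_cong2[of _ _ _ _ "(*)", OF refl], rule prod.cong[OF refl]) (simp only: lessThan_iff fst)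
    ultimately show ?thesis by (simp only: ac_simps)
  qed
  have "emeasure M (E \<inter> pth k ?zs y \<inter> {\<omega>\<in>space M. Rs (Suc k) (Suc (length zs)) \<omega> \<in> B})
      = (\<integral>\<^sup>+\<omega>. indicator E \<omega> * ennreal (measure (S x a y) B * pathweight k ?zs y \<omega>) \<partial>M)"
    unfolding Int_assoc eq by (subst algo[OF _ E]) (use B in simp, simp only: weight)
  also have "\<dots> = (\<integral>\<^sup>+\<omega>. ennreal (measure (S x a y) B) * (indicator E \<omega> * ennreal (pathweight k ?zs y \<omega>)) \<partial>M)"
    by (simp add: ennreal_mult pathweight_bounds ac_simps)
  also have "\<dots> = ennreal (measure (S x a y) B) * (\<integral>\<^sup>+\<omega>. (indicator E \<omega> * ennreal (pathweight k ?zs y \<omega>)) \<partial>M)"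
    by (rule nn_integral_cmult) measurable
  finally show ?thesis unfolding path_emeasure[OF E] .
qed

lemma integrable_bounded_mult:
  fixes f g :: "'m \<Rightarrow> real"
  assumes [measurable]: "f \<in> borel_measurable M" and f: "\<And>\<omega>. \<omega> \<in> space M \<Longrightarrow> \<bar>f \<omega>\<bar> \<le> B" and g: "integrable M g"
  shows "integrable M (\<lambda>\<omega>. f \<omega> * g \<omega>)"
proof (rule Bochner_Integration.integrable_bound)
  show "integrable M (\<lambda>\<omega>. B * g \<omega>)" using g by simp
  show "AE \<omega> in M. norm (f \<omega> * g \<omega>) \<le> norm (B * g \<omega>)"
  proof (rule AE_I2)
    fix \<omega> assume "\<omega> \<in> space M"
    then have "\<bar>f \<omega>\<bar> \<le> \<bar>B\<bar>" using f[of \<omega>] by linarith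
    then show "norm (f \<omega> * g \<omega>) \<le> norm (B * g \<omega>)" by (simp add: abs_mult mult_right_mono)
  qed
qed (use g in measurable)

lemma path_integral:
  assumes E: "E \<in> sets (F k)"
  shows "(\<integral>\<omega>. indicator E \<omega> * indicator (pth k zs y) \<omega> \<partial>M) = (\<integral>\<omega>. indicator E \<omega> * pathweight k zs y \<omega> \<partial>M)"
proof -
  have [measurable]: "E \<in> events" by (rule in_F_sets[OF E])
  have int: "integrable M (\<lambda>\<omega>. indicator E \<omega> * pathweight k zs y \<omega>)"
    using pathweight_bounds by (intro integrable_const_bound[of _ 1]) (auto simp: indicator_def)
  have "ennreal (prob (E \<inter> pth k zs y)) = (\<integral>\<^sup>+\<omega>. ennreal (indicator E \<omega> * pathweight k zs y \<omega>) \<partial>M)"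
    unfolding emeasure_eq_measure[symmetric] path_emeasure[OF E]
    by (intro nn_integral_cong) (auto simp: indicator_def)
  also have "\<dots> = ennreal (\<integral>\<omega>. indicator E \<omega> * pathweight k zs y \<omega> \<partial>M)"
    using pathweight_bounds by (intro nn_integral_eq_integral int) auto
  finally have "prob (E \<inter> pth k zs y) = (\<integral>\<omega>. indicator E \<omega> * pathweight k zs y \<omega> \<partial>M)"
    using pathweight_bounds by (subst (asm) ennreal_inj) (auto intro!: integral_nonneg_AE)
  then show ?thesis by (simp flip: indicator_inter_arith)
qed

text \<open>Past events are replaced by bounded past-measurable factors. Values of the current
  policy are of this kind, being fixed by the first \<open>k\<close> episodes.\<close>

lemma path_integral_mult:
  assumes E: "\<phi> \<in> borel_measurable (F k)" and B: "\<And>\<omega>. \<bar>\<phi> \<omega>\<bar> \<le> B"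
  shows "(\<integral>\<omega>. \<phi> \<omega> * indicator (pth k zs y) \<omega> \<partial>M) = (\<integral>\<omega>. \<phi> \<omega> * pathweight k zs y \<omega> \<partial>M)"
proof -
  interpret finite_measure_subalgebra M "F k" by standard (rule F_sub)
  have [measurable]: "\<phi> \<in> borel_measurable M" by (rule from_F[OF E])
  have int: "integrable M (indicator (pth k zs y) :: _ \<Rightarrow> real)" "integrable M (pathweight k zs y)"
    using pathweight_bounds by (auto intro: integrable_const_bound[of _ 1])
  show ?thesis
    by (rule integral_mult_eqI[OF int path_integral E integrable_bounded_mult[OF _ B int(1)]
        integrable_bounded_mult[OF _ B int(2)]]) auto
qed

text \<open>As an identity of measures it serves both nonnegative integrals, for second moments, and
  signed ones, for means.\<close>

lemma reward_distr:
  fixes zs y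
  assumes E: "E \<in> sets (F k)" and a: "a \<in> A x"
  defines "H \<equiv> E \<inter> pth k (zs @ [(x, a)]) y"
  shows "distr (density M (\<lambda>\<omega>. ennreal (indicator H \<omega>))) borel (Rs (Suc k) (Suc (length zs)))
    = density (S x a y) (\<lambda>_. ennreal (prob H))"
proof (rule measure_eqI)
  have [measurable]: "H \<in> events" unfolding H_def using in_F_sets[OF E] by auto
  interpret S: prob_space "S x a y" by (rule S_prob[OF a])
  show "sets (distr (density M (\<lambda>\<omega>. ennreal (indicator H \<omega>))) borel (Rs (Suc k) (Suc (length zs))))
      = sets (density (S x a y) (\<lambda>_. ennreal (prob H)))"
    using S_borel[OF a] by simp
  fix B assume "B \<in> sets (distr (density M (\<lambda>\<omega>. ennreal (indicator H \<omega>))) borel (Rs (Suc k) (Suc (length zs))))"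
  then have B [measurable]: "B \<in> sets borel" by simp
  let ?R = "Rs (Suc k) (Suc (length zs)) -` B \<inter> space M"
  have R [measurable]: "?R \<in> events" by measurable
  have "emeasure (distr (density M (\<lambda>\<omega>. ennreal (indicator H \<omega>))) borel (Rs (Suc k) (Suc (length zs)))) B
      = (\<integral>\<^sup>+\<omega>. ennreal (indicator H \<omega>) * indicator ?R \<omega> \<partial>M)"
    by (simp add: emeasure_distr emeasure_density)
  also have "\<dots> = (\<integral>\<^sup>+\<omega>. indicator (H \<inter> ?R) \<omega> \<partial>M)"
    by (intro nn_integral_cong) (auto simp: indicator_def)
  also have "\<dots> = emeasure M (H \<inter> ?R)" by simp
  also have "?R = {\<omega>\<in>space M. Rs (Suc k) (Suc (length zs)) \<omega> \<in> B}" by auto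
  also have "emeasure M (H \<inter> \<dots>) = ennreal (measure (S x a y) B) * emeasure M H"
    unfolding H_def by (rule path_reward_emeasure[OF E a B])
  also have "\<dots> = emeasure (density (S x a y) (\<lambda>_. ennreal (prob H))) B"
  proof -
    have "B \<in> sets (S x a y)" using B S_borel[OF a] by simp
    then have "emeasure (density (S x a y) (\<lambda>_. ennreal (prob H))) B = ennreal (prob H) * emeasure (S x a y) B"
      by (simp add: emeasure_density nn_integral_cmult_indicator)
    then show ?thesis unfolding S.emeasure_eq_measure emeasure_eq_measure by (simp only: mult.commute)
  qed
  finally show "emeasure (distr (density M (\<lambda>\<omega>. ennreal (indicator H \<omega>))) borel (Rs (Suc k) (Suc (length zs)))) B
      = emeasure (density (S x a y) (\<lambda>_. ennreal (prob H))) B" .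
qed

lemma reward_nn_integral:
  fixes f :: "real \<Rightarrow> ennreal" and zs y
  assumes E: "E \<in> sets (F k)" and a: "a \<in> A x" and f [measurable]: "f \<in> borel_measurable borel"
  defines "H \<equiv> E \<inter> pth k (zs @ [(x, a)]) y"
  shows "(\<integral>\<^sup>+\<omega>. indicator H \<omega> * f (Rs (Suc k) (Suc (length zs)) \<omega>) \<partial>M) = emeasure M H * (\<integral>\<^sup>+z. f z \<partial>S x a y)"
proof -
  have [measurable]: "H \<in> events" unfolding H_def using in_F_sets[OF E] by auto
  have [measurable]: "f \<in> borel_measurable (S x a y)" using f measurable_cong_sets[OF S_borel[OF a] refl] by blast
  have "(\<integral>\<^sup>+\<omega>. indicator H \<omega> * f (Rs (Suc k) (Suc (length zs)) \<omega>) \<partial>M)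
    = (\<integral>\<^sup>+z. f z \<partial>distr (density M (\<lambda>\<omega>. ennreal (indicator H \<omega>))) borel (Rs (Suc k) (Suc (length zs))))"
    by (simp add: nn_integral_distr nn_integral_density ennreal_indicator)
  also have "\<dots> = (\<integral>\<^sup>+z. f z \<partial>density (S x a y) (\<lambda>_. ennreal (prob H)))"
    unfolding H_def reward_distr[OF E a] ..
  also have "\<dots> = emeasure M H * (\<integral>\<^sup>+z. f z \<partial>S x a y)"
    by (simp add: nn_integral_density nn_integral_cmult emeasure_eq_measure)
  finally show ?thesis .
qed

lemma reward_mean:
  fixes zs y
  assumes E: "E \<in> sets (F k)" and a: "a \<in> A x"
  defines "H \<equiv> E \<inter> pth k (zs @ [(x, a)]) y"
  shows "(\<integral>\<omega>. indicator H \<omega> * Rs (Suc k) (Suc (length zs)) \<omega> \<partial>M) = prob H * mean_reward S x a y"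
proof -
  have [measurable]: "H \<in> events" unfolding H_def using in_F_sets[OF E] by auto
  have [measurable]: "(\<lambda>z. z) \<in> borel_measurable (S x a y)"
    by (rule measurable_ident_sets[OF S_borel[OF a]])
  have "(\<integral>\<omega>. indicator H \<omega> * Rs (Suc k) (Suc (length zs)) \<omega> \<partial>M)
    = (\<integral>z. z \<partial>distr (density M (\<lambda>\<omega>. ennreal (indicator H \<omega>))) borel (Rs (Suc k) (Suc (length zs))))"
    by (simp add: integral_distr integral_density)
  also have "\<dots> = (\<integral>z. z \<partial>density (S x a y) (\<lambda>_. ennreal (prob H)))"
    unfolding H_def reward_distr[OF E a] ..
  also have "\<dots> = prob H * mean_reward S x a y"
    by (simp add: integral_density mean_reward_def)
  finally show ?thesis .
qed

definition sqbound :: real where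
  "sqbound = (\<Sum>x\<in>UNIV. \<Sum>a\<in>A x. \<Sum>y\<in>UNIV. \<integral>z. z ^ 2 \<partial>S x a y)"

lemma sqbound_nonneg: "0 \<le> sqbound"
  unfolding sqbound_def by (intro sum_nonneg integral_nonneg_AE) auto

lemma sqbound:
  assumes a: "a \<in> A x"
  shows "(\<integral>\<^sup>+z. ennreal (z ^ 2) \<partial>S x a y) \<le> ennreal sqbound"
proof -
  have nn: "0 \<le> (\<integral>z. z ^ 2 \<partial>S x a y)" for x a y by (intro integral_nonneg_AE) auto
  have "(\<integral>z. z ^ 2 \<partial>S x a y) \<le> (\<Sum>y\<in>UNIV. \<integral>z. z ^ 2 \<partial>S x a y)"
    by (rule member_le_sum[where f = "\<lambda>y. \<integral>z. z ^ 2 \<partial>S x a y"]) (auto simp: nn)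
  also have "\<dots> \<le> (\<Sum>a\<in>A x. \<Sum>y\<in>UNIV. \<integral>z. z ^ 2 \<partial>S x a y)"
    by (rule member_le_sum[where f = "\<lambda>a. \<Sum>y\<in>UNIV. \<integral>z. z ^ 2 \<partial>S x a y"]) (auto intro: sum_nonneg nn a A_fin)
  also have "\<dots> \<le> sqbound"
    unfolding sqbound_def
    by (rule member_le_sum[where f = "\<lambda>x. \<Sum>a\<in>A x. \<Sum>y\<in>UNIV. \<integral>z. z ^ 2 \<partial>S x a y"]) (auto intro: sum_nonneg nn)
  finally have "ennreal (\<integral>z. z ^ 2 \<partial>S x a y) \<le> ennreal sqbound" by (rule ennreal_leI)
  also have "ennreal (\<integral>z. z ^ 2 \<partial>S x a y) = (\<integral>\<^sup>+z. ennreal (z ^ 2) \<partial>S x a y)"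
    by (rule nn_integral_eq_integral[symmetric]) (auto intro: S_sq a)
  finally show ?thesis .
qed

section \<open>Finite histories and their admissibility\<close>

definition L :: "nat \<Rightarrow> ('s \<times> 'a) list set" where
  "L n = {zs. set zs \<subseteq> Sigma UNIV A \<and> length zs = n}"

lemma finite_L: "finite (L n)"
  unfolding L_def by (intro finite_lists_length_eq finite_SigmaI A_fin) auto

lemma length_L: "zs \<in> L n \<Longrightarrow> length zs = n"
  by (simp add: L_def)

lemma L_0: "L 0 = {[]}"
  by (auto simp: L_def)

lemma L_SucE:
  assumes "l \<in> L (Suc n)"
  obtains zs x a where "l = zs @ [(x, a)]" "zs \<in> L n" "a \<in> A x"
proof -
  from assms obtain zs z where "l = zs @ [z]" by (cases l rule: rev_cases) (auto simp: L_def)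
  then show thesis using that[of zs "fst z" "snd z"] assms by (auto simp: L_def)
qed

lemma sum_L_Suc:
  fixes f :: "('s \<times> 'a) list \<Rightarrow> 'b::comm_monoid_add"
  shows "(\<Sum>l\<in>L (Suc n). f l) = (\<Sum>zs\<in>L n. \<Sum>x\<in>UNIV. \<Sum>a\<in>A x. f (zs @ [(x, a)]))"
proof -
  have eq: "L (Suc n) = (\<lambda>(zs, z). zs @ [z]) ` (L n \<times> Sigma UNIV A)"
  proof (intro set_eqI iffI)
    fix l assume "l \<in> L (Suc n)"
    then show "l \<in> (\<lambda>(zs, z). zs @ [z]) ` (L n \<times> Sigma UNIV A)" by (elim L_SucE) force
  qed (auto simp: L_def)
  have "(\<Sum>l\<in>L (Suc n). f l) = (\<Sum>(zs, z)\<in>L n \<times> Sigma UNIV A. f (zs @ [z]))"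
    unfolding eq by (subst sum.reindex) (auto simp: inj_on_def case_prod_unfold)
  also have "\<dots> = (\<Sum>zs\<in>L n. \<Sum>z\<in>Sigma UNIV A. f (zs @ [z]))"
    by (rule sum.cartesian_product[symmetric])
  also have "\<dots> = (\<Sum>zs\<in>L n. \<Sum>x\<in>UNIV. \<Sum>a\<in>A x. f (zs @ [(x, a)]))"
    by (intro sum.cong refl) (subst sum.Sigma, auto simp: A_fin case_prod_unfold)
  finally show ?thesis .
qed

lemma pathweight_mass: "(\<Sum>zs\<in>L n. \<Sum>y\<in>UNIV. pathweight k zs y \<omega>) = 1"
proof (induction n)
  case 0
  show ?case by (simp add: L_0 pathweight_Nil sum_pmf_UNIV)
next
  case (Suc n)
  have "(\<Sum>l\<in>L (Suc n). \<Sum>y\<in>UNIV. pathweight k l y \<omega>)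
    = (\<Sum>zs\<in>L n. \<Sum>x\<in>UNIV. \<Sum>a\<in>A x. \<Sum>y\<in>UNIV. pathweight k zs x \<omega> * (plc k \<omega> x a * pmf (P x a) y))"
    unfolding sum_L_Suc pathweight_snoc ..
  also have "\<dots> = (\<Sum>zs\<in>L n. \<Sum>x\<in>UNIV. pathweight k zs x \<omega>)"
    using sm_pibar[OF \<theta>(1), unfolded sm_def]
    by (intro sum.cong refl) (simp add: sum_pmf_UNIV flip: sum_distrib_left)
  finally show ?case using Suc by simp
qed

text \<open>In contrast to \<open>pth\<close> the next state is left open, so the event is decided
  as soon as the last action is drawn.\<close>

definition evt :: "nat \<Rightarrow> nat \<Rightarrow> ('s \<times> 'a) list set \<Rightarrow> 'm set" where
  "evt k n \<L> = {\<omega>\<in>space M. hist k n \<omega> \<in> \<L>}"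

text \<open>Path laws are known on cylinders that also fix the next state; summing over
  \<open>y\<close> removes it. The value type is general because both real and extended integrals
  are split this way.\<close>

lemma indicator_evt:
  assumes "\<L> \<subseteq> L n"
  shows "indicator (evt k n \<L>) \<omega> = (\<Sum>l\<in>\<L>. \<Sum>y\<in>UNIV. indicator (pth k l y) \<omega> :: 'b::semiring_1)"
proof (cases "\<omega> \<in> space M")
  case True
  have fin: "finite \<L>" using assms finite_L finite_subset by blast
  have "(\<Sum>l\<in>\<L>. \<Sum>y\<in>UNIV. indicator (pth k l y) \<omega> :: 'b) = (\<Sum>l\<in>\<L>. if l = hist k n \<omega> then 1 else 0)"
  proof (intro sum.cong refl)
    fix l assume "l \<in> \<L>"
    then have l: "length l = n" using assms length_L by blast
    have "(\<Sum>y\<in>UNIV. indicator (pth k l y) \<omega> :: 'b)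
      = (\<Sum>y\<in>UNIV. if y = Xs (Suc k) n \<omega> then (if l = hist k n \<omega> then 1 else 0) else 0)"
      using True l by (intro sum.cong refl) (auto simp: pth_def indicator_def)
    then show "(\<Sum>y\<in>UNIV. indicator (pth k l y) \<omega> :: 'b) = (if l = hist k n \<omega> then 1 else 0)"
      by simp
  qed
  also have "\<dots> = (if hist k n \<omega> \<in> \<L> then 1 else 0)" using fin by simp
  finally show ?thesis using True by (simp add: evt_def indicator_def)
qed (simp add: evt_def pth_def)

lemma evt_sets [measurable]:
  assumes "\<L> \<subseteq> L n"
  shows "evt k n \<L> \<in> events"
proof -
  have fin: "finite \<L>" using assms finite_L finite_subset by blast
  have "evt k n \<L> = (\<Union>l\<in>\<L>. \<Union>y\<in>UNIV. pth k l y)"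
  proof (intro set_eqI iffI)
    fix \<omega> assume "\<omega> \<in> evt k n \<L>"
    then have "hist k n \<omega> \<in> \<L>" "\<omega> \<in> pth k (hist k n \<omega>) (Xs (Suc k) n \<omega>)"
      by (auto simp: evt_def pth_def hist_def)
    then show "\<omega> \<in> (\<Union>l\<in>\<L>. \<Union>y\<in>UNIV. pth k l y)" by blast
  next
    fix \<omega> assume "\<omega> \<in> (\<Union>l\<in>\<L>. \<Union>y\<in>UNIV. pth k l y)"
    then obtain l y where l: "l \<in> \<L>" "\<omega> \<in> pth k l y" by blast
    then have "length l = n" using assms length_L by blast
    then show "\<omega> \<in> evt k n \<L>" using l by (simp add: evt_def pth_def)
  qed
  also have "\<dots> \<in> events" using fin by (intro sets.finite_UN pth_sets) auto
  finally show ?thesis .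
qed

lemma hist_Suc: "hist k (Suc n) \<omega> = hist k n \<omega> @ [(Xs (Suc k) n \<omega>, As (Suc k) n \<omega>)]"
  by (simp add: hist_def)

lemma take_hist: "take n (hist k (n + m) \<omega>) = hist k n \<omega>"
  by (simp add: hist_def take_map)

text \<open>Admissibility of the actions is not among the assumptions but follows from them: the
  weights of admissible paths add up to 1 by \<open>pathweight_mass\<close>, so all other histories
  have probability 0.\<close>

lemma AE_hist_valid: "AE \<omega> in M. \<forall>k n. hist k n \<omega> \<in> L n"
proof -
  have "AE \<omega> in M. hist k n \<omega> \<in> L n" for k n
  proof -
    have sp: "space M \<in> sets (F k)" using sets.top[of "F k"] by simp
    have int: "integrable M (indicator (pth k l y) :: _ \<Rightarrow> real)" "integrable M (pathweight k l y)" for l y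
      using pathweight_bounds by (auto intro: integrable_const_bound[of _ 1])
    have "(\<integral>\<omega>. indicator (pth k l y) \<omega> \<partial>M) = (\<integral>\<omega>. pathweight k l y \<omega> \<partial>M)" for l y
      using path_integral_mult[of "\<lambda>_. 1" k 1 l y] by simp
    then have "(\<integral>\<omega>. (\<Sum>l\<in>L n. \<Sum>y\<in>UNIV. indicator (pth k l y) \<omega>) \<partial>M)
      = (\<integral>\<omega>. (\<Sum>l\<in>L n. \<Sum>y\<in>UNIV. pathweight k l y \<omega>) \<partial>M)"
      using int by (simp only: Bochner_Integration.integral_sum Bochner_Integration.integrable_sum)
    also have "\<dots> = 1" unfolding pathweight_mass by (simp add: prob_space)
    finally have "(\<integral>\<omega>. indicator (evt k n (L n)) \<omega> \<partial>M) = (1::real)"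
      by (simp only: indicator_evt[OF order_refl])
    then have "prob (evt k n (L n)) = 1" using evt_sets[OF order_refl, of k n] by simp
    then have "AE \<omega> in M. \<omega> \<in> evt k n (L n)" by (rule AE_prob_1)
    then show ?thesis by eventually_elim (simp add: evt_def)
  qed
  then show ?thesis by (simp add: AE_all_countable)
qed

lemma nn_integral_evt:
  fixes g :: "'m \<Rightarrow> ennreal"
  assumes \<L>: "\<L> \<subseteq> L n" and [measurable]: "g \<in> borel_measurable M"
  shows "(\<integral>\<^sup>+\<omega>. g \<omega> * indicator (evt k n \<L>) \<omega> \<partial>M) = (\<Sum>l\<in>\<L>. \<Sum>y\<in>UNIV. \<integral>\<^sup>+\<omega>. g \<omega> * indicator (pth k l y) \<omega> \<partial>M)"
  unfolding indicator_evt[OF \<L>] sum_distrib_left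
proof -
  have "(\<integral>\<^sup>+\<omega>. (\<Sum>l\<in>\<L>. \<Sum>y\<in>UNIV. g \<omega> * indicator (pth k l y) \<omega>) \<partial>M)
    = (\<Sum>l\<in>\<L>. \<integral>\<^sup>+\<omega>. (\<Sum>y\<in>UNIV. g \<omega> * indicator (pth k l y) \<omega>) \<partial>M)"
    by (rule nn_integral_sum) measurable
  also have "\<dots> = (\<Sum>l\<in>\<L>. \<Sum>y\<in>UNIV. \<integral>\<^sup>+\<omega>. g \<omega> * indicator (pth k l y) \<omega> \<partial>M)"
    by (intro sum.cong refl nn_integral_sum) measurable
  finally show "(\<integral>\<^sup>+\<omega>. (\<Sum>l\<in>\<L>. \<Sum>y\<in>UNIV. g \<omega> * indicator (pth k l y) \<omega>) \<partial>M)
    = (\<Sum>l\<in>\<L>. \<Sum>y\<in>UNIV. \<integral>\<^sup>+\<omega>. g \<omega> * indicator (pth k l y) \<omega> \<partial>M)" .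
qed

section \<open>Second moments of rewards given the past and a history\<close>

lemma reward_square_step:
  assumes E: "E \<in> sets (F k)" and \<L>: "\<L> \<subseteq> L (Suc m)"
  shows "(\<integral>\<^sup>+\<omega>. indicator E \<omega> * indicator (evt k (Suc m) \<L>) \<omega> * ennreal ((Rs (Suc k) (Suc m) \<omega>)\<^sup>2) \<partial>M)
    \<le> ennreal sqbound * (\<integral>\<^sup>+\<omega>. indicator E \<omega> * indicator (evt k (Suc m) \<L>) \<omega> \<partial>M)"
proof -
  have [measurable]: "E \<in> events" by (rule in_F_sets[OF E])
  have single: "(\<integral>\<^sup>+\<omega>. indicator E \<omega> * indicator (pth k l y) \<omega> * ennreal ((Rs (Suc k) (Suc m) \<omega>)\<^sup>2) \<partial>M)
    \<le> ennreal sqbound * (\<integral>\<^sup>+\<omega>. indicator E \<omega> * indicator (pth k l y) \<omega> \<partial>M)" if l: "l \<in> \<L>" for l y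
  proof -
    obtain zs x a where l: "l = zs @ [(x, a)]" "zs \<in> L m" "a \<in> A x"
      using L_SucE \<L> l by blast
    have m: "length zs = m" using l(2) by (rule length_L)
    have "(\<integral>\<^sup>+\<omega>. indicator E \<omega> * indicator (pth k l y) \<omega> * ennreal ((Rs (Suc k) (Suc m) \<omega>)\<^sup>2) \<partial>M)
      = emeasure M (E \<inter> pth k l y) * (\<integral>\<^sup>+z. ennreal (z\<^sup>2) \<partial>S x a y)"
      using reward_nn_integral[OF E l(3), of "\<lambda>z. ennreal (z\<^sup>2)" zs y]
      unfolding l(1)[symmetric] m by (simp add: indicator_inter_arith)
    also have "\<dots> \<le> emeasure M (E \<inter> pth k l y) * ennreal sqbound"
      by (intro mult_left_mono sqbound l) auto
    also have "\<dots> = ennreal sqbound * (\<integral>\<^sup>+\<omega>. indicator E \<omega> * indicator (pth k l y) \<omega> \<partial>M)"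
      by (simp add: mult.commute flip: indicator_inter_arith)
    finally show ?thesis .
  qed
  have "(\<integral>\<^sup>+\<omega>. indicator E \<omega> * indicator (evt k (Suc m) \<L>) \<omega> * ennreal ((Rs (Suc k) (Suc m) \<omega>)\<^sup>2) \<partial>M)
    = (\<Sum>l\<in>\<L>. \<Sum>y\<in>UNIV. \<integral>\<^sup>+\<omega>. indicator E \<omega> * indicator (pth k l y) \<omega> * ennreal ((Rs (Suc k) (Suc m) \<omega>)\<^sup>2) \<partial>M)"
    unfolding indicator_evt[OF \<L>] sum_distrib_left sum_distrib_right by (simp add: nn_integral_sum)
  also have "\<dots> \<le> (\<Sum>l\<in>\<L>. \<Sum>y\<in>UNIV. ennreal sqbound * (\<integral>\<^sup>+\<omega>. indicator E \<omega> * indicator (pth k l y) \<omega> \<partial>M))"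
    by (intro sum_mono single)
  also have "\<dots> = ennreal sqbound * (\<Sum>l\<in>\<L>. \<Sum>y\<in>UNIV. (\<integral>\<^sup>+\<omega>. indicator E \<omega> * indicator (pth k l y) \<omega> \<partial>M))"
    by (simp only: sum_distrib_left)
  also have "(\<Sum>l\<in>\<L>. \<Sum>y\<in>UNIV. (\<integral>\<^sup>+\<omega>. indicator E \<omega> * indicator (pth k l y) \<omega> \<partial>M))
    = (\<integral>\<^sup>+\<omega>. indicator E \<omega> * indicator (evt k (Suc m) \<L>) \<omega> \<partial>M)"
    by (rule nn_integral_evt[symmetric, OF \<L>]) measurable
  finally show ?thesis .
qed

text \<open>Up to a null set, a history event of \<open>Suc s\<close> pairs is the event of all
  longer admissible histories extending it. So the bound for the reward directly after a history
  passes to all later rewards.\<close>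

lemma reward_square:
  assumes E: "E \<in> sets (F k)" and \<L>: "\<L> \<subseteq> L (Suc s)"
  shows "(\<integral>\<^sup>+\<omega>. indicator E \<omega> * indicator (evt k (Suc s) \<L>) \<omega> * ennreal ((Rs (Suc k) (Suc (s + t)) \<omega>)\<^sup>2) \<partial>M)
    \<le> ennreal sqbound * (\<integral>\<^sup>+\<omega>. indicator E \<omega> * indicator (evt k (Suc s) \<L>) \<omega> \<partial>M)"
proof -
  define \<L>' where "\<L>' = {l\<in>L (Suc (s + t)). take (Suc s) l \<in> \<L>}"
  have eq: "AE \<omega> in M. indicator (evt k (Suc s) \<L>) \<omega> = (indicator (evt k (Suc (s + t)) \<L>') \<omega> :: ennreal)"
    using AE_hist_valid
  proof eventually_elim
    case (elim \<omega>)
    have "take (Suc s) (hist k (Suc (s + t)) \<omega>) = hist k (Suc s) \<omega>"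
      using take_hist[of "Suc s" k t \<omega>] by simp
    then show ?case using elim by (simp add: indicator_def evt_def \<L>'_def)
  qed
  have "(\<integral>\<^sup>+\<omega>. indicator E \<omega> * indicator (evt k (Suc s) \<L>) \<omega> * ennreal ((Rs (Suc k) (Suc (s + t)) \<omega>)\<^sup>2) \<partial>M)
    = (\<integral>\<^sup>+\<omega>. indicator E \<omega> * indicator (evt k (Suc (s + t)) \<L>') \<omega> * ennreal ((Rs (Suc k) (Suc (s + t)) \<omega>)\<^sup>2) \<partial>M)"
    by (rule nn_integral_cong_AE, use eq in eventually_elim) simp
  also have "\<dots> \<le> ennreal sqbound * (\<integral>\<^sup>+\<omega>. indicator E \<omega> * indicator (evt k (Suc (s + t)) \<L>') \<omega> \<partial>M)"
    by (intro reward_square_step E) (auto simp: \<L>'_def)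
  also have "(\<integral>\<^sup>+\<omega>. indicator E \<omega> * indicator (evt k (Suc (s + t)) \<L>') \<omega> \<partial>M) = (\<integral>\<^sup>+\<omega>. indicator E \<omega> * indicator (evt k (Suc s) \<L>) \<omega> \<partial>M)"
    by (rule nn_integral_cong_AE, use eq in eventually_elim) simp
  finally show ?thesis .
qed

lemma reward_square_total: "(\<integral>\<^sup>+\<omega>. ennreal ((Rs (Suc k) (Suc t) \<omega>)\<^sup>2) \<partial>M) \<le> ennreal sqbound"
proof -
  have sp: "space M \<in> sets (F k)" using sets.top[of "F k"] by simp
  have one: "AE \<omega> in M. indicator (space M) \<omega> * indicator (evt k (Suc 0) (L (Suc 0))) \<omega> = (1::ennreal)"
    using AE_hist_valid AE_space
  proof eventually_elim
    case (elim \<omega>)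
    then have "\<omega> \<in> evt k (Suc 0) (L (Suc 0))" unfolding evt_def by blast
    then show ?case using elim by simp
  qed
  have "(\<integral>\<^sup>+\<omega>. ennreal ((Rs (Suc k) (Suc t) \<omega>)\<^sup>2) \<partial>M)
    = (\<integral>\<^sup>+\<omega>. indicator (space M) \<omega> * indicator (evt k (Suc 0) (L (Suc 0))) \<omega> * ennreal ((Rs (Suc k) (Suc t) \<omega>)\<^sup>2) \<partial>M)"
    by (rule nn_integral_cong_AE, use one in eventually_elim) simp
  also have "\<dots> \<le> ennreal sqbound * (\<integral>\<^sup>+\<omega>. indicator (space M) \<omega> * indicator (evt k (Suc 0) (L (Suc 0))) \<omega> \<partial>M)"
    using reward_square[OF sp order_refl, of 0 t] by simp
  also have "(\<integral>\<^sup>+\<omega>. indicator (space M) \<omega> * indicator (evt k (Suc 0) (L (Suc 0))) \<omega> \<partial>M) = (\<integral>\<^sup>+\<omega>. 1 \<partial>M)"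
    using one by (rule nn_integral_cong_AE)
  also have "ennreal sqbound * \<dots> = ennreal sqbound" by (simp add: emeasure_space_1)
  finally show ?thesis .
qed

lemma integrable_reward: "integrable M (Rs (Suc k) (Suc t))"
proof -
  have sq: "integrable M (\<lambda>\<omega>. (Rs (Suc k) (Suc t) \<omega>)\<^sup>2)"
  proof (rule integrableI_bounded)
    have "(\<integral>\<^sup>+\<omega>. ennreal (norm ((Rs (Suc k) (Suc t) \<omega>)\<^sup>2)) \<partial>M) \<le> ennreal sqbound"
      using reward_square_total[of k t] by simp
    also have "\<dots> < \<infinity>" by simp
    finally show "(\<integral>\<^sup>+\<omega>. ennreal (norm ((Rs (Suc k) (Suc t) \<omega>)\<^sup>2)) \<partial>M) < \<infinity>" .
  qed measurable
  show ?thesis by (rule square_integrable_imp_integrable[OF _ sq]) measurable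
qed

text \<open>The expected discounted sum of squares is at most \<open>sqbound\<close> times the
  geometric series. All starts \<open>s\<close> are covered at once because the first visit is
  random; this is what makes the infinite sum in \<open>ret\<close> a genuine limit.\<close>

lemma AE_summable_rewards: "AE \<omega> in M. \<forall>k s. summable (\<lambda>t. \<gamma> ^ t * (Rs (Suc k) (Suc (s + t)) \<omega>)\<^sup>2)"
proof -
  have "AE \<omega> in M. summable (\<lambda>t. \<gamma> ^ t * (Rs (Suc k) (Suc (s + t)) \<omega>)\<^sup>2)" for k s
  proof -
    have geo: "summable (\<lambda>t. \<gamma> ^ t * sqbound)" using \<gamma>_nonneg \<gamma>_less_1 by (intro summable_mult2) simp
    have "(\<integral>\<^sup>+\<omega>. (\<Sum>t. ennreal (\<gamma> ^ t * (Rs (Suc k) (Suc (s + t)) \<omega>)\<^sup>2)) \<partial>M)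
      = (\<Sum>t. \<integral>\<^sup>+\<omega>. ennreal (\<gamma> ^ t * (Rs (Suc k) (Suc (s + t)) \<omega>)\<^sup>2) \<partial>M)"
      by (rule nn_integral_suminf) measurable
    also have "\<dots> \<le> (\<Sum>t. ennreal (\<gamma> ^ t * sqbound))"
    proof (intro suminf_le)
      fix t
      have "(\<integral>\<^sup>+\<omega>. ennreal (\<gamma> ^ t * (Rs (Suc k) (Suc (s + t)) \<omega>)\<^sup>2) \<partial>M)
        = ennreal (\<gamma> ^ t) * (\<integral>\<^sup>+\<omega>. ennreal ((Rs (Suc k) (Suc (s + t)) \<omega>)\<^sup>2) \<partial>M)"
        using \<gamma>_nonneg by (simp add: ennreal_mult nn_integral_cmult)
      also have "\<dots> \<le> ennreal (\<gamma> ^ t) * ennreal sqbound"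
        by (intro mult_left_mono reward_square_total) auto
      finally show "(\<integral>\<^sup>+\<omega>. ennreal (\<gamma> ^ t * (Rs (Suc k) (Suc (s + t)) \<omega>)\<^sup>2) \<partial>M) \<le> ennreal (\<gamma> ^ t * sqbound)"
        using \<gamma>_nonneg sqbound_nonneg by (simp add: ennreal_mult)
    qed auto
    also have "\<dots> = ennreal (\<Sum>t. \<gamma> ^ t * sqbound)"
      using \<gamma>_nonneg sqbound_nonneg by (intro suminf_ennreal2 geo) auto
    also have "\<dots> < \<infinity>" by simp
    finally have "(\<integral>\<^sup>+\<omega>. (\<Sum>t. ennreal (\<gamma> ^ t * (Rs (Suc k) (Suc (s + t)) \<omega>)\<^sup>2)) \<partial>M) \<noteq> \<infinity>" by simp
    then have "AE \<omega> in M. (\<Sum>t. ennreal (\<gamma> ^ t * (Rs (Suc k) (Suc (s + t)) \<omega>)\<^sup>2)) \<noteq> \<infinity>"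
      by (intro nn_integral_PInf_AE) measurable
    then show ?thesis
    proof eventually_elim
      case (elim \<omega>)
      show ?case by (rule summable_suminf_not_top) (use elim \<gamma>_nonneg in auto)
    qed
  qed
  then show ?thesis by (simp add: AE_all_countable)
qed

section \<open>First-visit returns\<close>

abbreviation "vn k n \<omega> \<equiv> vfin A P S \<gamma> (sm_policy (plc k \<omega>)) n []"

text \<open>The truncated return from time \<open>s\<close> in episode \<open>k + 1\<close>; the
  reward earned at time t carries the index t + 1.\<close>

definition Rsum :: "nat \<Rightarrow> nat \<Rightarrow> nat \<Rightarrow> 'm \<Rightarrow> real" where
  "Rsum k s n \<omega> = (\<Sum>t<n. \<gamma> ^ t * Rs (Suc k) (Suc (s + t)) \<omega>)"

lemma is_policy_plc: "is_policy A (sm_policy (plc k \<omega>))"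
  by (intro is_policy_sm sm_pibar \<theta>)

lemma vn_F [measurable]: "(\<lambda>\<omega>. vn k n \<omega> y) \<in> borel_measurable (F k)"
proof (induction n arbitrary: y)
  case (Suc n)
  note Suc [measurable]
  show ?case unfolding vfin_sm_Suc qval_def by measurable
qed simp

lemma qval_vn_F [measurable]: "(\<lambda>\<omega>. qval (vn k n \<omega>) x a) \<in> borel_measurable (F k)"
  unfolding qval_def by measurable

lemma qval_vn_M [measurable]: "(\<lambda>\<omega>. qval (vn k n \<omega>) x a) \<in> borel_measurable M"
  by (rule from_F) (rule qval_vn_F)

lemma vn_M [measurable]: "(\<lambda>\<omega>. vn k n \<omega> y) \<in> borel_measurable M"
  by (rule from_F) (rule vn_F)

lemma Vsm_F [measurable]: "(\<lambda>\<omega>. Vsm (plc k \<omega>) y) \<in> borel_measurable (F k)"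
  by (rule borel_measurable_LIMSEQ_real[OF vfin_tendsto[OF is_policy_plc] vn_F])

lemma qval_Vsm_F [measurable]: "(\<lambda>\<omega>. qval (Vsm (plc k \<omega>)) x a) \<in> borel_measurable (F k)"
  unfolding qval_def by measurable

lemma qval_Vsm_M [measurable]: "(\<lambda>\<omega>. qval (Vsm (plc k \<omega>)) x a) \<in> borel_measurable M"
  by (rule from_F) (rule qval_Vsm_F)

lemma qval_vn_bounded: "a \<in> A x \<Longrightarrow> \<bar>qval (vn k n \<omega>) x a\<bar> \<le> vbound"
  by (rule abs_qval_le) (auto intro: vfin_bounded is_policy_plc)

lemma qval_Vsm_bounded: "a \<in> A x \<Longrightarrow> \<bar>qval (Vsm (plc k \<omega>)) x a\<bar> \<le> vbound"
  by (rule abs_qval_le) (auto intro: Vpol_bounded is_policy_plc)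

lemma Rsum_measurable [measurable]: "Rsum k s n \<in> borel_measurable M"
  unfolding Rsum_def by measurable

lemma integrable_Rsum: "integrable M (Rsum k s n)"
  unfolding Rsum_def by (intro Bochner_Integration.integrable_sum integrable_mult_right integrable_reward)

lemma Rsum_Suc: "Rsum k s (Suc n) \<omega> = Rs (Suc k) (Suc s) \<omega> + \<gamma> * Rsum k (Suc s) n \<omega>"
  unfolding Rsum_def sum.lessThan_Suc_shift by (simp add: sum_distrib_left ac_simps)

section \<open>Conditional means of truncated returns by backward induction\<close>

lemma integrable_indicator_mult:
  fixes g :: "'m \<Rightarrow> real"
  assumes "B \<in> events" "integrable M g"
  shows "integrable M (\<lambda>\<omega>. indicator B \<omega> * g \<omega>)"
  using integrable_mult_indicator[OF assms] by simp

lemma integral_evt_singleton: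
  fixes g :: "'m \<Rightarrow> real"
  assumes l: "l \<in> L n" and g: "integrable M g"
  shows "(\<integral>\<omega>. indicator (evt k n {l}) \<omega> * g \<omega> \<partial>M) = (\<Sum>y\<in>UNIV. \<integral>\<omega>. indicator (pth k l y) \<omega> * g \<omega> \<partial>M)"
proof -
  have "(\<lambda>\<omega>. indicator (evt k n {l}) \<omega> * g \<omega>) = (\<lambda>\<omega>. \<Sum>y\<in>UNIV. indicator (pth k l y) \<omega> * g \<omega>)"
  proof
    fix \<omega>
    have "indicator (evt k n {l}) \<omega> = (\<Sum>y\<in>UNIV. indicator (pth k l y) \<omega> :: real)"
      using l by (subst indicator_evt) auto
    then show "indicator (evt k n {l}) \<omega> * g \<omega> = (\<Sum>y\<in>UNIV. indicator (pth k l y) \<omega> * g \<omega>)"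
      by (simp only: sum_distrib_right)
  qed
  then show ?thesis
    by (simp only: Bochner_Integration.integral_sum[OF integrable_indicator_mult[OF pth_sets g]])
qed

text \<open>Splitting by the next state \<open>y\<close>, the first reward contributes its mean by
  \<open>reward_mean\<close> and the rest contributes \<open>IH\<close>; summed over
  \<open>y\<close> this is the lookahead \<open>qval\<close>. Taking \<open>IH\<close> as an
  assumption makes the step available inside the induction and again, after it, for
  centering.\<close>

lemma mean_step:
  assumes E: "E \<in> sets (F k)" and zs: "zs \<in> L m" and a: "a \<in> A x"
    and IH: "\<And>l y. l \<in> L (Suc m) \<Longrightarrow> (\<integral>\<omega>. indicator (pth k l y) \<omega> * (indicator E \<omega> * Rsum k (Suc m) n \<omega>) \<partial>M)
        = (\<integral>\<omega>. indicator E \<omega> * (pathweight k l y \<omega> * vn k n \<omega> y) \<partial>M)"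
  shows "(\<integral>\<omega>. indicator (evt k (Suc m) {zs @ [(x, a)]}) \<omega> * (indicator E \<omega> * Rsum k m (Suc n) \<omega>) \<partial>M)
    = (\<integral>\<omega>. indicator E \<omega> * (pathweight k zs x \<omega> * plc k \<omega> x a * qval (vn k n \<omega>) x a) \<partial>M)"
proof -
  have [measurable]: "E \<in> events" by (rule in_F_sets[OF E])
  let ?l = "zs @ [(x, a)]"
  have l: "?l \<in> L (Suc m)" using zs a by (auto simp: L_def)
  have m: "length zs = m" by (rule length_L[OF zs])
  have int_w: "integrable M (\<lambda>\<omega>. pathweight k ?l y \<omega> * (indicator E \<omega> * g \<omega>))"
    if [measurable]: "g \<in> borel_measurable M" and g: "\<And>\<omega>. \<bar>g \<omega>\<bar> \<le> c" for g c y
  proof (rule integrable_bounded_mult[where B = 1])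
    have "integrable M g" using g by (intro integrable_const_bound[of _ c]) auto
    then show "integrable M (\<lambda>\<omega>. indicator E \<omega> * g \<omega>)" by (rule integrable_indicator_mult[rotated]) simp
  qed (use pathweight_bounds in auto)
  have "(\<integral>\<omega>. indicator (pth k ?l y) \<omega> * (indicator E \<omega> * Rsum k m (Suc n) \<omega>) \<partial>M)
    = (\<integral>\<omega>. indicator E \<omega> * (pathweight k ?l y \<omega> * (mean_reward S x a y + \<gamma> * vn k n \<omega> y)) \<partial>M)" for y
  proof -
    let ?H = "E \<inter> pth k ?l y"
    have "(\<integral>\<omega>. indicator (pth k ?l y) \<omega> * (indicator E \<omega> * Rsum k m (Suc n) \<omega>) \<partial>M)
      = (\<integral>\<omega>. indicator ?H \<omega> * Rs (Suc k) (Suc m) \<omega> + \<gamma> * (indicator (pth k ?l y) \<omega> * (indicator E \<omega> * Rsum k (Suc m) n \<omega>)) \<partial>M)"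
      by (intro Bochner_Integration.integral_cong refl) (simp add: Rsum_Suc indicator_inter_arith algebra_simps)
    also have "\<dots> = (\<integral>\<omega>. indicator ?H \<omega> * Rs (Suc k) (Suc m) \<omega> \<partial>M)
        + \<gamma> * (\<integral>\<omega>. indicator (pth k ?l y) \<omega> * (indicator E \<omega> * Rsum k (Suc m) n \<omega>) \<partial>M)"
      by (subst Bochner_Integration.integral_add)
        (auto intro!: integrable_indicator_mult integrable_mult_right integrable_Rsum integrable_reward)
    also have "(\<integral>\<omega>. indicator ?H \<omega> * Rs (Suc k) (Suc m) \<omega> \<partial>M) = prob ?H * mean_reward S x a y"
      using reward_mean[OF E a, of zs y] unfolding m .
    also have "prob ?H = (\<integral>\<omega>. indicator E \<omega> * pathweight k ?l y \<omega> \<partial>M)"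
      unfolding path_integral[OF E, symmetric] by (simp flip: indicator_inter_arith)
    also have "(\<integral>\<omega>. indicator E \<omega> * pathweight k ?l y \<omega> \<partial>M) * mean_reward S x a y
        + \<gamma> * (\<integral>\<omega>. indicator (pth k ?l y) \<omega> * (indicator E \<omega> * Rsum k (Suc m) n \<omega>) \<partial>M)
      = (\<integral>\<omega>. pathweight k ?l y \<omega> * (indicator E \<omega> * mean_reward S x a y)
          + \<gamma> * (pathweight k ?l y \<omega> * (indicator E \<omega> * vn k n \<omega> y)) \<partial>M)"
    proof -
      have i1: "integrable M (\<lambda>\<omega>. pathweight k ?l y \<omega> * (indicator E \<omega> * mean_reward S x a y))"
        by (rule int_w[of _ "\<bar>mean_reward S x a y\<bar>"]) auto
      have i2: "integrable M (\<lambda>\<omega>. \<gamma> * (pathweight k ?l y \<omega> * (indicator E \<omega> * vn k n \<omega> y)))"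
        by (intro integrable_mult_right int_w[of _ vbound] vfin_bounded is_policy_plc) measurable
      have "(\<integral>\<omega>. indicator E \<omega> * pathweight k ?l y \<omega> \<partial>M) * mean_reward S x a y
          = (\<integral>\<omega>. pathweight k ?l y \<omega> * (indicator E \<omega> * mean_reward S x a y) \<partial>M)"
        unfolding integral_mult_left_zero[symmetric] by (simp only: ac_simps)
      moreover have "\<gamma> * (\<integral>\<omega>. indicator (pth k ?l y) \<omega> * (indicator E \<omega> * Rsum k (Suc m) n \<omega>) \<partial>M)
          = (\<integral>\<omega>. \<gamma> * (pathweight k ?l y \<omega> * (indicator E \<omega> * vn k n \<omega> y)) \<partial>M)"
        unfolding IH[OF l] integral_mult_right_zero by (simp only: mult.left_commute)
      ultimately show ?thesis
        by (simp only: Bochner_Integration.integral_add[OF i1 i2])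
    qed
    also have "\<dots> = (\<integral>\<omega>. indicator E \<omega> * (pathweight k ?l y \<omega> * (mean_reward S x a y + \<gamma> * vn k n \<omega> y)) \<partial>M)"
      by (intro Bochner_Integration.integral_cong refl) (simp add: algebra_simps)
    finally show ?thesis .
  qed
  then have "(\<integral>\<omega>. indicator (evt k (Suc m) {?l}) \<omega> * (indicator E \<omega> * Rsum k m (Suc n) \<omega>) \<partial>M)
    = (\<Sum>y\<in>UNIV. \<integral>\<omega>. indicator E \<omega> * (pathweight k ?l y \<omega> * (mean_reward S x a y + \<gamma> * vn k n \<omega> y)) \<partial>M)"
    by (subst integral_evt_singleton[OF l]) (auto intro!: integrable_indicator_mult integrable_Rsum)
  also have "\<dots> = (\<integral>\<omega>. (\<Sum>y\<in>UNIV. indicator E \<omega> * (pathweight k ?l y \<omega> * (mean_reward S x a y + \<gamma> * vn k n \<omega> y))) \<partial>M)"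
  proof (rule Bochner_Integration.integral_sum[symmetric])
    fix y
    have vb: "\<bar>vn k n \<omega> y\<bar> \<le> vbound" for \<omega> by (rule vfin_bounded[OF is_policy_plc])
    have "\<bar>mean_reward S x a y + \<gamma> * vn k n \<omega> y\<bar> \<le> \<bar>mean_reward S x a y\<bar> + \<gamma> * vbound" for \<omega>
      using mult_left_mono[OF vb[of \<omega>] \<gamma>_nonneg] \<gamma>_nonneg
        abs_triangle_ineq[of "mean_reward S x a y" "\<gamma> * vn k n \<omega> y"] by (simp add: abs_mult)
    then have "integrable M (\<lambda>\<omega>. pathweight k ?l y \<omega> * (indicator E \<omega> * (mean_reward S x a y + \<gamma> * vn k n \<omega> y)))"
      by (intro int_w) measurable
    then show "integrable M (\<lambda>\<omega>. indicator E \<omega> * (pathweight k ?l y \<omega> * (mean_reward S x a y + \<gamma> * vn k n \<omega> y)))"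
      by (simp add: ac_simps)
  qed
  also have "\<dots> = (\<integral>\<omega>. indicator E \<omega> * (pathweight k zs x \<omega> * plc k \<omega> x a * qval (vn k n \<omega>) x a) \<partial>M)"
    unfolding pathweight_snoc qval_def
    by (intro Bochner_Integration.integral_cong refl) (simp only: sum_distrib_left mult.assoc)
  finally show ?thesis .
qed

text \<open>The next action lies in \<open>A x\<close> almost surely, so up to a null set a cylinder
  ending in \<open>x\<close> splits by finitely many actions.\<close>

lemma AE_pth_split:
  assumes zs: "zs \<in> L m"
  shows "AE \<omega> in M. indicator (pth k zs x) \<omega> = (\<Sum>a\<in>A x. indicator (evt k (Suc m) {zs @ [(x, a)]}) \<omega> :: real)"
  using AE_hist_valid AE_space
proof eventually_elim
  case (elim \<omega>)
  have m: "length zs = m" by (rule length_L[OF zs])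
  have "hist k (Suc m) \<omega> \<in> L (Suc m)" using elim by blast
  then have a: "As (Suc k) m \<omega> \<in> A (Xs (Suc k) m \<omega>)" by (simp add: hist_Suc L_def)
  have "(\<Sum>a\<in>A x. indicator (evt k (Suc m) {zs @ [(x, a)]}) \<omega> :: real)
    = (\<Sum>a\<in>A x. if a = As (Suc k) m \<omega> then indicator (pth k zs x) \<omega> else 0)"
    using elim m by (intro sum.cong refl) (auto simp: evt_def pth_def hist_Suc indicator_def)
  also have "\<dots> = (if As (Suc k) m \<omega> \<in> A x then indicator (pth k zs x) \<omega> else 0)"
    using A_fin by simp
  also have "\<dots> = indicator (pth k zs x) \<omega>"
    using a m by (auto simp: pth_def indicator_def)
  finally show ?case by simp
qed

text \<open>The path grows by one pair while the horizon shrinks by one, so \<open>zs\<close>,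
  \<open>m\<close> and \<open>x\<close> must vary in the induction.\<close>

lemma mean_value:
  assumes E: "E \<in> sets (F k)"
  shows "zs \<in> L m \<Longrightarrow> (\<integral>\<omega>. indicator (pth k zs x) \<omega> * (indicator E \<omega> * Rsum k m n \<omega>) \<partial>M)
        = (\<integral>\<omega>. indicator E \<omega> * (pathweight k zs x \<omega> * vn k n \<omega> x) \<partial>M)"
proof (induction n arbitrary: zs m x)
  case 0
  then show ?case by (simp add: Rsum_def)
next
  case (Suc n)
  have [measurable]: "E \<in> events" by (rule in_F_sets[OF E])
  have lc: "\<And>a. a \<in> A x \<Longrightarrow> zs @ [(x, a)] \<in> L (Suc m)" using Suc.prems by (auto simp: L_def)
  have ev: "evt k (Suc m) {zs @ [(x, a)]} \<in> events" if "a \<in> A x" for a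
    by (rule evt_sets) (use lc that in auto)
  have "(\<integral>\<omega>. indicator (pth k zs x) \<omega> * (indicator E \<omega> * Rsum k m (Suc n) \<omega>) \<partial>M)
    = (\<integral>\<omega>. (\<Sum>a\<in>A x. indicator (evt k (Suc m) {zs @ [(x, a)]}) \<omega> * (indicator E \<omega> * Rsum k m (Suc n) \<omega>)) \<partial>M)"
  proof (rule integral_cong_AE)
    show "AE \<omega> in M. indicator (pth k zs x) \<omega> * (indicator E \<omega> * Rsum k m (Suc n) \<omega>)
      = (\<Sum>a\<in>A x. indicator (evt k (Suc m) {zs @ [(x, a)]}) \<omega> * (indicator E \<omega> * Rsum k m (Suc n) \<omega>))"
      using AE_pth_split[OF Suc.prems, of k x] by eventually_elim (simp only: sum_distrib_right)
    show "(\<lambda>\<omega>. \<Sum>a\<in>A x. indicator (evt k (Suc m) {zs @ [(x, a)]}) \<omega> * (indicator E \<omega> * Rsum k m (Suc n) \<omega>)) \<in> borel_measurable M"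
      using ev by (intro borel_measurable_sum borel_measurable_times borel_measurable_indicator) auto
  qed measurable
  also have "\<dots> = (\<Sum>a\<in>A x. \<integral>\<omega>. indicator (evt k (Suc m) {zs @ [(x, a)]}) \<omega> * (indicator E \<omega> * Rsum k m (Suc n) \<omega>) \<partial>M)"
    by (intro Bochner_Integration.integral_sum integrable_indicator_mult integrable_Rsum ev) auto
  also have "\<dots> = (\<Sum>a\<in>A x. \<integral>\<omega>. indicator E \<omega> * (pathweight k zs x \<omega> * plc k \<omega> x a * qval (vn k n \<omega>) x a) \<partial>M)"
    by (intro sum.cong refl mean_step[OF E Suc.prems] Suc.IH)
  also have "\<dots> = (\<integral>\<omega>. (\<Sum>a\<in>A x. indicator E \<omega> * (pathweight k zs x \<omega> * plc k \<omega> x a * qval (vn k n \<omega>) x a)) \<partial>M)"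
  proof (rule Bochner_Integration.integral_sum[symmetric])
    fix a assume a: "a \<in> A x"
    show "integrable M (\<lambda>\<omega>. indicator E \<omega> * (pathweight k zs x \<omega> * plc k \<omega> x a * qval (vn k n \<omega>) x a))"
    proof (rule integrable_const_bound[of _ vbound])
      show "AE \<omega> in M. norm (indicator E \<omega> * (pathweight k zs x \<omega> * plc k \<omega> x a * qval (vn k n \<omega>) x a)) \<le> vbound"
      proof (rule AE_I2)
        fix \<omega>
        have "\<bar>pathweight k zs x \<omega> * plc k \<omega> x a\<bar> * \<bar>qval (vn k n \<omega>) x a\<bar> \<le> 1 * vbound"
          using pathweight_bounds[of k zs x \<omega>] pibar_nonneg[OF \<theta>(1)] pibar_le_1[OF \<theta>(1)] qval_vn_bounded[OF a]
          by (intro mult_mono) (auto simp: abs_mult intro: mult_le_one)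
        then show "norm (indicator E \<omega> * (pathweight k zs x \<omega> * plc k \<omega> x a * qval (vn k n \<omega>) x a)) \<le> vbound"
          using vbound_nonneg by (simp add: indicator_def abs_mult)
      qed
    qed measurable
  qed
  also have "\<dots> = (\<integral>\<omega>. indicator E \<omega> * (pathweight k zs x \<omega> * vn k (Suc n) \<omega> x) \<partial>M)"
    unfolding vfin_sm_Suc
    by (intro Bochner_Integration.integral_cong refl) (simp only: sum_distrib_left mult.assoc)
  finally show ?case .
qed

text \<open>The centering term is random but fixed by the past, so \<open>path_integral_mult\<close>
  replaces the cylinder by its weight there too, and both integrals reduce to the one in
  \<open>mean_step\<close>. \<open>Suc n\<close> rewards face \<open>vn k n\<close>, since
  \<open>qval\<close> accounts for the first.\<close>

lemma mean_centered:
  assumes E: "E \<in> sets (F k)" and zs: "zs \<in> L m" and a: "a \<in> A x"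
  shows "(\<integral>\<omega>. indicator (evt k (Suc m) {zs @ [(x, a)]}) \<omega> * (indicator E \<omega> * (Rsum k m (Suc n) \<omega> - qval (vn k n \<omega>) x a)) \<partial>M) = 0"
proof -
  let ?l = "zs @ [(x, a)]" and ?q = "\<lambda>\<omega>. qval (vn k n \<omega>) x a"
  have [measurable]: "E \<in> events" by (rule in_F_sets[OF E])
  have l: "?l \<in> L (Suc m)" using zs a by (auto simp: L_def)
  have ev [measurable]: "evt k (Suc m) {?l} \<in> events" by (rule evt_sets) (use l in auto)
  have q: "integrable M ?q" by (rule integrable_const_bound[of _ vbound]) (use qval_vn_bounded[OF a] in auto)
  have Eq: "integrable M (\<lambda>\<omega>. indicator E \<omega> * ?q \<omega>)" by (intro integrable_indicator_mult q) auto
  have EqF: "(\<lambda>\<omega>. indicator E \<omega> * ?q \<omega>) \<in> borel_measurable (F k)" using E by measurable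
  have bd: "\<bar>indicator E \<omega> * ?q \<omega>\<bar> \<le> vbound" for \<omega>
  proof -
    have "\<bar>?q \<omega>\<bar> \<le> vbound" by (rule qval_vn_bounded[OF a])
    then show ?thesis using vbound_nonneg by (auto simp: indicator_def)
  qed
  have "(\<integral>\<omega>. indicator (evt k (Suc m) {?l}) \<omega> * (indicator E \<omega> * ?q \<omega>) \<partial>M)
    = (\<Sum>y\<in>UNIV. \<integral>\<omega>. (indicator E \<omega> * ?q \<omega>) * indicator (pth k ?l y) \<omega> \<partial>M)"
    unfolding integral_evt_singleton[OF l Eq] by (simp only: mult.commute)
  also have "\<dots> = (\<Sum>y\<in>UNIV. \<integral>\<omega>. (indicator E \<omega> * ?q \<omega>) * pathweight k ?l y \<omega> \<partial>M)"
    by (intro sum.cong refl path_integral_mult[OF EqF bd])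
  also have "\<dots> = (\<integral>\<omega>. (\<Sum>y\<in>UNIV. (indicator E \<omega> * ?q \<omega>) * pathweight k ?l y \<omega>) \<partial>M)"
  proof (rule Bochner_Integration.integral_sum[symmetric])
    fix y
    have "integrable M (\<lambda>\<omega>. pathweight k ?l y \<omega> * (indicator E \<omega> * ?q \<omega>))"
      by (rule integrable_bounded_mult[OF _ _ Eq, of _ 1]) (use pathweight_bounds in auto)
    then show "integrable M (\<lambda>\<omega>. (indicator E \<omega> * ?q \<omega>) * pathweight k ?l y \<omega>)" by (simp only: mult.commute)
  qed
  also have "\<dots> = (\<integral>\<omega>. indicator E \<omega> * (pathweight k zs x \<omega> * plc k \<omega> x a * ?q \<omega>) \<partial>M)"
  proof (intro Bochner_Integration.integral_cong refl)
    fix \<omega>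
    have "(\<Sum>y\<in>UNIV. pathweight k ?l y \<omega>) = pathweight k zs x \<omega> * plc k \<omega> x a"
      unfolding pathweight_snoc by (simp add: sum_pmf_UNIV flip: sum_distrib_left)
    then show "(\<Sum>y\<in>UNIV. (indicator E \<omega> * ?q \<omega>) * pathweight k ?l y \<omega>) = indicator E \<omega> * (pathweight k zs x \<omega> * plc k \<omega> x a * ?q \<omega>)"
      unfolding sum_distrib_left[symmetric] by (simp only: ac_simps)
  qed
  also have "\<dots> = (\<integral>\<omega>. indicator (evt k (Suc m) {?l}) \<omega> * (indicator E \<omega> * Rsum k m (Suc n) \<omega>) \<partial>M)"
    by (rule mean_step[OF E zs a mean_value[OF E], symmetric])
  finally have eq: "(\<integral>\<omega>. indicator (evt k (Suc m) {?l}) \<omega> * (indicator E \<omega> * ?q \<omega>) \<partial>M)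
    = (\<integral>\<omega>. indicator (evt k (Suc m) {?l}) \<omega> * (indicator E \<omega> * Rsum k m (Suc n) \<omega>) \<partial>M)" .
  have "(\<integral>\<omega>. indicator (evt k (Suc m) {?l}) \<omega> * (indicator E \<omega> * (Rsum k m (Suc n) \<omega> - ?q \<omega>)) \<partial>M)
    = (\<integral>\<omega>. indicator (evt k (Suc m) {?l}) \<omega> * (indicator E \<omega> * Rsum k m (Suc n) \<omega>)
        - indicator (evt k (Suc m) {?l}) \<omega> * (indicator E \<omega> * ?q \<omega>) \<partial>M)"
    by (simp only: right_diff_distrib)
  also have "\<dots> = 0"
    by (subst Bochner_Integration.integral_diff)
      (auto intro!: integrable_indicator_mult integrable_Rsum Eq simp: eq)
  finally show ?thesis .
qed

section \<open>Events of a first visit at a given time, and the noise on them\<close>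

definition fv :: "nat \<Rightarrow> 's \<Rightarrow> 'a \<Rightarrow> ('s \<times> 'a) list set" where
  "fv s x a = (\<lambda>zs. zs @ [(x, a)]) ` {zs\<in>L s. (x, a) \<notin> set zs}"

abbreviation "FV k s x a \<equiv> evt k (Suc s) (fv s x a)"

abbreviation "fvt k x a \<omega> \<equiv> first_visit (\<lambda>i t. Xs i t \<omega>) (\<lambda>i t. As i t \<omega>) (Suc k) x a"

lemma fv_subset: "a \<in> A x \<Longrightarrow> fv s x a \<subseteq> L (Suc s)"
  by (auto simp: fv_def L_def)

text \<open>Admissible histories are required because \<open>fv\<close> collects only those. A first
  visit at time \<open>s\<close> is decided by \<open>Suc s\<close> pairs, before the reward of that
  time is drawn; this makes it an event to which \<open>mean_centered\<close> and
  \<open>reward_square\<close> apply.\<close>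

lemma FV_iff:
  assumes "\<And>n. hist k n \<omega> \<in> L n" "\<omega> \<in> space M"
  shows "\<omega> \<in> FV k s x a \<longleftrightarrow> vis (Suc k) x a \<omega> \<and> fvt k x a \<omega> = s"
proof -
  let ?Q = "\<lambda>t. Xs (Suc k) t \<omega> = x \<and> As (Suc k) t \<omega> = a"
  have set: "(x, a) \<in> set (hist k s \<omega>) \<longleftrightarrow> (\<exists>t<s. ?Q t)"
    unfolding hist_def by (auto simp: image_iff)
  have "hist k (Suc s) \<omega> \<in> fv s x a \<longleftrightarrow> (x, a) \<notin> set (hist k s \<omega>) \<and> ?Q s"
    using assms(1)[of s] by (auto simp: fv_def hist_Suc image_iff)
  then have "\<omega> \<in> FV k s x a \<longleftrightarrow> ?Q s \<and> (\<forall>t<s. \<not> ?Q t)"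
    using assms(2) set unfolding evt_def by blast
  then show ?thesis unfolding visits_def first_visit_def Least_eq_iff_first .
qed

lemma FV_sets [measurable]: "a \<in> A x \<Longrightarrow> FV k s x a \<in> events"
  by (rule evt_sets[OF fv_subset])

lemma AE_FV_indicator:
  "AE \<omega> in M. \<forall>s. indicator (FV k s x a) \<omega> = (if vis (Suc k) x a \<omega> \<and> s = fvt k x a \<omega> then 1 else 0 :: 'b::zero_neq_one)"
  using AE_hist_valid AE_space
proof eventually_elim
  case (elim \<omega>)
  have "\<And>n. hist k n \<omega> \<in> L n" using elim by blast
  from FV_iff[OF this elim(2)] show ?case by (auto simp: indicator_def)
qed

text \<open>The event is a disjoint union of finitely many single histories;
  \<open>mean_centered\<close> will supply the zero on each.\<close>

lemma FV_integral_zero: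
  fixes g :: "'m \<Rightarrow> real"
  assumes a: "a \<in> A x" and g: "integrable M g"
    and zero: "\<And>zs. zs \<in> L s \<Longrightarrow> (\<integral>\<omega>. indicator (evt k (Suc s) {zs @ [(x, a)]}) \<omega> * g \<omega> \<partial>M) = 0"
  shows "(\<integral>\<omega>. indicator (FV k s x a) \<omega> * g \<omega> \<partial>M) = 0"
proof -
  have fin: "finite (fv s x a)" by (rule finite_subset[OF fv_subset[OF a] finite_L])
  have ind: "indicator (FV k s x a) \<omega> = (\<Sum>l\<in>fv s x a. indicator (evt k (Suc s) {l}) \<omega> :: real)" for \<omega>
  proof (cases "\<omega> \<in> space M")
    case True
    have "(\<Sum>l\<in>fv s x a. indicator (evt k (Suc s) {l}) \<omega> :: real) = (\<Sum>l\<in>fv s x a. if l = hist k (Suc s) \<omega> then 1 else 0)"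
      using True by (intro sum.cong refl) (auto simp: evt_def indicator_def)
    then show ?thesis using True fin by (simp add: evt_def indicator_def)
  qed (simp add: evt_def)
  have ev: "evt k (Suc s) {l} \<in> events" if "l \<in> fv s x a" for l
    by (rule evt_sets) (use that fv_subset[OF a] in blast)
  have "(\<integral>\<omega>. indicator (FV k s x a) \<omega> * g \<omega> \<partial>M) = (\<integral>\<omega>. (\<Sum>l\<in>fv s x a. indicator (evt k (Suc s) {l}) \<omega> * g \<omega>) \<partial>M)"
    unfolding ind sum_distrib_right ..
  also have "\<dots> = (\<Sum>l\<in>fv s x a. \<integral>\<omega>. indicator (evt k (Suc s) {l}) \<omega> * g \<omega> \<partial>M)"
    by (intro Bochner_Integration.integral_sum integrable_indicator_mult ev g)
  also have "\<dots> = 0"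
    by (intro sum.neutral ballI) (auto simp: fv_def zero)
  finally show ?thesis .
qed

text \<open>Shifted index: \<open>err k\<close> is the noise of episode \<open>k + 1\<close>, which is run with policy \<open>plc k\<close>.\<close>

definition err :: "nat \<Rightarrow> 's \<Rightarrow> 'a \<Rightarrow> 'm \<Rightarrow> real" where
  "err k x a \<omega> = of_bool (vis (Suc k) x a \<omega>) * (rtn (Suc k) x a \<omega> - qval (Vsm (plc k \<omega>)) x a)"

lemma F_mono: "j \<le> k \<Longrightarrow> f \<in> measurable (F j) N \<Longrightarrow> f \<in> measurable (F k) N"
proof -
  assume jk: "j \<le> k" and f: "f \<in> measurable (F j) N"
  have "past_generator j \<subseteq> past_generator k"
    unfolding past_generator_def using jk by (intro UN_mono) auto
  then have "sets (F j) \<subseteq> sets (F k)"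
    unfolding F_eq sets_measure_of[OF past_generator_Pow] by (rule sigma_sets_mono')
  then show ?thesis using f by (auto simp: measurable_def)
qed

lemma err_F: "j < k \<Longrightarrow> err j x a \<in> borel_measurable (F k)"
proof -
  assume jk: "j < k"
  have [measurable]: "Measurable.pred (F k) (vis (Suc j) x a)" "rtn (Suc j) x a \<in> borel_measurable (F k)"
    using jk by (auto intro!: vis_F rtn_F)
  have [measurable]: "(\<lambda>\<omega>. qval (Vsm (plc j \<omega>)) x a) \<in> borel_measurable (F k)"
    by (rule F_mono[OF _ qval_Vsm_F]) (use jk in simp)
  show ?thesis unfolding err_def by measurable
qed

lemma err_M [measurable]: "err k x a \<in> borel_measurable M"
  by (rule from_F[OF err_F[of k "Suc k"]]) simp

lemma rtn_first_visit:
  assumes "vis (Suc k) x a \<omega>" "fvt k x a \<omega> = s"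
  shows "rtn (Suc k) x a \<omega> = (\<Sum>t. \<gamma> ^ t * Rs (Suc k) (Suc (s + t)) \<omega>)"
  using assms by (simp add: ret_def)

lemma expected_abs_reward: "(\<integral>\<omega>. \<bar>Rs (Suc k) (Suc t) \<omega>\<bar> \<partial>M) \<le> 1 + sqbound"
proof -
  have "ennreal (\<integral>\<omega>. \<bar>Rs (Suc k) (Suc t) \<omega>\<bar> \<partial>M) = (\<integral>\<^sup>+\<omega>. ennreal \<bar>Rs (Suc k) (Suc t) \<omega>\<bar> \<partial>M)"
    by (rule nn_integral_eq_integral[symmetric]) (auto intro: integrable_reward)
  also have "\<dots> \<le> (\<integral>\<^sup>+\<omega>. 1 + ennreal ((Rs (Suc k) (Suc t) \<omega>)\<^sup>2) \<partial>M)"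
  proof (rule nn_integral_mono)
    fix \<omega>
    have "\<bar>Rs (Suc k) (Suc t) \<omega>\<bar> \<le> 1 + (Rs (Suc k) (Suc t) \<omega>)\<^sup>2"
      using sum_squares_bound[of 1 "\<bar>Rs (Suc k) (Suc t) \<omega>\<bar>"] by simp
    then have "ennreal \<bar>Rs (Suc k) (Suc t) \<omega>\<bar> \<le> ennreal (1 + (Rs (Suc k) (Suc t) \<omega>)\<^sup>2)" by (rule ennreal_leI)
    then show "ennreal \<bar>Rs (Suc k) (Suc t) \<omega>\<bar> \<le> 1 + ennreal ((Rs (Suc k) (Suc t) \<omega>)\<^sup>2)"
      by (simp add: ennreal_plus)
  qed
  also have "\<dots> = 1 + (\<integral>\<^sup>+\<omega>. ennreal ((Rs (Suc k) (Suc t) \<omega>)\<^sup>2) \<partial>M)"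
    by (subst nn_integral_add) (auto simp: emeasure_space_1)
  also have "\<dots> \<le> 1 + ennreal sqbound" by (intro add_left_mono reward_square_total)
  also have "\<dots> = ennreal (1 + sqbound)" using sqbound_nonneg by (simp add: ennreal_plus)
  finally show ?thesis using sqbound_nonneg by (subst (asm) ennreal_le_iff) auto
qed

text \<open>On this event the centered truncated returns have mean 0 and converge to
  \<open>err\<close>. They are dominated by the discounted sum of absolute rewards plus
  \<open>vbound\<close>, integrable because mean absolute rewards are at most
  \<open>1 + sqbound\<close>.\<close>

lemma err_mean_FV:
  assumes E: "E \<in> sets (F k)" and a: "a \<in> A x"
  shows "(\<integral>\<omega>. indicator (FV k s x a) \<omega> * (indicator E \<omega> * err k x a \<omega>) \<partial>M) = 0"
proof -
  have [measurable]: "E \<in> events" by (rule in_F_sets[OF E])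
  have [measurable]: "FV k s x a \<in> events" by (rule FV_sets[OF a])
  let ?f = "\<lambda>n \<omega>. indicator (FV k s x a) \<omega> * (indicator E \<omega> * (Rsum k s (Suc n) \<omega> - qval (vn k n \<omega>) x a))"
  let ?r = "\<lambda>t \<omega>. \<gamma> ^ t * \<bar>Rs (Suc k) (Suc (s + t)) \<omega>\<bar>"
  have q: "integrable M (\<lambda>\<omega>. qval (vn k n \<omega>) x a)" for n
    by (rule integrable_const_bound[of _ vbound]) (use qval_vn_bounded[OF a] in auto)
  have zero: "(\<integral>\<omega>. ?f n \<omega> \<partial>M) = 0" for n
    by (rule FV_integral_zero[OF a _ mean_centered[OF E _ a]])
      (auto intro!: integrable_indicator_mult Bochner_Integration.integrable_diff integrable_Rsum q)
  have abs_sum: "AE \<omega> in M. summable (\<lambda>t. ?r t \<omega>)"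
    using AE_summable_rewards
  proof eventually_elim
    case (elim \<omega>)
    then have "summable (\<lambda>t. \<gamma> ^ t * (Rs (Suc k) (Suc (s + t)) \<omega>)\<^sup>2)" by blast
    then show ?case by (rule discounted_sum_squared_le(1)[OF \<gamma>_nonneg \<gamma>_less_1])
  qed
  have Y: "integrable M (\<lambda>\<omega>. \<Sum>t. ?r t \<omega>)"
  proof (rule integrable_suminf)
    show "integrable M (?r t)" for t by (intro integrable_mult_right integrable_abs integrable_reward)
    show "AE \<omega> in M. summable (\<lambda>t. norm (?r t \<omega>))"
      using abs_sum \<gamma>_nonneg by simp
    have geo: "summable (\<lambda>t. \<gamma> ^ t * (1 + sqbound))"
      using \<gamma>_nonneg \<gamma>_less_1 by (intro summable_mult2) simp
    show "summable (\<lambda>t. \<integral>\<omega>. norm (?r t \<omega>) \<partial>M)"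
    proof (rule summable_comparison_test'[OF geo, where N = 0])
      fix t
      have "(\<integral>\<omega>. norm (?r t \<omega>) \<partial>M) = \<gamma> ^ t * (\<integral>\<omega>. \<bar>Rs (Suc k) (Suc (s + t)) \<omega>\<bar> \<partial>M)"
        using \<gamma>_nonneg by simp
      also have "\<dots> \<le> \<gamma> ^ t * (1 + sqbound)"
        using \<gamma>_nonneg by (intro mult_left_mono expected_abs_reward) simp
      finally have "(\<integral>\<omega>. norm (?r t \<omega>) \<partial>M) \<le> \<gamma> ^ t * (1 + sqbound)" .
      moreover have "0 \<le> (\<integral>\<omega>. norm (?r t \<omega>) \<partial>M)" by (intro integral_nonneg_AE) simp
      ultimately show "norm (\<integral>\<omega>. norm (?r t \<omega>) \<partial>M) \<le> \<gamma> ^ t * (1 + sqbound)" by (simp only: real_norm_def abs_of_nonneg)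
    qed
  qed
  have "(\<lambda>n. \<integral>\<omega>. ?f n \<omega> \<partial>M) \<longlonglongrightarrow> (\<integral>\<omega>. indicator (FV k s x a) \<omega> * (indicator E \<omega> * err k x a \<omega>) \<partial>M)"
  proof (rule integral_dominated_convergence)
    show "integrable M (\<lambda>\<omega>. (\<Sum>t. ?r t \<omega>) + vbound)" using Y by simp
    show "AE \<omega> in M. (\<lambda>n. ?f n \<omega>) \<longlonglongrightarrow> indicator (FV k s x a) \<omega> * (indicator E \<omega> * err k x a \<omega>)"
      using abs_sum AE_FV_indicator[of k x a, where 'b = real]
    proof eventually_elim
      case (elim \<omega>)
      show ?case
      proof (cases "vis (Suc k) x a \<omega> \<and> s = fvt k x a \<omega>")
        case True
        have "summable (\<lambda>t. \<gamma> ^ t * Rs (Suc k) (Suc (s + t)) \<omega>)"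
          using elim(1) \<gamma>_nonneg
          by (intro summable_rabs_cancel[of "\<lambda>t. \<gamma> ^ t * Rs (Suc k) (Suc (s + t)) \<omega>"]) (simp add: abs_mult)
        then have "(\<lambda>n. Rsum k s n \<omega>) \<longlonglongrightarrow> (\<Sum>t. \<gamma> ^ t * Rs (Suc k) (Suc (s + t)) \<omega>)"
          unfolding Rsum_def by (rule summable_LIMSEQ)
        moreover have "rtn (Suc k) x a \<omega> = (\<Sum>t. \<gamma> ^ t * Rs (Suc k) (Suc (s + t)) \<omega>)"
          by (rule rtn_first_visit) (use True in auto)
        ultimately have "(\<lambda>n. Rsum k s (Suc n) \<omega>) \<longlonglongrightarrow> rtn (Suc k) x a \<omega>"
          by (intro LIMSEQ_Suc) simp
        then have "(\<lambda>n. indicator (FV k s x a) \<omega> * (indicator E \<omega> * (Rsum k s (Suc n) \<omega> - qval (vn k n \<omega>) x a)))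
          \<longlonglongrightarrow> indicator (FV k s x a) \<omega> * (indicator E \<omega> * (rtn (Suc k) x a \<omega> - qval (Vsm (plc k \<omega>)) x a))"
          by (intro tendsto_mult tendsto_diff tendsto_const tendsto_qval vfin_tendsto is_policy_plc)
        then show ?thesis using True by (simp add: err_def)
      next
        case False
        then have "indicator (FV k s x a) \<omega> = (0::real)" using elim(2) by simp
        then show ?thesis by simp
      qed
    qed
    show "AE \<omega> in M. norm (?f n \<omega>) \<le> (\<Sum>t. ?r t \<omega>) + vbound" for n
      using abs_sum
    proof eventually_elim
      case (elim \<omega>)
      have "\<bar>Rsum k s (Suc n) \<omega>\<bar> \<le> (\<Sum>t<Suc n. ?r t \<omega>)"
        unfolding Rsum_def using \<gamma>_nonneg by (intro order_trans[OF sum_abs] sum_mono) (simp add: abs_mult)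
      also have "\<dots> \<le> (\<Sum>t. ?r t \<omega>)" using \<gamma>_nonneg by (intro sum_le_suminf elim) auto
      finally have R: "\<bar>Rsum k s (Suc n) \<omega>\<bar> \<le> (\<Sum>t. ?r t \<omega>)" .
      have qb: "\<bar>qval (vn k n \<omega>) x a\<bar> \<le> vbound" by (rule qval_vn_bounded[OF a])
      have "norm (?f n \<omega>) \<le> \<bar>Rsum k s (Suc n) \<omega> - qval (vn k n \<omega>) x a\<bar>"
        by (auto simp: indicator_def)
      also have "\<dots> \<le> (\<Sum>t. ?r t \<omega>) + vbound" using R qb by linarith
      finally show ?case .
    qed
  qed measurable
  then show ?thesis unfolding zero by (rule LIMSEQ_unique[OF tendsto_const, symmetric])
qed

text \<open>From \<open>(r - q)\<^sup>2 \<le> 2 * r\<^sup>2 + 2 * q\<^sup>2\<close> for the return r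
  and its centering q. One factor 1/(1 - gamma) stems from \<open>discounted_sum_squared_le\<close>,
  the other from summing the discounts.\<close>

definition errbound :: real where
  "errbound = 2 * sqbound / (1 - \<gamma>)\<^sup>2 + 2 * vbound\<^sup>2"

lemma errbound_nonneg: "0 \<le> errbound"
  using sqbound_nonneg by (simp add: errbound_def)

lemma suminf_discount: "(\<Sum>t. ennreal (\<gamma> ^ t)) = ennreal (1 / (1 - \<gamma>))"
  using \<gamma>_nonneg \<gamma>_less_1 by (subst suminf_ennreal2) (auto simp: suminf_geometric)

text \<open>The bound must be proportional to the probability of the event and not merely constant.
  This works because \<open>reward_square\<close> bounds every later reward relative to the same
  event.\<close>

lemma err_square_FV:
  assumes E: "E \<in> sets (F k)" and a: "a \<in> A x"
  shows "(\<integral>\<^sup>+\<omega>. indicator E \<omega> * indicator (FV k s x a) \<omega> * ennreal ((err k x a \<omega>)\<^sup>2) \<partial>M)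
    \<le> ennreal errbound * (\<integral>\<^sup>+\<omega>. indicator E \<omega> * indicator (FV k s x a) \<omega> \<partial>M)" (is "_ \<le> _ * ?p")
proof -
  have [measurable]: "E \<in> events" by (rule in_F_sets[OF E])
  have [measurable]: "FV k s x a \<in> events" by (rule FV_sets[OF a])
  let ?I = "\<lambda>\<omega>. indicator E \<omega> * indicator (FV k s x a) \<omega> :: ennreal"
  let ?R = "\<lambda>t \<omega>. ennreal ((Rs (Suc k) (Suc (s + t)) \<omega>)\<^sup>2)"
  have pt: "AE \<omega> in M. ?I \<omega> * ennreal ((err k x a \<omega>)\<^sup>2)
      \<le> ennreal (2 / (1 - \<gamma>)) * (\<Sum>t. ennreal (\<gamma> ^ t) * (?I \<omega> * ?R t \<omega>)) + ennreal (2 * vbound\<^sup>2) * ?I \<omega>"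
    using AE_summable_rewards AE_FV_indicator[of k x a, where 'b = ennreal]
  proof eventually_elim
    case (elim \<omega>)
    let ?T = "\<Sum>t. \<gamma> ^ t * (Rs (Suc k) (Suc (s + t)) \<omega>)\<^sup>2"
    show ?case
    proof (cases "vis (Suc k) x a \<omega> \<and> s = fvt k x a \<omega>")
      case True
      let ?q = "qval (Vsm (plc k \<omega>)) x a"
      have sum: "summable (\<lambda>t. \<gamma> ^ t * (Rs (Suc k) (Suc (s + t)) \<omega>)\<^sup>2)" using elim(1) by blast
      have T: "0 \<le> ?T" using \<gamma>_nonneg by (intro suminf_nonneg sum) simp
      have rtn: "rtn (Suc k) x a \<omega> = (\<Sum>t. \<gamma> ^ t * Rs (Suc k) (Suc (s + t)) \<omega>)"
        by (rule rtn_first_visit) (use True in auto)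
      have "(rtn (Suc k) x a \<omega>)\<^sup>2 \<le> ?T / (1 - \<gamma>)"
        unfolding rtn by (rule discounted_sum_squared_le(2)[OF \<gamma>_nonneg \<gamma>_less_1 sum])
      moreover have "?q\<^sup>2 \<le> vbound\<^sup>2"
        by (subst power2_abs[symmetric]) (rule power_mono[OF qval_Vsm_bounded[OF a] abs_ge_zero])
      moreover have "(err k x a \<omega>)\<^sup>2 \<le> 2 * (rtn (Suc k) x a \<omega>)\<^sup>2 + 2 * ?q\<^sup>2"
        using sum_squares_bound[of "rtn (Suc k) x a \<omega>" "- ?q"] True
        by (simp add: err_def power2_diff)
      ultimately have "(err k x a \<omega>)\<^sup>2 \<le> 2 / (1 - \<gamma>) * ?T + 2 * vbound\<^sup>2" by simp
      then have "ennreal ((err k x a \<omega>)\<^sup>2) \<le> ennreal (2 / (1 - \<gamma>) * ?T + 2 * vbound\<^sup>2)" by (rule ennreal_leI)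
      also have "\<dots> = ennreal (2 / (1 - \<gamma>)) * ennreal ?T + ennreal (2 * vbound\<^sup>2)"
        using T \<gamma>_less_1 by (simp add: ennreal_plus flip: ennreal_mult)
      also have "ennreal ?T = (\<Sum>t. ennreal (\<gamma> ^ t) * ?R t \<omega>)"
        using \<gamma>_nonneg by (subst suminf_ennreal2[OF _ sum, symmetric]) (auto simp: ennreal_mult)
      finally have *: "ennreal ((err k x a \<omega>)\<^sup>2)
        \<le> ennreal (2 / (1 - \<gamma>)) * (\<Sum>t. ennreal (\<gamma> ^ t) * ?R t \<omega>) + ennreal (2 * vbound\<^sup>2)" .
      show ?thesis
      proof (cases "\<omega> \<in> E")
        case True
        then show ?thesis using * elim(2) \<open>vis (Suc k) x a \<omega> \<and> s = fvt k x a \<omega>\<close> by simp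
      qed simp
    next
      case False
      then have "indicator (FV k s x a) \<omega> = (0::ennreal)" using elim(2) by simp
      then show ?thesis by simp
    qed
  qed
  have "(\<integral>\<^sup>+\<omega>. ?I \<omega> * ennreal ((err k x a \<omega>)\<^sup>2) \<partial>M)
    \<le> (\<integral>\<^sup>+\<omega>. ennreal (2 / (1 - \<gamma>)) * (\<Sum>t. ennreal (\<gamma> ^ t) * (?I \<omega> * ?R t \<omega>)) + ennreal (2 * vbound\<^sup>2) * ?I \<omega> \<partial>M)"
    by (rule nn_integral_mono_AE[OF pt])
  also have "\<dots> = ennreal (2 / (1 - \<gamma>)) * (\<Sum>t. ennreal (\<gamma> ^ t) * (\<integral>\<^sup>+\<omega>. ?I \<omega> * ?R t \<omega> \<partial>M)) + ennreal (2 * vbound\<^sup>2) * ?p"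
    by (simp add: nn_integral_add nn_integral_cmult nn_integral_suminf)
  also have "\<dots> \<le> ennreal (2 / (1 - \<gamma>)) * (\<Sum>t. ennreal (\<gamma> ^ t) * (ennreal sqbound * ?p)) + ennreal (2 * vbound\<^sup>2) * ?p"
    by (intro add_right_mono mult_left_mono suminf_le reward_square E fv_subset a) auto
  also have "\<dots> = (ennreal (2 / (1 - \<gamma>)) * (ennreal (1 / (1 - \<gamma>)) * ennreal sqbound) + ennreal (2 * vbound\<^sup>2)) * ?p"
    unfolding ennreal_suminf_multc suminf_discount by (simp only: distrib_right mult.assoc)
  also have "ennreal (2 / (1 - \<gamma>)) * (ennreal (1 / (1 - \<gamma>)) * ennreal sqbound) + ennreal (2 * vbound\<^sup>2) = ennreal errbound"
  proof -
    have "errbound = 2 / (1 - \<gamma>) * (1 / (1 - \<gamma>) * sqbound) + 2 * vbound\<^sup>2"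
      by (simp add: errbound_def power2_eq_square)
    then show ?thesis using sqbound_nonneg \<gamma>_less_1 by (simp add: ennreal_plus flip: ennreal_mult)
  qed
  finally show ?thesis .
qed

lemma AE_FV_suminf: "AE \<omega> in M. (\<Sum>s. indicator (FV k s x a) \<omega>) = (of_bool (vis (Suc k) x a \<omega>) :: ennreal)"
  using AE_FV_indicator[of k x a, where 'b = ennreal]
proof eventually_elim
  case (elim \<omega>)
  show ?case
  proof (cases "vis (Suc k) x a \<omega>")
    case True
    then have "(\<lambda>s. indicator (FV k s x a) \<omega> :: ennreal) = (\<lambda>s. if s = fvt k x a \<omega> then 1 else 0)"
      using elim by auto
    then show ?thesis using True sums_unique[OF sums_single[of "fvt k x a \<omega>" "\<lambda>_. 1 :: ennreal"]] by simp
  next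
    case False
    then have "(\<lambda>s. indicator (FV k s x a) \<omega> :: ennreal) = (\<lambda>s. 0)" using elim by auto
    then show ?thesis using False by simp
  qed
qed

text \<open>The first-visit events sum to the indicator of a visit, and \<open>err\<close> vanishes
  off visits. The indicator survives on the right, as \<open>D_var\<close> demands.\<close>

lemma err_square:
  assumes E: "E \<in> sets (F k)" and a: "a \<in> A x"
  shows "(\<integral>\<^sup>+\<omega>. indicator E \<omega> * ennreal ((err k x a \<omega>)\<^sup>2) \<partial>M)
    \<le> ennreal errbound * (\<integral>\<^sup>+\<omega>. indicator E \<omega> * of_bool (vis (Suc k) x a \<omega>) \<partial>M)"
proof -
  have [measurable]: "E \<in> events" by (rule in_F_sets[OF E])
  have [measurable]: "FV k s x a \<in> events" for s by (rule FV_sets[OF a])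
  have "(\<integral>\<^sup>+\<omega>. indicator E \<omega> * ennreal ((err k x a \<omega>)\<^sup>2) \<partial>M)
    = (\<integral>\<^sup>+\<omega>. (\<Sum>s. indicator E \<omega> * indicator (FV k s x a) \<omega> * ennreal ((err k x a \<omega>)\<^sup>2)) \<partial>M)"
  proof (rule nn_integral_cong_AE, use AE_FV_suminf[of k x a] in eventually_elim)
    fix \<omega> assume *: "(\<Sum>s. indicator (FV k s x a) \<omega>) = (of_bool (vis (Suc k) x a \<omega>) :: ennreal)"
    have "(\<Sum>s. indicator E \<omega> * indicator (FV k s x a) \<omega> * ennreal ((err k x a \<omega>)\<^sup>2))
      = indicator E \<omega> * of_bool (vis (Suc k) x a \<omega>) * ennreal ((err k x a \<omega>)\<^sup>2)"
      unfolding ennreal_suminf_multc ennreal_suminf_cmult * ..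
    then show "indicator E \<omega> * ennreal ((err k x a \<omega>)\<^sup>2)
      = (\<Sum>s. indicator E \<omega> * indicator (FV k s x a) \<omega> * ennreal ((err k x a \<omega>)\<^sup>2))"
      by (simp add: err_def)
  qed
  also have "\<dots> = (\<Sum>s. \<integral>\<^sup>+\<omega>. indicator E \<omega> * indicator (FV k s x a) \<omega> * ennreal ((err k x a \<omega>)\<^sup>2) \<partial>M)"
    by (rule nn_integral_suminf) measurable
  also have "\<dots> \<le> (\<Sum>s. ennreal errbound * (\<integral>\<^sup>+\<omega>. indicator E \<omega> * indicator (FV k s x a) \<omega> \<partial>M))"
    by (intro suminf_le err_square_FV E a) auto
  also have "\<dots> = ennreal errbound * (\<Sum>s. \<integral>\<^sup>+\<omega>. indicator E \<omega> * indicator (FV k s x a) \<omega> \<partial>M)"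
    by (rule ennreal_suminf_cmult)
  also have "(\<Sum>s. \<integral>\<^sup>+\<omega>. indicator E \<omega> * indicator (FV k s x a) \<omega> \<partial>M)
    = (\<integral>\<^sup>+\<omega>. (\<Sum>s. indicator E \<omega> * indicator (FV k s x a) \<omega>) \<partial>M)"
    by (rule nn_integral_suminf[symmetric]) measurable
  also have "\<dots> = (\<integral>\<^sup>+\<omega>. indicator E \<omega> * of_bool (vis (Suc k) x a \<omega>) \<partial>M)"
    unfolding ennreal_suminf_cmult
    by (rule nn_integral_cong_AE, use AE_FV_suminf[of k x a] in eventually_elim) simp
  finally show ?thesis .
qed

lemma integrable_err_square:
  assumes a: "a \<in> A x"
  shows "integrable M (\<lambda>\<omega>. (err k x a \<omega>)\<^sup>2)"
proof (rule integrableI_bounded)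
  have sp: "space M \<in> sets (F k)" using sets.top[of "F k"] by simp
  have "(\<integral>\<^sup>+\<omega>. ennreal (norm ((err k x a \<omega>)\<^sup>2)) \<partial>M) = (\<integral>\<^sup>+\<omega>. indicator (space M) \<omega> * ennreal ((err k x a \<omega>)\<^sup>2) \<partial>M)"
    by (intro nn_integral_cong) simp
  also have "\<dots> \<le> ennreal errbound * (\<integral>\<^sup>+\<omega>. indicator (space M) \<omega> * of_bool (vis (Suc k) x a \<omega>) \<partial>M)"
    by (rule err_square[OF sp a])
  also have "\<dots> \<le> ennreal errbound * (\<integral>\<^sup>+\<omega>. 1 \<partial>M)"
    by (intro mult_left_mono nn_integral_mono) auto
  also have "\<dots> < \<infinity>" by (simp add: emeasure_space_1)
  finally show "(\<integral>\<^sup>+\<omega>. ennreal (norm ((err k x a \<omega>)\<^sup>2)) \<partial>M) < \<infinity>" .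
qed measurable

text \<open>The mean is 0 on each first-visit event. Dominated convergence exchanges the sum over
  times with the integral; the absolute error is integrable by its second moment.\<close>

lemma err_mean:
  assumes E: "E \<in> sets (F k)" and a: "a \<in> A x"
  shows "(\<integral>\<omega>. indicator E \<omega> * err k x a \<omega> \<partial>M) = 0"
proof -
  have [measurable]: "E \<in> events" by (rule in_F_sets[OF E])
  have [measurable]: "FV k s x a \<in> events" for s by (rule FV_sets[OF a])
  have int: "integrable M (err k x a)"
    by (rule square_integrable_imp_integrable[OF _ integrable_err_square[OF a]]) measurable
  have Eint: "integrable M (\<lambda>\<omega>. indicator E \<omega> * err k x a \<omega>)" by (intro integrable_indicator_mult int) simp
  let ?f = "\<lambda>n \<omega>. \<Sum>s<n. indicator (FV k s x a) \<omega> * (indicator E \<omega> * err k x a \<omega>)"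
  have zero: "(\<integral>\<omega>. ?f n \<omega> \<partial>M) = 0" for n
    by (subst Bochner_Integration.integral_sum)
      (auto intro!: integrable_indicator_mult[OF _ Eint] simp: err_mean_FV[OF E a])
  have pt: "AE \<omega> in M. \<forall>n. ?f n \<omega> = (if vis (Suc k) x a \<omega> \<and> fvt k x a \<omega> < n then indicator E \<omega> * err k x a \<omega> else 0)"
    using AE_FV_indicator[of k x a, where 'b = real]
  proof eventually_elim
    case (elim \<omega>)
    show ?case
    proof
      fix n
      have "?f n \<omega> = (\<Sum>s<n. if s = fvt k x a \<omega> then (if vis (Suc k) x a \<omega> then indicator E \<omega> * err k x a \<omega> else 0) else 0)"
        using elim by (intro sum.cong refl) auto
      then show "?f n \<omega> = (if vis (Suc k) x a \<omega> \<and> fvt k x a \<omega> < n then indicator E \<omega> * err k x a \<omega> else 0)"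
        by simp
    qed
  qed
  have "(\<lambda>n. \<integral>\<omega>. ?f n \<omega> \<partial>M) \<longlonglongrightarrow> (\<integral>\<omega>. indicator E \<omega> * err k x a \<omega> \<partial>M)"
  proof (rule integral_dominated_convergence)
    show "integrable M (\<lambda>\<omega>. \<bar>indicator E \<omega> * err k x a \<omega>\<bar>)" using Eint by simp
    show "AE \<omega> in M. (\<lambda>n. ?f n \<omega>) \<longlonglongrightarrow> indicator E \<omega> * err k x a \<omega>"
      using pt
    proof eventually_elim
      case (elim \<omega>)
      have "\<forall>\<^sub>F n in sequentially. ?f n \<omega> = indicator E \<omega> * err k x a \<omega>"
        using eventually_gt_at_top[of "fvt k x a \<omega>"]
      proof eventually_elim
        case (elim n)
        \<comment> \<open>Without a visit the partial sums are 0, and so is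
          \<open>err\<close>.\<close>
        then show ?case using \<open>\<forall>n. _ n\<close> by (cases "vis (Suc k) x a \<omega>") (simp_all add: err_def)
      qed
      then show ?case by (rule tendsto_eventually)
    qed
    show "AE \<omega> in M. norm (?f n \<omega>) \<le> \<bar>indicator E \<omega> * err k x a \<omega>\<bar>" for n
      using pt
    proof eventually_elim
      case (elim \<omega>)
      show ?case unfolding elim[rule_format] by simp
    qed
  qed measurable
  then show ?thesis unfolding zero by (rule LIMSEQ_unique[OF tendsto_const, symmetric])
qed

text \<open>The shift \<open>err (i - 1)\<close> puts the noise of episode \<open>i\<close> at
  position \<open>i\<close>. What remains is the passage from extended to real integrals in
  \<open>D_var\<close>.\<close>

lemma visit_noise_err:
  assumes a: "a \<in> A x"
  shows "visit_noise M F (\<lambda>i. err (i - 1) x a) (\<lambda>i. vis i x a) errbound"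
proof
  fix k E assume E: "E \<in> sets (F k)"
  have [measurable]: "E \<in> events" by (rule in_F_sets[OF E])
  have i1: "integrable M (\<lambda>\<omega>. indicator E \<omega> * (err k x a \<omega>)\<^sup>2)"
    by (intro integrable_indicator_mult integrable_err_square a) simp
  have i2: "integrable M (\<lambda>\<omega>. indicator E \<omega> * of_bool (vis (Suc k) x a \<omega>) :: real)"
    by (rule integrable_const_bound[of _ 1]) (auto simp: indicator_def)
  have "ennreal (\<integral>\<omega>. indicator E \<omega> * (err k x a \<omega>)\<^sup>2 \<partial>M) = (\<integral>\<^sup>+\<omega>. ennreal (indicator E \<omega> * (err k x a \<omega>)\<^sup>2) \<partial>M)"
    by (rule nn_integral_eq_integral[OF i1, symmetric]) simp
  also have "\<dots> = (\<integral>\<^sup>+\<omega>. indicator E \<omega> * ennreal ((err k x a \<omega>)\<^sup>2) \<partial>M)"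
    by (intro nn_integral_cong) (simp add: indicator_def)
  also have "\<dots> \<le> ennreal errbound * (\<integral>\<^sup>+\<omega>. indicator E \<omega> * of_bool (vis (Suc k) x a \<omega>) \<partial>M)"
    by (rule err_square[OF E a])
  also have "(\<integral>\<^sup>+\<omega>. indicator E \<omega> * of_bool (vis (Suc k) x a \<omega>) \<partial>M) = (\<integral>\<^sup>+\<omega>. ennreal (indicator E \<omega> * of_bool (vis (Suc k) x a \<omega>)) \<partial>M)"
    by (intro nn_integral_cong) (simp add: indicator_def)
  also have "\<dots> = ennreal (\<integral>\<omega>. indicator E \<omega> * of_bool (vis (Suc k) x a \<omega>) \<partial>M)"
    by (rule nn_integral_eq_integral[OF i2]) simp
  also have "ennreal errbound * \<dots> = ennreal (errbound * (\<integral>\<omega>. indicator E \<omega> * of_bool (vis (Suc k) x a \<omega>) \<partial>M))"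
    by (rule ennreal_mult[symmetric]) (auto intro: errbound_nonneg integral_nonneg_AE)
  finally show "(\<integral>\<omega>. indicator E \<omega> * (err (Suc k - 1) x a \<omega>)\<^sup>2 \<partial>M) \<le> errbound * (\<integral>\<omega>. indicator E \<omega> * of_bool (vis (Suc k) x a \<omega>) \<partial>M)"
    using errbound_nonneg by (subst (asm) ennreal_le_iff) (auto intro!: mult_nonneg_nonneg integral_nonneg_AE)
  show "(\<integral>\<omega>. indicator E \<omega> * err (Suc k - 1) x a \<omega> \<partial>M) = 0"
    using err_mean[OF E a] by simp
next
  show "err (Suc k - 1) x a \<omega> = 0" if "\<not> vis (Suc k) x a \<omega>" for k \<omega>
    using that by (simp add: err_def)
qed (auto intro: F_sub err_F vis_F integrable_err_square[OF a] errbound_nonneg)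

section \<open>Exploration rates force infinitely many visits\<close>

definition visit_rate :: "'s \<Rightarrow> nat \<Rightarrow> real" where
  "visit_rate x k = pmf \<mu>0 x / (real (card (A x)) * (1 + real (card (A x)) * real k))"

lemma card_A_pos: "1 \<le> card (A x)"
  using A_fin A_ne by (simp add: Suc_le_eq card_gt_0_iff)

lemma visit_rate_bounds: "0 \<le> visit_rate x k" "visit_rate x k \<le> 1"
proof -
  show "0 \<le> visit_rate x k" by (simp add: visit_rate_def)
  have "1 * 1 \<le> real (card (A x)) * (1 + real (card (A x)) * real k)"
    using card_A_pos[of x] by (intro mult_mono) auto
  then show "visit_rate x k \<le> 1"
    using pmf_le_1[of \<mu>0 x] by (simp add: visit_rate_def divide_le_eq)
qed

lemma not_summable_visit_rate: "\<not> summable (visit_rate x)"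
proof
  let ?N = "real (card (A x))"
  assume "summable (visit_rate x)"
  \<comment> \<open>With N = \<open>card (A x)\<close> this multiple equals N/(1 + N k), which is at
    least 1/(k + 1) because N >= 1.\<close>
  then have "summable (\<lambda>k. ?N * ?N / pmf \<mu>0 x * visit_rate x k)" by (rule summable_mult)
  then have "summable (\<lambda>k. inverse (real (Suc k)))"
  proof (rule summable_comparison_test'[where N = 0])
    fix k
    have N: "1 \<le> ?N" using card_A_pos[of x] by simp
    have "?N * ?N / pmf \<mu>0 x * visit_rate x k = ?N / (1 + ?N * real k)"
      using N \<mu>0[of x] by (simp add: visit_rate_def)
    moreover have "inverse (real (Suc k)) \<le> ?N / (1 + ?N * real k)"
    proof -
      have "1 + ?N * real k \<le> ?N * real (Suc k)" using N by (simp add: algebra_simps)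
      moreover have "0 < 1 + ?N * real k" using N by (intro add_pos_nonneg) auto
      ultimately have "?N / (?N * real (Suc k)) \<le> ?N / (1 + ?N * real k)"
        using N by (intro divide_left_mono mult_pos_pos) auto
      moreover have "?N / (?N * real (Suc k)) = inverse (real (Suc k))"
        using N by (simp add: inverse_eq_divide del: of_nat_Suc)
      ultimately show ?thesis by simp
    qed
    ultimately show "norm (inverse (real (Suc k))) \<le> ?N * ?N / pmf \<mu>0 x * visit_rate x k" by simp
  qed
  then have "summable (\<lambda>k. inverse (real k))" by (subst (asm) summable_Suc_iff)
  then show False using not_summable_harmonic[where 'a = real] by blast
qed

text \<open>At most \<open>card (A x)\<close> counters have grown by at most 1 per episode, and for
  a base of at least 1 the condition \<open>\<theta> \<le> 1\<close> keeps the power above the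
  reciprocal.\<close>

lemma eps_ge: "1 / (1 + real (card (A x)) * real k) \<le> eps A \<theta> X Ac k x"
proof -
  have "Nvis X Ac k x a \<le> k" for a
  proof -
    have "card {i\<in>{1..k}. visits X Ac i x a} \<le> card {1..k}" by (rule card_mono) auto
    then show ?thesis by (simp add: Nvis_def)
  qed
  then have "Nst A X Ac k x \<le> card (A x) * k"
    unfolding Nst_def using sum_bounded_above[of "A x" "\<lambda>a. Nvis X Ac k x a" k] by simp
  then have N: "1 + real (Nst A X Ac k x) \<le> 1 + real (card (A x)) * real k"
    by (simp flip: of_nat_mult)
  have "1 / (1 + real (card (A x)) * real k) \<le> 1 / (1 + real (Nst A X Ac k x))"
    using N by (intro divide_left_mono mult_pos_pos add_pos_nonneg) auto
  also have "\<dots> = (1 + real (Nst A X Ac k x)) powr (- 1)"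
    by (simp add: powr_minus_divide add_pos_nonneg)
  also have "\<dots> \<le> eps A \<theta> X Ac k x"
    unfolding eps_def using \<theta> by (intro powr_mono) auto
  finally show ?thesis .
qed

text \<open>Visits at time 0 suffice: the start is \<open>x\<close> with probability
  \<open>pmf \<mu>0 x\<close>, and then \<open>a\<close> is drawn with probability at least
  \<open>eps\<close> divided by \<open>card (A x)\<close>. By \<open>eps_ge\<close> the product is
  at least \<open>visit_rate x k\<close>, a number that does not depend on the outcome.\<close>

lemma no_visit_prob_le:
  assumes E: "E \<in> sets (F k)" and a: "a \<in> A x"
  shows "prob {\<omega>\<in>E. \<not> vis (Suc k) x a \<omega>} \<le> (1 - visit_rate x k) * prob E"
proof -
  have E_M [measurable]: "E \<in> events" by (rule in_F_sets[OF E])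
  let ?V = "evt k (Suc 0) {[(x, a)]}"
  have l: "[(x, a)] \<in> L (Suc 0)" using a by (simp add: L_def)
  have V [measurable]: "?V \<in> events" by (rule evt_sets) (use l in auto)
  have int_E: "integrable M (indicator E :: _ \<Rightarrow> real)"
    by (rule integrable_const_bound[of _ 1]) auto
  have le: "visit_rate x k \<le> pmf \<mu>0 x * plc k \<omega> x a" for \<omega>
  proof -
    have "visit_rate x k = pmf \<mu>0 x * (1 / (1 + real (card (A x)) * real k) / real (card (A x)))"
      by (simp add: visit_rate_def)
    also have "\<dots> \<le> pmf \<mu>0 x * (eps A \<theta> (\<lambda>i t. Xs i t \<omega>) (\<lambda>i t. As i t \<omega>) k x / real (card (A x)))"
      by (intro mult_left_mono divide_right_mono eps_ge) auto
    also have "\<dots> \<le> pmf \<mu>0 x * plc k \<omega> x a"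
      by (intro mult_left_mono pibar_ge \<theta> a) auto
    finally show ?thesis .
  qed
  have int_w: "integrable M (\<lambda>\<omega>. indicator E \<omega> * pathweight k l y \<omega>)" for l y
    using pathweight_bounds by (intro integrable_const_bound[of _ 1]) (auto simp: indicator_def)
  have "visit_rate x k * prob E = (\<integral>\<omega>. indicator E \<omega> * visit_rate x k \<partial>M)"
    by simp
  also have "\<dots> \<le> (\<integral>\<omega>. (\<Sum>y\<in>UNIV. indicator E \<omega> * pathweight k [(x, a)] y \<omega>) \<partial>M)"
  proof (rule Bochner_Integration.integral_mono)
    show "integrable M (\<lambda>\<omega>. indicator E \<omega> * visit_rate x k)" using int_E by simp
    show "integrable M (\<lambda>\<omega>. \<Sum>y\<in>UNIV. indicator E \<omega> * pathweight k [(x, a)] y \<omega>)"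
      by (intro Bochner_Integration.integrable_sum int_w)
    fix \<omega>
    have "(\<Sum>y\<in>UNIV. pathweight k [(x, a)] y \<omega>) = pmf \<mu>0 x * plc k \<omega> x a"
      using pathweight_snoc[of k "[]" x a] by (simp add: pathweight_Nil sum_pmf_UNIV flip: sum_distrib_left)
    then show "indicator E \<omega> * visit_rate x k \<le> (\<Sum>y\<in>UNIV. indicator E \<omega> * pathweight k [(x, a)] y \<omega>)"
      unfolding sum_distrib_left[symmetric] using le[of \<omega>] by (simp add: mult_left_mono)
  qed
  also have "\<dots> = (\<Sum>y\<in>UNIV. \<integral>\<omega>. indicator E \<omega> * pathweight k [(x, a)] y \<omega> \<partial>M)"
    by (rule Bochner_Integration.integral_sum[OF int_w])
  also have "\<dots> = (\<Sum>y\<in>UNIV. \<integral>\<omega>. indicator (pth k [(x, a)] y) \<omega> * indicator E \<omega> \<partial>M)"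
    unfolding path_integral[OF E, symmetric] by (simp only: mult.commute)
  also have "\<dots> = (\<integral>\<omega>. indicator ?V \<omega> * indicator E \<omega> \<partial>M)"
    by (rule integral_evt_singleton[OF l int_E, symmetric])
  also have "\<dots> = prob (?V \<inter> E)"
    by (simp flip: indicator_inter_arith)
  finally have lower: "visit_rate x k * prob E \<le> prob (?V \<inter> E)" .
  have V_vis: "vis (Suc k) x a \<omega>" if "\<omega> \<in> ?V" for \<omega>
    using that by (auto simp: evt_def hist_def visits_def)
  have "prob {\<omega>\<in>E. \<not> vis (Suc k) x a \<omega>} \<le> prob (E - ?V \<inter> E)"
    using V_vis by (intro finite_measure_mono) auto
  also have "\<dots> = prob E - prob (?V \<inter> E)"
    by (rule finite_measure_Diff) auto
  also have "\<dots> \<le> (1 - visit_rate x k) * prob E" using lower by (simp add: left_diff_distrib)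
  finally show ?thesis .
qed

lemma AE_visits_at_top:
  assumes "a \<in> A x"
  shows "AE \<omega> in M. filterlim (vcount (\<lambda>i. vis i x a \<omega>)) at_top sequentially"
  by (rule AE_infinitely_many_visits[where F = F and c = "visit_rate x"])
    (simp_all add: F_sub vis_F no_visit_prob_le assms visit_rate_bounds not_summable_visit_rate)

section \<open>Vanishing of the noise average and the almost sure limit\<close>

lemma AE_averaged_error_null:
  assumes "a \<in> A x"
  shows "AE \<omega> in M. (\<lambda>k. (\<Sum>i<k. err i x a \<omega>) / real (vcount (\<lambda>i. vis i x a \<omega>) k)) \<longlonglongrightarrow> 0"
proof -
  interpret visit_noise M F "\<lambda>i. err (i - 1) x a" "\<lambda>i. vis i x a" errbound
    by (rule visit_noise_err[OF assms])
  show ?thesis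
    using AE_visit_average_null AE_visits_at_top[OF assms] by eventually_elim simp
qed

text \<open>The return is 0 in episodes without a visit, so the unrestricted sum in
  \<open>Qbar\<close> matches the sum over visits. Before the first visit all quotients are 0 by the
  convention for division by 0.\<close>

lemma Qbar_error:
  "Qbar \<gamma> (\<lambda>i t. Xs i t \<omega>) (\<lambda>i t. As i t \<omega>) (\<lambda>i t. Rs i t \<omega>) k x a -
    (\<Sum>i\<in>{i\<in>{1..k}. vis i x a \<omega>}. qval (Vsm (plc (i - 1) \<omega>)) x a) / real (vcount (\<lambda>i. vis i x a \<omega>) k)
   = (\<Sum>i<k. err i x a \<omega>) / real (vcount (\<lambda>i. vis i x a \<omega>) k)"
proof -
  have "(\<Sum>i\<in>{1..k}. rtn i x a \<omega>) - (\<Sum>i\<in>{i\<in>{1..k}. vis i x a \<omega>}. qval (Vsm (plc (i - 1) \<omega>)) x a)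
    = (\<Sum>i\<in>{1..k}. rtn i x a \<omega> - (if vis i x a \<omega> then qval (Vsm (plc (i - 1) \<omega>)) x a else 0))"
    by (subst sum.inter_filter) (simp_all only: finite_atLeastAtMost sum_subtractf)
  also have "\<dots> = (\<Sum>i<k. rtn (Suc i) x a \<omega> - (if vis (Suc i) x a \<omega> then qval (Vsm (plc i \<omega>)) x a else 0))"
    unfolding One_nat_def sum.atLeast1_atMost_eq by (simp only: diff_Suc_Suc diff_zero)
  also have "\<dots> = (\<Sum>i<k. err i x a \<omega>)"
    by (intro sum.cong refl) (simp add: err_def ret_def)
  finally show ?thesis
    unfolding Qbar_def Nvis_eq_vcount diff_divide_distrib[symmetric] by simp
qed

text \<open>The count of a single action already drives the count of its state to infinity.\<close>

lemma eps_tendsto_0: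
  assumes "\<And>a. a \<in> A x \<Longrightarrow> filterlim (vcount (\<lambda>i. visits X Ac i x a)) at_top sequentially"
  shows "(\<lambda>k. eps A \<theta> X Ac k x) \<longlonglongrightarrow> 0"
proof -
  obtain a where a: "a \<in> A x" using A_ne by blast
  have "filterlim (\<lambda>k. real (vcount (\<lambda>i. visits X Ac i x a) k)) at_top sequentially"
    by (rule filterlim_compose[OF filterlim_real_sequentially assms[OF a]])
  then have "filterlim (\<lambda>k. 1 + real (Nst A X Ac k x)) at_top sequentially"
  proof (rule filterlim_at_top_mono)
    show "\<forall>\<^sub>F k in sequentially. real (vcount (\<lambda>i. visits X Ac i x a) k) \<le> 1 + real (Nst A X Ac k x)"
    proof (intro always_eventually allI)
      fix k
      have "Nvis X Ac k x a \<le> Nst A X Ac k x"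
        unfolding Nst_def by (rule member_le_sum) (use a A_fin in auto)
      then show "real (vcount (\<lambda>i. visits X Ac i x a) k) \<le> 1 + real (Nst A X Ac k x)"
        by (simp add: Nvis_eq_vcount)
    qed
  qed
  then show ?thesis unfolding eps_def using \<theta> by (intro tendsto_neg_powr) auto
qed

text \<open>There are finitely many pairs, so their exceptional sets form one null set, off which
  the deterministic argument applies outcome by outcome.\<close>

lemma convergence:
  assumes \<gamma>: "\<gamma> < 1 / 2"
  shows "AE \<omega> in M. \<forall>x. (\<lambda>k. Vsm (plc k \<omega>) x) \<longlonglongrightarrow> Vopt x"
proof -
  let ?Z = "Sigma UNIV A"
  have fin: "finite ?Z" by (intro finite_SigmaI A_fin) auto
  have "AE \<omega> in M. \<forall>(x, a)\<in>?Z. filterlim (vcount (\<lambda>i. vis i x a \<omega>)) at_top sequentially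
      \<and> (\<lambda>k. (\<Sum>i<k. err i x a \<omega>) / real (vcount (\<lambda>i. vis i x a \<omega>) k)) \<longlonglongrightarrow> 0"
    using fin by (intro AE_finite_allI) (auto intro: AE_conjI AE_visits_at_top AE_averaged_error_null)
  then show ?thesis
  proof eventually_elim
    case (elim \<omega>)
    then have N: "filterlim (vcount (\<lambda>i. vis i x a \<omega>)) at_top sequentially"
      and err: "(\<lambda>k. (\<Sum>i<k. err i x a \<omega>) / real (vcount (\<lambda>i. vis i x a \<omega>) k)) \<longlonglongrightarrow> 0" if "a \<in> A x" for x a
      using that by auto
    show ?case
    proof
      fix x
      show "(\<lambda>k. Vsm (plc k \<omega>) x) \<longlonglongrightarrow> Vopt x"
      proof (rule Vsm_tends_to_Vopt[OF \<gamma>])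
        show "sm (plc k \<omega>)" for k by (rule sm_pibar[OF \<theta>(1)])
        show "filterlim (vcount (\<lambda>i. vis i x a \<omega>)) at_top sequentially" if "a \<in> A x" for x a
          by (rule N[OF that])
        show "(\<lambda>k. Qbar \<gamma> (\<lambda>i t. Xs i t \<omega>) (\<lambda>i t. As i t \<omega>) (\<lambda>i t. Rs i t \<omega>) k x a -
            (\<Sum>i\<in>{i\<in>{1..k}. vis i x a \<omega>}. qval (Vsm (plc (i - 1) \<omega>)) x a) / real (vcount (\<lambda>i. vis i x a \<omega>) k)) \<longlonglongrightarrow> 0"
          if "a \<in> A x" for x a
          unfolding Qbar_error by (rule err[OF that])
        show "(\<lambda>k. eps A \<theta> (\<lambda>i t. Xs i t \<omega>) (\<lambda>i t. As i t \<omega>) k y) \<longlonglongrightarrow> 0" for y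
          by (rule eps_tendsto_0[OF N])
      qed (rule pibar_nongreedy_le[OF \<theta>(1)])
    qed
  qed
qed

end

theorem theorem2p5:
  fixes A :: "'s::finite \<Rightarrow> 'a set"
    and P :: "'s \<Rightarrow> 'a \<Rightarrow> 's pmf"
    and S :: "'s \<Rightarrow> 'a \<Rightarrow> 's \<Rightarrow> real measure"
    and \<gamma> \<theta> :: real
    and \<mu>0 :: "'s pmf"
    and M :: "'m measure"
    and Xs :: "nat \<Rightarrow> nat \<Rightarrow> 'm \<Rightarrow> 's"
    and As :: "nat \<Rightarrow> nat \<Rightarrow> 'm \<Rightarrow> 'a"
    and Rs :: "nat \<Rightarrow> nat \<Rightarrow> 'm \<Rightarrow> real"
  assumes A_fin: "\<And>x. finite (A x)" and A_ne: "\<And>x. A x \<noteq> {}"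
    and S_prob: "\<And>x a y. a \<in> A x \<Longrightarrow> prob_space (S x a y)"
    and S_borel: "\<And>x a y. a \<in> A x \<Longrightarrow> sets (S x a y) = sets borel"
    and S_sq: "\<And>x a y. a \<in> A x \<Longrightarrow> integrable (S x a y) (\<lambda>z. z ^ 2)"
    and \<gamma>: "0 \<le> \<gamma>" "\<gamma> < 1 / 2"
    and \<theta>: "0 < \<theta>" "\<theta> \<le> 1"
    and \<mu>0: "\<And>x. 0 < pmf \<mu>0 x"
    and M: "prob_space M"
    and Xs_meas: "\<And>i t. Xs i t \<in> measurable M (count_space UNIV)"
    and As_meas: "\<And>i t. As i t \<in> measurable M (count_space UNIV)"
    and Rs_meas: "\<And>i t. Rs i t \<in> borel_measurable M"
    and algo: "\<And>k n xs as Bs E. (\<And>t. Bs t \<in> sets borel) \<Longrightarrow>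
        E \<in> sets (past_sigma M Xs As Rs k) \<Longrightarrow>
        emeasure M (E \<inter> {\<omega>\<in>space M. (\<forall>t\<le>n. Xs (Suc k) t \<omega> = xs t)
              \<and> (\<forall>t<n. As (Suc k) t \<omega> = as t \<and> Rs (Suc k) (Suc t) \<omega> \<in> Bs t)})
        = (\<integral>\<^sup>+\<omega>. indicator E \<omega> * ennreal (pmf \<mu>0 (xs 0) *
              (\<Prod>t<n. pibar A \<gamma> \<theta> (\<lambda>i t. Xs i t \<omega>) (\<lambda>i t. As i t \<omega>) (\<lambda>i t. Rs i t \<omega>) k (xs t) (as t)
                     * pmf (P (xs t) (as t)) (xs (Suc t))
                     * measure (S (xs t) (as t) (xs (Suc t))) (Bs t))) \<partial>M)"
  shows "AE \<omega> in M. \<forall>x. (\<lambda>k. Vpol A P S \<gamma>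
            (sm_policy (pibar A \<gamma> \<theta> (\<lambda>i t. Xs i t \<omega>) (\<lambda>i t. As i t \<omega>) (\<lambda>i t. Rs i t \<omega>) k)) x)
          \<longlonglongrightarrow> Vstar A P S \<gamma> x"
proof -
  interpret mdp A P S \<gamma>
    using A_fin A_ne \<gamma> by unfold_locales auto
  interpret prob_space M by (rule M)
  interpret monte_carlo A P S \<gamma> M \<theta> \<mu>0 Xs As Rs
    by (intro monte_carlo.intro monte_carlo_axioms.intro)
      (fact mdp_axioms prob_space_axioms S_prob S_borel S_sq \<theta> \<mu>0 Xs_meas As_meas Rs_meas algo)+
  show ?thesis by (rule convergence[OF \<gamma>(2)])
qed

end
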